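(* Let $\Pi:F\to M$ be a smooth fibration over a Riemannian manifold $M$ whose fibres are Riemannian manifolds (the metrics forming a smooth inner product on the vertical bundle $\mathcal V\subseteq T(F)$), and let $\mathcal H\subseteq T(F)$ be a complementary sub-bundle to $\mathcal V$. For $\lambda\in[1,\infty)$ let $\nabla^{\lambda r}$ be the Riemannian (Levi-Civita) connection of the metric $\langle\,,\rangle^\lambda$ on $F$, and let $\nabla^\oplus=\nabla^{\mathcal V}\oplus\nabla^{\mathcal H}$ be the direct sum connection. Set $\tilde\nabla^r=\lim_{\lambda\to\infty}\nabla^{\lambda r}$. Then $\tilde\nabla^r$ is a well defined connection on $T(F)$, and $\tilde\nabla^r$ is $CS$ equivalent to $\nabla^\oplus$.
   Context: $\mathcal V=\ker\Pi_*$, and $T(F)=\mathcal V\oplus\mathcal H$ with $\mathcal H\cong\Pi^*T(M)$. For $\lambda\ge1$, the metric $\langle\,,\rangle^\lambda$ on $F$ equals the fibre metric on $\mathcal V$, equals $\lambda$ times the pullback of the metric of $M$ on $\mathcal H$, and makes $\mathcal V$ and $\mathcal H$ orthogonal. The limit of connections is the pointwise limit of the $\mathrm{End}(T(F))$-valued 1-forms $\nabla^{\lambda r}-\nabla^\oplus$. $\nabla^{\mathcal H}$ is the pullback to $\mathcal H\cong\Pi^*T(M)$ of the Riemannian connection of $M$. $\nabla^{\mathcal V}$ is the connection on $\mathcal V$ with, for vertical fields $X,Y,Z$ and $H$ the horizontal lift of a vector field on $M$: $\langle\nabla^{\mathcal V}_XY,Z\rangle=\langle\nabla_XY,Z\rangle$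 with $\nabla$ the Riemannian connection of the fibres, and $\langle\nabla^{\mathcal V}_HY,Z\rangle=\frac12\{\langle[H,Y],Z\rangle-\langle[H,Z],Y\rangle+H(\langle Y,Z\rangle)\}$. ($\nabla^{\mathcal V}$, $\nabla^{\mathcal H}$, $\nabla^\oplus$ do not depend on $\lambda$.) $CS$ equivalence: for connections $\nabla^0,\nabla^1$ on a real vector bundle of rank $n$ over a manifold $N$, a smooth curve of connections $\nabla^t$ joining them with curvature $R^t$, $B^t=\frac{d}{dt}\nabla^t$, and an invariant polynomial $P$ of degree $l$ on the Lie algebra of $GL(n,\mathbb R)$, set $TP(\nabla^0,\nabla^1)=l\int_0^1P(B^t\wedge R^t\wedge\cdots\wedge R^t)\,dt$ ($l-1$ factors $R^t$) modulo exact $(2l-1)$-forms; it is independent of the curve. $\nabla^0$ and $\nabla^1$ are $CS$ equivalent if $TP(\nabla^0,\nabla^1)$ is exact for all invariant polynomials $P$. *)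

theory Defs
  imports "HOL-Analysis.Analysis" "HOL-Combinatorics.Permutations"
begin

section \<open>Smooth manifolds\<close>

text \<open>\<open>Ck_on k S f\<close> is only meaningful for open \<open>S\<close>. On a finite-dimensional space it says that
  all iterated directional derivatives of order at most \<open>k\<close> exist and are continuous.\<close>

primrec Ck_on :: "nat \<Rightarrow> 'e::real_normed_vector set \<Rightarrow> ('e \<Rightarrow> 'f::real_normed_vector) \<Rightarrow> bool" where
  "Ck_on 0 = (\<lambda>S f. continuous_on S f)"
| "Ck_on (Suc k) = (\<lambda>S f. (\<forall>x\<in>S. f differentiable (at x)) \<and>
                          (\<forall>v. Ck_on k S (\<lambda>x. frechet_derivative f (at x) v)))"

definition smooth_on :: "'e::real_normed_vector set \<Rightarrow> ('e \<Rightarrow> 'f::real_normed_vector) \<Rightarrow> bool" where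
  "smooth_on S f \<longleftrightarrow> (\<forall>k. Ck_on k S f)"

type_synonym ('a, 'e) chart = "'a set \<times> ('a \<Rightarrow> 'e)"

abbreviation (input) chart_inv :: "('a, 'e) chart \<Rightarrow> 'e \<Rightarrow> 'a" where
  "chart_inv c \<equiv> inv_into (fst c) (snd c)"

text \<open>A manifold is a (Hausdorff, second countable) type with a smooth atlas; the atlas need not be
  maximal. The model space is a finite-dimensional normed space rather than a member of
  \<^class>\<open>euclidean_space\<close>, so that dimension \<open>0\<close> is not excluded.\<close>

definition smooth_manifold ::
    "('a::{t2_space,second_countable_topology}, 'e::real_normed_vector) chart set \<Rightarrow> bool" where
  "smooth_manifold A \<longleftrightarrow>
     (\<exists>B::'e set. finite B \<and> span B = UNIV) \<and>
     (\<Union>c\<in>A. fst c) = UNIV \<and>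
     (\<forall>c\<in>A. open (fst c) \<and> open (snd c ` fst c) \<and>
            homeomorphism (fst c) (snd c ` fst c) (snd c) (chart_inv c)) \<and>
     (\<forall>c\<in>A. \<forall>c'\<in>A. smooth_on (snd c ` (fst c \<inter> fst c')) (snd c' \<circ> chart_inv c))"

definition smooth_fun :: "('a, 'e::real_normed_vector) chart set \<Rightarrow> ('a \<Rightarrow> real) \<Rightarrow> bool" where
  "smooth_fun A f \<longleftrightarrow> (\<forall>c\<in>A. smooth_on (snd c ` fst c) (f \<circ> chart_inv c))"

definition smooth_map_on ::
    "('a::topological_space, 'e::real_normed_vector) chart set \<Rightarrow>
     ('b::topological_space, 'f::real_normed_vector) chart set \<Rightarrow> 'a set \<Rightarrow> ('a \<Rightarrow> 'b) \<Rightarrow> bool" where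
  "smooth_map_on A B W f \<longleftrightarrow> continuous_on W f \<and>
     (\<forall>c\<in>A. \<forall>d\<in>B. smooth_on (snd c ` (W \<inter> fst c \<inter> f -` fst d)) (snd d \<circ> f \<circ> chart_inv c))"

definition product_atlas ::
    "('a, 'e) chart set \<Rightarrow> ('b, 'f) chart set \<Rightarrow> ('a \<times> 'b, 'e \<times> 'f) chart set" where
  "product_atlas A B = {(fst c \<times> fst d, map_prod (snd c) (snd d)) | c d. c \<in> A \<and> d \<in> B}"


section \<open>Tangent vectors and vector fields\<close>

text \<open>Every point \<open>p\<close> gets a preferred chart, and the tangent space at \<open>p\<close> is identified with the
  model space \<open>'e\<close> by the differential of that chart. So a vector field is a map \<open>X :: 'a \<Rightarrow> 'e\<close>,
  where \<open>X p\<close> represents the tangent vector at \<open>p\<close> with components \<open>X p\<close> in the preferred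
  chart at \<open>p\<close>. The preferred charts vary discontinuously with \<open>p\<close>; hence smoothness of a field is
  always tested in a fixed chart, after applying the differential of that chart.\<close>

definition chart_at :: "('a, 'e) chart set \<Rightarrow> 'a \<Rightarrow> ('a, 'e) chart" where
  "chart_at A p = (SOME c. c \<in> A \<and> p \<in> fst c)"

text \<open>\<open>mderiv A f p v\<close> is the derivative at \<open>p\<close> of the vector-valued function \<open>f\<close> in the direction
  of the tangent vector \<open>v\<close>; \<open>mdiff A B f p\<close> is the differential at \<open>p\<close> of a map between
  manifolds, from the tangent space at \<open>p\<close> to the one at \<open>f p\<close>.\<close>

definition mderiv :: "('a, 'e::real_normed_vector) chart set \<Rightarrow> ('a \<Rightarrow> 'f::real_normed_vector) \<Rightarrow>
    'a \<Rightarrow> 'e \<Rightarrow> 'f" where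
  "mderiv A f p v = frechet_derivative (f \<circ> chart_inv (chart_at A p)) (at (snd (chart_at A p) p)) v"

definition mdiff :: "('a, 'e::real_normed_vector) chart set \<Rightarrow>
    ('b, 'f::real_normed_vector) chart set \<Rightarrow> ('a \<Rightarrow> 'b) \<Rightarrow> 'a \<Rightarrow> 'e \<Rightarrow> 'f" where
  "mdiff A B f p v = mderiv A (snd (chart_at B (f p)) \<circ> f) p v"

definition smooth_vf_on :: "('a, 'e::real_normed_vector) chart set \<Rightarrow> 'a set \<Rightarrow> ('a \<Rightarrow> 'e) \<Rightarrow> bool" where
  "smooth_vf_on A W X \<longleftrightarrow>
     (\<forall>c\<in>A. smooth_on (snd c ` (W \<inter> fst c))
              (\<lambda>x. mderiv A (snd c) (chart_inv c x) (X (chart_inv c x))))"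

abbreviation smooth_vf :: "('a, 'e::real_normed_vector) chart set \<Rightarrow> ('a \<Rightarrow> 'e) \<Rightarrow> bool" where
  "smooth_vf A \<equiv> smooth_vf_on A UNIV"

text \<open>In coordinates \<open>[X, Y] = DY(X) - DX(Y)\<close>, here computed in the preferred chart at \<open>p\<close>.\<close>

definition lie_bracket :: "('a, 'e::real_normed_vector) chart set \<Rightarrow> ('a \<Rightarrow> 'e) \<Rightarrow> ('a \<Rightarrow> 'e) \<Rightarrow>
    'a \<Rightarrow> 'e" where
  "lie_bracket A X Y p = (let \<phi> = snd (chart_at A p) in
     mderiv A (\<lambda>q. mderiv A \<phi> q (Y q)) p (X p) - mderiv A (\<lambda>q. mderiv A \<phi> q (X q)) p (Y p))"


section \<open>Sub-bundles of the tangent bundle, metrics, connections\<close>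

text \<open>A family \<open>S\<close> of subspaces of the tangent spaces is a smooth sub-bundle if it has local smooth
  frames \<open>X 0, \<dots>, X (r - 1)\<close>.\<close>

definition smooth_subbundle :: "('a::topological_space, 'e::real_normed_vector) chart set \<Rightarrow>
    ('a \<Rightarrow> 'e set) \<Rightarrow> bool" where
  "smooth_subbundle A S \<longleftrightarrow> (\<forall>p. subspace (S p)) \<and>
     (\<forall>p. \<exists>W r. \<exists>X :: nat \<Rightarrow> 'a \<Rightarrow> 'e. open W \<and> p \<in> W \<and> (\<forall>i<r. smooth_vf_on A W (X i)) \<and>
        (\<forall>q\<in>W. inj_on (\<lambda>i. X i q) {..<r} \<and> independent ((\<lambda>i. X i q) ` {..<r}) \<and>
               span ((\<lambda>i. X i q) ` {..<r}) = S q))"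

definition section_of :: "('a, 'e::real_normed_vector) chart set \<Rightarrow> ('a \<Rightarrow> 'e set) \<Rightarrow>
    ('a \<Rightarrow> 'e) \<Rightarrow> bool" where
  "section_of A S Y \<longleftrightarrow> smooth_vf A Y \<and> (\<forall>p. Y p \<in> S p)"

definition inner_product_on :: "'e::real_vector set \<Rightarrow> ('e \<Rightarrow> 'e \<Rightarrow> real) \<Rightarrow> bool" where
  "inner_product_on S b \<longleftrightarrow>
     (\<forall>x\<in>S. \<forall>y\<in>S. b x y = b y x) \<and>
     (\<forall>x\<in>S. \<forall>y\<in>S. \<forall>z\<in>S. b (x + y) z = b x z + b y z) \<and>
     (\<forall>x\<in>S. \<forall>y\<in>S. \<forall>a. b (a *\<^sub>R x) y = a * b x y) \<and>
     (\<forall>x\<in>S. x \<noteq> 0 \<longrightarrow> b x x > 0)"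

text \<open>A metric on the sub-bundle \<open>S\<close>; the values of \<open>g p\<close> outside \<open>S p\<close> are irrelevant. For
  \<open>S = (\<lambda>_. UNIV)\<close> this is a Riemannian metric on the manifold.\<close>

definition bundle_metric :: "('a, 'e::real_normed_vector) chart set \<Rightarrow> ('a \<Rightarrow> 'e set) \<Rightarrow>
    ('a \<Rightarrow> 'e \<Rightarrow> 'e \<Rightarrow> real) \<Rightarrow> bool" where
  "bundle_metric A S g \<longleftrightarrow> (\<forall>p. inner_product_on (S p) (g p)) \<and>
     (\<forall>X Y. section_of A S X \<and> section_of A S Y \<longrightarrow> smooth_fun A (\<lambda>p. g p (X p) (Y p)))"

text \<open>A covariant derivative is an operator \<open>D\<close> on global sections, \<open>D Y p v\<close> being the derivative
  of \<open>Y\<close> at \<open>p\<close> in direction \<open>v\<close>. Its values on maps \<open>Y\<close> that are not smooth sections of \<open>S\<close> are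
  irrelevant.\<close>

type_synonym ('a, 'e) cov_deriv = "('a \<Rightarrow> 'e) \<Rightarrow> 'a \<Rightarrow> 'e \<Rightarrow> 'e"

definition connection_on :: "('a, 'e::real_normed_vector) chart set \<Rightarrow> ('a \<Rightarrow> 'e set) \<Rightarrow>
    ('a, 'e) cov_deriv \<Rightarrow> bool" where
  "connection_on A S D \<longleftrightarrow> (\<forall>Y. section_of A S Y \<longrightarrow>
     (\<forall>p. linear (D Y p) \<and> range (D Y p) \<subseteq> S p) \<and>
     (\<forall>X. smooth_vf A X \<longrightarrow> smooth_vf A (\<lambda>p. D Y p (X p))) \<and>
     (\<forall>Z. section_of A S Z \<longrightarrow> (\<forall>p v. D (\<lambda>q. Y q + Z q) p v = D Y p v + D Z p v)) \<and>
     (\<forall>f. smooth_fun A f \<longrightarrow>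
        (\<forall>p v. D (\<lambda>q. f q *\<^sub>R Y q) p v = mderiv A f p v *\<^sub>R Y p + f p *\<^sub>R D Y p v)))"

abbreviation connection :: "('a, 'e::real_normed_vector) chart set \<Rightarrow> ('a, 'e) cov_deriv \<Rightarrow> bool" where
  "connection A \<equiv> connection_on A (\<lambda>_. UNIV)"

definition levi_civita :: "('a, 'e::real_normed_vector) chart set \<Rightarrow> ('a \<Rightarrow> 'e \<Rightarrow> 'e \<Rightarrow> real) \<Rightarrow>
    ('a, 'e) cov_deriv \<Rightarrow> bool" where
  "levi_civita A g D \<longleftrightarrow> connection A D \<and>
     (\<forall>X Y p. smooth_vf A X \<and> smooth_vf A Y \<longrightarrow> D Y p (X p) - D X p (Y p) = lie_bracket A X Y p) \<and>
     (\<forall>X Y Z p. smooth_vf A X \<and> smooth_vf A Y \<and> smooth_vf A Z \<longrightarrow>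
        mderiv A (\<lambda>q. g q (Y q) (Z q)) p (X p) = g p (D Y p (X p)) (Z p) + g p (Y p) (D Z p (X p)))"


section \<open>Fibrations\<close>

text \<open>\<open>T\<close> is a diffeomorphism of \<open>U \<times> C\<close> onto the part of the total space over \<open>U\<close>, where the
  type \<open>'c\<close> with atlas \<open>AC\<close> is the typical fibre. In particular \<open>\<lambda>y. T (x, y)\<close> is a
  diffeomorphism of the typical fibre onto the fibre over \<open>x\<close>.\<close>

definition local_trivialization ::
    "('a::topological_space, 'e::real_normed_vector) chart set \<Rightarrow>
     ('b::topological_space, 'm::real_normed_vector) chart set \<Rightarrow>
     ('c::topological_space, 'k::real_normed_vector) chart set \<Rightarrow>
     ('a \<Rightarrow> 'b) \<Rightarrow> 'b set \<Rightarrow> ('b \<times> 'c \<Rightarrow> 'a) \<Rightarrow> bool" where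
  "local_trivialization AF AM AC \<pi> U T \<longleftrightarrow> open U \<and>
     bij_betw T (U \<times> UNIV) (\<pi> -` U) \<and>
     (\<forall>x\<in>U. \<forall>y. \<pi> (T (x, y)) = x) \<and>
     smooth_map_on (product_atlas AM AC) AF (U \<times> UNIV) T \<and>
     smooth_map_on AF (product_atlas AM AC) (\<pi> -` U) (inv_into (U \<times> UNIV) T)"

definition smooth_fibration ::
    "('a::{t2_space,second_countable_topology}, 'e::real_normed_vector) chart set \<Rightarrow>
     ('b::{t2_space,second_countable_topology}, 'm::real_normed_vector) chart set \<Rightarrow>
     ('c::{t2_space,second_countable_topology}, 'k::real_normed_vector) chart set \<Rightarrow>
     ('a \<Rightarrow> 'b) \<Rightarrow> bool" where
  "smooth_fibration AF AM AC \<pi> \<longleftrightarrow>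
     smooth_manifold AF \<and> smooth_manifold AM \<and> smooth_manifold AC \<and>
     smooth_map_on AF AM UNIV \<pi> \<and>
     (\<forall>x. \<exists>U T. x \<in> U \<and> local_trivialization AF AM AC \<pi> U T)"

definition vertical :: "('a, 'e::real_normed_vector) chart set \<Rightarrow>
    ('b, 'm::real_normed_vector) chart set \<Rightarrow> ('a \<Rightarrow> 'b) \<Rightarrow> 'a \<Rightarrow> 'e set" where
  "vertical AF AM \<pi> p = {v. mdiff AF AM \<pi> p v = 0}"

definition complementary :: "('a \<Rightarrow> 'e::real_vector set) \<Rightarrow> ('a \<Rightarrow> 'e set) \<Rightarrow> bool" where
  "complementary V H \<longleftrightarrow> (\<forall>p. V p \<inter> H p = {0} \<and> (\<forall>u. \<exists>v\<in>V p. \<exists>h\<in>H p. u = v + h))"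

text \<open>The projection onto \<open>V p\<close> along \<open>H p\<close>.\<close>

definition proj_along :: "('a \<Rightarrow> 'e::real_vector set) \<Rightarrow> ('a \<Rightarrow> 'e set) \<Rightarrow> 'a \<Rightarrow> 'e \<Rightarrow> 'e" where
  "proj_along V H p u = (THE v. v \<in> V p \<and> u - v \<in> H p)"

text \<open>The differential of \<open>\<pi>\<close> kills the vertical part, so the second summand only sees the
  horizontal parts.\<close>

definition scaled_metric :: "('a, 'e::real_normed_vector) chart set \<Rightarrow>
    ('b, 'm::real_normed_vector) chart set \<Rightarrow> ('a \<Rightarrow> 'b) \<Rightarrow> ('a \<Rightarrow> 'e set) \<Rightarrow>
    ('a \<Rightarrow> 'e \<Rightarrow> 'e \<Rightarrow> real) \<Rightarrow> ('b \<Rightarrow> 'm \<Rightarrow> 'm \<Rightarrow> real) \<Rightarrow> real \<Rightarrow> 'a \<Rightarrow> 'e \<Rightarrow> 'e \<Rightarrow> real" where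
  "scaled_metric AF AM \<pi> H g gM r p u w =
     g p (proj_along (vertical AF AM \<pi>) H p u) (proj_along (vertical AF AM \<pi>) H p w)
     + r * gM (\<pi> p) (mdiff AF AM \<pi> p u) (mdiff AF AM \<pi> p w)"

definition hor_lift :: "('a, 'e::real_normed_vector) chart set \<Rightarrow>
    ('b, 'm::real_normed_vector) chart set \<Rightarrow> ('a \<Rightarrow> 'b) \<Rightarrow> ('a \<Rightarrow> 'e set) \<Rightarrow>
    ('b \<Rightarrow> 'm) \<Rightarrow> 'a \<Rightarrow> 'e" where
  "hor_lift AF AM \<pi> H K p = (THE h. h \<in> H p \<and> mdiff AF AM \<pi> p h = K (\<pi> p))"

text \<open>The connection \<open>\<nabla>\<^sup>\<H>\<close>: the pullback along \<open>\<pi>\<close> of the connection \<open>DM\<close> of the base, carried to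
  \<open>H\<close> by the isomorphism of \<open>H\<close> with \<open>\<pi>\<^sup>*T(M)\<close>. The pulled back sections of \<open>\<pi>\<^sup>*T(M)\<close> correspond
  to the horizontal lifts of fields on the base, and the pullback connection is the connection with
  \<open>(\<pi>\<^sup>*\<nabla>)\<^sub>v (K \<circ> \<pi>) = \<nabla>\<^bsub>d\<pi> v\<^esub> K\<close>.\<close>

definition horizontal_connection :: "('a, 'e::real_normed_vector) chart set \<Rightarrow>
    ('b, 'm::real_normed_vector) chart set \<Rightarrow> ('a \<Rightarrow> 'b) \<Rightarrow> ('a \<Rightarrow> 'e set) \<Rightarrow>
    ('b, 'm) cov_deriv \<Rightarrow> ('a, 'e) cov_deriv \<Rightarrow> bool" where
  "horizontal_connection AF AM \<pi> H DM DH \<longleftrightarrow> connection_on AF H DH \<and>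
     (\<forall>K p v. smooth_vf AM K \<longrightarrow>
        mdiff AF AM \<pi> p (DH (hor_lift AF AM \<pi> H K) p v) = DM K (\<pi> p) (mdiff AF AM \<pi> p v))"

text \<open>The Riemannian connection of the fibre over \<open>x\<close> is transported from the typical fibre, which
  carries the metric pulled back along \<open>\<iota> = (\<lambda>y. T (x, y))\<close>. The fields \<open>X'\<close>, \<open>Y'\<close> below are the
  restrictions to that fibre of the vertical fields \<open>X\<close>, \<open>Y\<close>, moved to the typical fibre.\<close>

definition pullback_metric :: "('c, 'k::real_normed_vector) chart set \<Rightarrow>
    ('a, 'e::real_normed_vector) chart set \<Rightarrow> ('c \<Rightarrow> 'a) \<Rightarrow> ('a \<Rightarrow> 'e \<Rightarrow> 'e \<Rightarrow> real) \<Rightarrow>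
    'c \<Rightarrow> 'k \<Rightarrow> 'k \<Rightarrow> real" where
  "pullback_metric AC AF \<iota> g y u w = g (\<iota> y) (mdiff AC AF \<iota> y u) (mdiff AC AF \<iota> y w)"

definition fields_related :: "('c, 'k::real_normed_vector) chart set \<Rightarrow>
    ('a, 'e::real_normed_vector) chart set \<Rightarrow> ('c \<Rightarrow> 'a) \<Rightarrow> ('c \<Rightarrow> 'k) \<Rightarrow> ('a \<Rightarrow> 'e) \<Rightarrow> bool" where
  "fields_related AC AF \<iota> X' X \<longleftrightarrow> (\<forall>y. mdiff AC AF \<iota> y (X' y) = X (\<iota> y))"

definition vertical_connection ::
    "('a::topological_space, 'e::real_normed_vector) chart set \<Rightarrow>
     ('b::topological_space, 'm::real_normed_vector) chart set \<Rightarrow>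
     ('c::topological_space, 'k::real_normed_vector) chart set \<Rightarrow>
     ('a \<Rightarrow> 'b) \<Rightarrow> ('a \<Rightarrow> 'e set) \<Rightarrow> ('a \<Rightarrow> 'e \<Rightarrow> 'e \<Rightarrow> real) \<Rightarrow> ('a, 'e) cov_deriv \<Rightarrow> bool" where
  "vertical_connection AF AM AC \<pi> H g DV \<longleftrightarrow>
     connection_on AF (vertical AF AM \<pi>) DV \<and>
     (\<forall>U T x. local_trivialization AF AM AC \<pi> U T \<and> x \<in> U \<longrightarrow>
        (let \<iota> = (\<lambda>y. T (x, y)) in
         \<exists>DC. levi_civita AC (pullback_metric AC AF \<iota> g) DC \<and>
          (\<forall>X Y Z X' Y'.
             section_of AF (vertical AF AM \<pi>) X \<and> section_of AF (vertical AF AM \<pi>) Y \<and>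
             section_of AF (vertical AF AM \<pi>) Z \<and> smooth_vf AC X' \<and> smooth_vf AC Y' \<and>
             fields_related AC AF \<iota> X' X \<and> fields_related AC AF \<iota> Y' Y \<longrightarrow>
             (\<forall>y. g (\<iota> y) (DV Y (\<iota> y) (X (\<iota> y))) (Z (\<iota> y)) =
                  g (\<iota> y) (mdiff AC AF \<iota> y (DC Y' y (X' y))) (Z (\<iota> y)))))) \<and>
     (\<forall>K Y Z p. smooth_vf AM K \<and>
        section_of AF (vertical AF AM \<pi>) Y \<and> section_of AF (vertical AF AM \<pi>) Z \<longrightarrow>
        (let L = hor_lift AF AM \<pi> H K in
           g p (DV Y p (L p)) (Z p) =
             1/2 * (g p (lie_bracket AF L Y p) (Z p) - g p (lie_bracket AF L Z p) (Y p)
                    + mderiv AF (\<lambda>q. g q (Y q) (Z q)) p (L p))))"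

definition sum_connection :: "('a \<Rightarrow> 'e::real_vector set) \<Rightarrow> ('a \<Rightarrow> 'e set) \<Rightarrow>
    ('a, 'e) cov_deriv \<Rightarrow> ('a, 'e) cov_deriv \<Rightarrow> ('a, 'e) cov_deriv" where
  "sum_connection V H DV DH Y p v =
     DV (\<lambda>q. proj_along V H q (Y q)) p v + DH (\<lambda>q. Y q - proj_along V H q (Y q)) p v"


section \<open>Connections on the tangent bundle: differences, limits, curvature\<close>

text \<open>From here on the model space is \<^typ>\<open>real^'n\<close>, so that endomorphisms of tangent spaces are
  matrices. The difference of two connections, and the curvature, are tensorial: the
  matrices below exist and are determined by the stated equations.\<close>

definition conn_diff :: "('a, real^'n) chart set \<Rightarrow> ('a, real^'n) cov_deriv \<Rightarrow>
    ('a, real^'n) cov_deriv \<Rightarrow> 'a \<Rightarrow> real^'n \<Rightarrow> real^'n^'n" where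
  "conn_diff A D0 D1 p v = (THE S. \<forall>Y. smooth_vf A Y \<longrightarrow> S *v Y p = D1 Y p v - D0 Y p v)"

definition limit_connection :: "('a, real^'n) chart set \<Rightarrow> ('a, real^'n) cov_deriv \<Rightarrow>
    (real \<Rightarrow> ('a, real^'n) cov_deriv) \<Rightarrow> ('a, real^'n) cov_deriv" where
  "limit_connection A D0 D Y p v = D0 Y p v + Lim at_top (\<lambda>r. conn_diff A D0 (D r) p v) *v Y p"

definition curvature :: "('a, real^'n) chart set \<Rightarrow> ('a, real^'n) cov_deriv \<Rightarrow>
    'a \<Rightarrow> real^'n \<Rightarrow> real^'n \<Rightarrow> real^'n^'n" where
  "curvature A D p u v = (THE R. \<forall>X Y Z.
     smooth_vf A X \<and> smooth_vf A Y \<and> smooth_vf A Z \<and> X p = u \<and> Y p = v \<longrightarrow>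
     R *v Z p = D (\<lambda>q. D Z q (Y q)) p (X p) - D (\<lambda>q. D Z q (X q)) p (Y p)
                - D Z p (lie_bracket A X Y p))"

text \<open>Smoothness of a curve is joint smoothness in the parameter and the point; as usual for a
  closed parameter interval, the curve is required to be smooth on a neighbourhood of it.\<close>

definition connection_curve :: "('a, real^'n) chart set \<Rightarrow> (real \<Rightarrow> ('a, real^'n) cov_deriv) \<Rightarrow> bool" where
  "connection_curve A D \<longleftrightarrow> (\<exists>e>0.
     (\<forall>t\<in>{-e<..<1+e}. connection A (D t)) \<and>
     (\<forall>X Y. smooth_vf A X \<and> smooth_vf A Y \<longrightarrow>
        (\<forall>c\<in>A. smooth_on ({-e<..<1+e} \<times> snd c ` fst c)
           (\<lambda>(t, x). let q = chart_inv c x in mderiv A (snd c) q (D t Y q (X q))))))"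

definition curve_velocity :: "('a, real^'n) chart set \<Rightarrow> (real \<Rightarrow> ('a, real^'n) cov_deriv) \<Rightarrow>
    real \<Rightarrow> 'a \<Rightarrow> real^'n \<Rightarrow> real^'n^'n" where
  "curve_velocity A D t p v = vector_derivative (\<lambda>s. conn_diff A (D 0) (D s) p v) (at t)"


section \<open>Differential forms\<close>

text \<open>A \<open>k\<close>-form assigns to \<open>p\<close> an alternating function of the first \<open>k\<close> entries of a sequence of
  tangent vectors at \<open>p\<close>.\<close>

definition smooth_form :: "('a, 'e::real_normed_vector) chart set \<Rightarrow> nat \<Rightarrow>
    ('a \<Rightarrow> (nat \<Rightarrow> 'e) \<Rightarrow> real) \<Rightarrow> bool" where
  "smooth_form A k \<omega> \<longleftrightarrow>
     (\<forall>p v w. (\<forall>i<k. v i = w i) \<longrightarrow> \<omega> p v = \<omega> p w) \<and>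
     (\<forall>p v. \<forall>i<k. linear (\<lambda>u. \<omega> p (v(i := u)))) \<and>
     (\<forall>p v. \<forall>i<k. \<forall>j<k. i \<noteq> j \<and> v i = v j \<longrightarrow> \<omega> p v = 0) \<and>
     (\<forall>X. (\<forall>i. smooth_vf A (X i)) \<longrightarrow> smooth_fun A (\<lambda>p. \<omega> p (\<lambda>i. X i p)))"

definition coord_field :: "('a, 'e::real_normed_vector) chart set \<Rightarrow> ('a, 'e) chart \<Rightarrow>
    'e \<Rightarrow> 'a \<Rightarrow> 'e" where
  "coord_field A c u q = inv (mderiv A (snd c) q) u"

text \<open>The exterior derivative of a \<open>k\<close>-form,
  \<open>d\<omega>(v\<^sub>0, \<dots>, v\<^sub>k) = (\<Sum>i. (-1)^i v\<^sub>i (\<omega>(V\<^sub>0, \<dots>, V\<^sub>k without V\<^sub>i)))\<close>, where the \<open>V\<^sub>j\<close> are the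
  extensions of the \<open>v\<^sub>j\<close> with constant components in the preferred chart at \<open>p\<close> (their brackets
  vanish).\<close>

definition ext_deriv :: "('a, 'e::real_normed_vector) chart set \<Rightarrow> nat \<Rightarrow>
    ('a \<Rightarrow> (nat \<Rightarrow> 'e) \<Rightarrow> real) \<Rightarrow> 'a \<Rightarrow> (nat \<Rightarrow> 'e) \<Rightarrow> real" where
  "ext_deriv A k \<omega> p v = (\<Sum>i\<le>k. (-1)^i *
     mderiv A (\<lambda>q. \<omega> q (\<lambda>j. coord_field A (chart_at A p) (v (if j < i then j else Suc j)) q)) p (v i))"

definition exact_form :: "('a, 'e::real_normed_vector) chart set \<Rightarrow> nat \<Rightarrow>
    ('a \<Rightarrow> (nat \<Rightarrow> 'e) \<Rightarrow> real) \<Rightarrow> bool" where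
  "exact_form A k \<omega> \<longleftrightarrow>
     k \<ge> 1 \<and> (\<exists>\<eta>. smooth_form A (k - 1) \<eta> \<and> (\<forall>p v. \<omega> p v = ext_deriv A (k - 1) \<eta> p v))"


section \<open>Chern-Simons equivalence\<close>

text \<open>An invariant polynomial of degree \<open>l\<close> is taken in its polarized form: a symmetric \<open>l\<close>-linear
  function on the first \<open>l\<close> entries of a sequence of matrices, invariant under conjugation.\<close>

definition invariant_polynomial :: "nat \<Rightarrow> ((nat \<Rightarrow> real^'n^'n) \<Rightarrow> real) \<Rightarrow> bool" where
  "invariant_polynomial l P \<longleftrightarrow>
     (\<forall>M N. (\<forall>i<l. M i = N i) \<longrightarrow> P M = P N) \<and>
     (\<forall>M. \<forall>i<l. linear (\<lambda>S. P (M(i := S)))) \<and>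
     (\<forall>M \<sigma>. \<sigma> permutes {..<l} \<longrightarrow> P (M \<circ> \<sigma>) = P M) \<and>
     (\<forall>M G. invertible G \<longrightarrow> P (\<lambda>i. G ** M i ** matrix_inv G) = P M)"

text \<open>\<open>P(B \<and> R \<and> \<dots> \<and> R)\<close> for a matrix-valued 1-form \<open>B\<close> and \<open>l - 1\<close> copies of a
  matrix-valued 2-form \<open>R\<close>, with the wedge convention
  \<open>(\<alpha> \<and> \<beta>)(v\<^sub>1, \<dots>, v\<^bsub>p+q\<^esub>) = 1/(p! q!) (\<Sum>\<sigma>. sign \<sigma> \<alpha>(v\<^bsub>\<sigma>1\<^esub>, \<dots>) \<beta>(\<dots>, v\<^bsub>\<sigma>(p+q)\<^esub>))\<close>.\<close>

definition wedge_poly :: "nat \<Rightarrow> ((nat \<Rightarrow> real^'n^'n) \<Rightarrow> real) \<Rightarrow>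
    ('a \<Rightarrow> real^'n \<Rightarrow> real^'n^'n) \<Rightarrow> ('a \<Rightarrow> real^'n \<Rightarrow> real^'n \<Rightarrow> real^'n^'n) \<Rightarrow>
    'a \<Rightarrow> (nat \<Rightarrow> real^'n) \<Rightarrow> real" where
  "wedge_poly l P B R p v = 1 / 2^(l - 1) *
     (\<Sum>\<sigma> | \<sigma> permutes {..<2 * l - 1}. of_int (sign \<sigma>) *
        P (\<lambda>i. if i = 0 then B p (v (\<sigma> 0)) else R p (v (\<sigma> (2 * i - 1))) (v (\<sigma> (2 * i)))))"

definition TP_form :: "('a, real^'n) chart set \<Rightarrow> nat \<Rightarrow> ((nat \<Rightarrow> real^'n^'n) \<Rightarrow> real) \<Rightarrow>
    (real \<Rightarrow> ('a, real^'n) cov_deriv) \<Rightarrow> 'a \<Rightarrow> (nat \<Rightarrow> real^'n) \<Rightarrow> real" where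
  "TP_form A l P D p v =
     of_nat l * integral {0..1} (\<lambda>t. wedge_poly l P (curve_velocity A D t) (curvature A (D t)) p v)"

text \<open>Modulo exact forms \<open>TP_form\<close> does not depend on the curve joining \<open>D0\<close> to \<open>D1\<close>, so it does
  not matter which curve is used. The definition asks for one curve that serves all \<open>P\<close>.\<close>

definition CS_equivalent :: "('a, real^'n) chart set \<Rightarrow> ('a, real^'n) cov_deriv \<Rightarrow>
    ('a, real^'n) cov_deriv \<Rightarrow> bool" where
  "CS_equivalent A D0 D1 \<longleftrightarrow> (\<exists>D. connection_curve A D \<and> D 0 = D0 \<and> D 1 = D1 \<and>
     (\<forall>l P. l \<ge> 1 \<and> invariant_polynomial l P \<longrightarrow> exact_form A (2 * l - 1) (TP_form A l P D)))"

end

theory Submission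
  imports Defs
begin

text \<open>
  Write \<open>g\<^sub>r = g\<^sub>V + r g\<^sub>H\<close> for the metric scaled by \<open>r\<close>, where \<open>g\<^sub>H\<close> is the pulled back metric of
  the base. The direct sum connection is compatible with the degenerate metric \<open>g\<^sub>H\<close> and its torsion
  is vertical, so Koszul's formula for \<open>g\<^sub>H\<close> holds with it. Subtracting, Koszul's formula for \<open>g\<^sub>r\<close>
  shows that the difference tensor \<open>S\<^sub>r = \<nabla>\<^sup>r - \<nabla>\<^sup>\<oplus>\<close>, paired with a third vector by \<open>g\<^sub>r\<close>, does not
  depend on \<open>r\<close>. Hence the vertical part of \<open>S\<^sub>r\<close> is constant in \<open>r\<close>, its horizontal part is
  proportional to \<open>1/r\<close>, and the limit is the vertical part of \<open>S\<^sub>1\<close>. On vertical sections the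
  defining equations of the vertical connection are Koszul's formula again, so the limit tensor kills
  \<open>\<V>\<close>, and it takes values in \<open>\<V>\<close>. Along the segment joining the two connections the velocity is
  therefore strictly block triangular and the curvature is block triangular. An invariant polynomial
  vanishes on such arguments: conjugation by \<open>2 \<oplus> 1\<close> multiplies each homogeneous part by a power of 2
  at least 2. So the transgression forms vanish identically.
\<close>

section \<open>Calculus of smooth functions\<close>

text \<open>Two encodings shape the groundwork. A covariant derivative acts on global fields only,
  so a statement about one tangent vector needs a global extension by bump functions, and the
  \<open>THE\<close> in the difference tensor and in the curvature is meaningful only once
  tensoriality is proved for operators on global fields. Tangent vectors are components in preferred
  charts that jump from point to point; hence smoothness is always shown for expressions in a fixed
  chart, never for the matrices themselves.

  The limit connection differs from the direct sum in general: the block of the limit tensor from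
  \<open>H\<close> to \<open>\<V>\<close> carries the vertical parts of brackets of horizontal lifts
  and the variation of the fibre metric along lifts. The transgression therefore vanishes because of
  the shape of this block and not because the connections agree. Conjugation by
  \<open>a \<oplus> 1\<close> gives weight \<open>a\<close> to each factor in that block and weight
  1 to the diagonal ones; the choice \<open>a = 2\<close> keeps the total weight away from
  1.\<close>

lemma Ck_on_subset: "Ck_on k S f \<Longrightarrow> T \<subseteq> S \<Longrightarrow> Ck_on k T f"
  by (induction k arbitrary: f) (auto intro: continuous_on_subset)

lemma Ck_on_cong:
  assumes "open S" "\<And>x. x \<in> S \<Longrightarrow> f x = g x" "Ck_on k S f"
  shows "Ck_on k S g"
  using assms(2,3)
proof (induction k arbitrary: f g)
  case 0
  then show ?case
    using continuous_on_cong by fastforce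
next
  case (Suc k)
  have *: "(g has_derivative frechet_derivative f (at x)) (at x)" if "x \<in> S" for x
  proof (rule has_derivative_transform_within_open[OF _ assms(1) that Suc.prems(1)])
    show "(f has_derivative frechet_derivative f (at x)) (at x)"
      using Suc.prems(2) that by (simp add: frechet_derivative_works)
  qed
  then have "frechet_derivative f (at x) v = frechet_derivative g (at x) v" if "x \<in> S" for x v
    using frechet_derivative_at[OF *[OF that]] by simp
  then have "Ck_on k S (\<lambda>x. frechet_derivative g (at x) v)" for v
    by (rule Suc.IH[of "\<lambda>x. frechet_derivative f (at x) v"]) (use Suc.prems in auto)
  then show ?case
    using * by (auto simp: differentiable_def)
qed

text \<open>Derivatives at interior points are unique, so an explicit formula \<open>D\<close> may
  stand in for \<open>frechet_derivative\<close>. The closure properties of \<open>Ck_on\<close>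
  then follow from the usual differentiation rules by induction on the order.\<close>

lemma Ck_on_SucI:
  assumes "open S" "\<And>x. x \<in> S \<Longrightarrow> (f has_derivative D x) (at x)"
    and "\<And>v. Ck_on k S (\<lambda>x. D x v)"
  shows "Ck_on (Suc k) S f"
proof -
  have "D x v = frechet_derivative f (at x) v" if "x \<in> S" for x v
    using frechet_derivative_at[OF assms(2)[OF that]] by simp
  then have "Ck_on k S (\<lambda>x. frechet_derivative f (at x) v)" for v
    by (rule Ck_on_cong[OF assms(1) _ assms(3)[of v]])
  then show ?thesis
    using assms(2) by (auto simp: differentiable_def)
qed

lemma Ck_on_Suc_has_derivative:
  "Ck_on (Suc k) S f \<Longrightarrow> x \<in> S \<Longrightarrow> (f has_derivative frechet_derivative f (at x)) (at x)"
  by (simp add: frechet_derivative_works)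

lemma Ck_on_SucD: "Ck_on (Suc k) S f \<Longrightarrow> Ck_on k S f"
  by (induction k arbitrary: f)
    (auto simp: continuous_on_eq_continuous_within
      intro: differentiable_imp_continuous_within differentiable_at_withinI)

lemma Ck_on_const: "Ck_on k S (\<lambda>_. c)"
  by (induction k arbitrary: c) (auto simp: frechet_derivative_const)

lemma Ck_on_linear:
  assumes "bounded_linear L" "open S" "Ck_on k S f"
  shows "Ck_on k S (\<lambda>x. L (f x))"
  using assms(3)
proof (induction k arbitrary: f)
  case 0
  then show ?case using bounded_linear.continuous_on[OF assms(1)] by simp
next
  case (Suc k)
  show ?case
    by (rule Ck_on_SucI[OF assms(2) bounded_linear.has_derivative[OF assms(1)
            Ck_on_Suc_has_derivative[OF Suc.prems]] Suc.IH])
      (use Suc.prems in auto)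
qed

lemma Ck_on_add:
  assumes "open S" "Ck_on k S f" "Ck_on k S g"
  shows "Ck_on k S (\<lambda>x. f x + g x)"
  using assms(2,3)
proof (induction k arbitrary: f g)
  case 0
  then show ?case by (simp add: continuous_on_add)
next
  case (Suc k)
  show ?case
    by (rule Ck_on_SucI[OF assms(1) has_derivative_add[OF
            Ck_on_Suc_has_derivative[OF Suc.prems(1)] Ck_on_Suc_has_derivative[OF Suc.prems(2)]]
          Suc.IH])
      (use Suc.prems in auto)
qed

lemma Ck_on_sum:
  assumes "open S" "\<And>i. i \<in> I \<Longrightarrow> Ck_on k S (f i)"
  shows "Ck_on k S (\<lambda>x. \<Sum>i\<in>I. f i x)"
  using assms(2)
  by (induction I rule: infinite_finite_induct) (auto intro: Ck_on_add Ck_on_const assms(1))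

lemma Ck_on_bilinear:
  assumes "bounded_bilinear B" "open S" "Ck_on k S f" "Ck_on k S g"
  shows "Ck_on k S (\<lambda>x. B (f x) (g x))"
  using assms(3,4)
proof (induction k arbitrary: f g)
  case 0
  then show ?case using bounded_bilinear.continuous_on[OF assms(1)] by simp
next
  case (Suc k)
  show ?case
  proof (rule Ck_on_SucI[OF assms(2) bounded_bilinear.FDERIV[OF assms(1)
            Ck_on_Suc_has_derivative[OF Suc.prems(1)] Ck_on_Suc_has_derivative[OF Suc.prems(2)]]])
    show "Ck_on k S (\<lambda>x. B (f x) (frechet_derivative g (at x) v)
                       + B (frechet_derivative f (at x) v) (g x))" for v
      using Suc.prems Ck_on_SucD[OF Suc.prems(1)] Ck_on_SucD[OF Suc.prems(2)]
      by (intro Ck_on_add assms(2) Suc.IH) auto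
  qed
qed

lemma Ck_on_id: "Ck_on k S (\<lambda>x. x)"
  by (cases k) (auto simp: frechet_derivative_ident Ck_on_const)

lemma Ck_on_Pair:
  assumes "open S" "Ck_on k S f" "Ck_on k S g"
  shows "Ck_on k S (\<lambda>x. (f x, g x))"
proof -
  have l: "bounded_linear (\<lambda>x. (x, 0))" "bounded_linear (\<lambda>x. (0, x))"
    by (intro bounded_linear_Pair bounded_linear_ident bounded_linear_zero)+
  have "Ck_on k S (\<lambda>x. (f x, 0) + (0, g x))"
    by (intro Ck_on_add assms(1) Ck_on_linear[OF l(1)] Ck_on_linear[OF l(2)] assms)
  then show ?thesis by simp
qed

lemma Ck_on_local:
  assumes "\<And>x. x \<in> S \<Longrightarrow> \<exists>T. open T \<and> x \<in> T \<and> Ck_on k T f"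
  shows "Ck_on k S f"
  using assms
proof (induction k arbitrary: f)
  case 0
  have "isCont f x" if "x \<in> S" for x
    using 0[OF that] by (auto simp: continuous_on_eq_continuous_at)
  then show ?case
    by (simp add: continuous_at_imp_continuous_on)
next
  case (Suc k)
  have "Ck_on k S (\<lambda>x. frechet_derivative f (at x) v)" for v
  proof (rule Suc.IH)
    fix x assume "x \<in> S"
    from Suc.prems[OF this] show "\<exists>T. open T \<and> x \<in> T \<and> Ck_on k T (\<lambda>x. frechet_derivative f (at x) v)"
      by auto
  qed
  moreover have "f differentiable at x" if "x \<in> S" for x
    using Suc.prems[OF that] by auto
  ultimately show ?case by simp
qed

text \<open>The model spaces of the base and of the fibre are only assumed to be inner product spaces
  with a finite spanning set, so they need a substitute for \<^const>\<open>Basis\<close>.\<close>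

definition onb :: "'e::real_inner set" where
  "onb = (SOME B. finite B \<and> (\<forall>v. v = (\<Sum>b\<in>B. (v \<bullet> b) *\<^sub>R b)))"

definition fin_dim :: "'e::real_inner itself \<Rightarrow> bool" where
  "fin_dim _ \<longleftrightarrow> (\<exists>B::'e set. finite B \<and> span B = UNIV)"

lemma orthonormal_basis_exists:
  assumes "finite (B::'e::real_inner set)" "span B = UNIV"
  shows "\<exists>C::'e set. finite C \<and> (\<forall>v. v = (\<Sum>b\<in>C. (v \<bullet> b) *\<^sub>R b))"
proof -
  obtain C where C: "finite C" "span C = span B" "pairwise orthogonal C"
    using basis_orthogonal[OF assms(1)] by blast
  \<comment> \<open>An orthogonal set may contain \<open>0\<close>, which has to be discarded before
    normalising; the span stays the same.\<close>
  define C' where "C' = (\<lambda>x. x /\<^sub>R norm x) ` (C - {0})"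
  have fin: "finite C'" using C by (simp add: C'_def)
  have orth: "b \<bullet> c = (if b = c then 1 else 0)" if "b \<in> C'" "c \<in> C'" for b c
  proof -
    obtain x where "x \<in> C - {0}" "b = x /\<^sub>R norm x"
      using \<open>b \<in> C'\<close> unfolding C'_def image_iff by blast
    moreover obtain y where "y \<in> C - {0}" "c = y /\<^sub>R norm y"
      using \<open>c \<in> C'\<close> unfolding C'_def image_iff by blast
    ultimately have xy: "x \<in> C" "y \<in> C" "x \<noteq> 0" "y \<noteq> 0" "b = x /\<^sub>R norm x" "c = y /\<^sub>R norm y"
      by auto
    show ?thesis
    proof (cases "x = y")
      case True
      then show ?thesis using xy by (simp add: dot_square_norm power2_eq_square)
    next
      case False
      then have "x \<bullet> y = 0" using C(3) xy by (auto simp: pairwise_def orthogonal_def)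
      then have "b \<bullet> c = 0" using xy by simp
      moreover have "b \<bullet> b \<noteq> 0" using xy by simp
      ultimately show ?thesis by auto
    qed
  qed
  have "C \<subseteq> span C'"
  proof
    fix x assume "x \<in> C"
    show "x \<in> span C'"
    proof (cases "x = 0")
      case False
      then have "x /\<^sub>R norm x \<in> C'" using \<open>x \<in> C\<close> by (auto simp: C'_def)
      then have "norm x *\<^sub>R (x /\<^sub>R norm x) \<in> span C'" by (intro span_scale span_base)
      then show ?thesis using False by simp
    qed (simp add: span_zero)
  qed
  then have sp: "span C' = UNIV"
    using C(2) assms(2) by (metis UNIV_I span_minimal subspace_span subset_antisym subset_UNIV)
  have "v = (\<Sum>b\<in>C'. (v \<bullet> b) *\<^sub>R b)" for v
  proof -
    have "v \<in> span C'" using sp by simp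
    then show ?thesis
    proof (induction rule: span_induct_alt)
      case base
      then show ?case by simp
    next
      case (step c x y)
      have "(\<Sum>b\<in>C'. (x \<bullet> b) *\<^sub>R b) = (\<Sum>b\<in>C'. if b = x then x else 0)"
        using step(1) by (intro sum.cong) (auto simp: orth)
      also have "\<dots> = x" using fin step(1) by simp
      finally have x: "(\<Sum>b\<in>C'. (x \<bullet> b) *\<^sub>R b) = x" .
      have "(\<Sum>b\<in>C'. ((c *\<^sub>R x + y) \<bullet> b) *\<^sub>R b)
          = (\<Sum>b\<in>C'. c *\<^sub>R ((x \<bullet> b) *\<^sub>R b) + (y \<bullet> b) *\<^sub>R b)"
        by (simp add: inner_add_left scaleR_add_left)
      also have "\<dots> = c *\<^sub>R x + y"
        using x step(2) by (simp only: sum.distrib scaleR_sum_right[symmetric])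
      finally show ?case by simp
    qed
  qed
  then show ?thesis using fin by blast
qed

lemma onb:
  assumes "fin_dim TYPE('e::real_inner)"
  shows "finite (onb :: 'e set)" "v = (\<Sum>b\<in>onb. ((v::'e) \<bullet> b) *\<^sub>R b)"
proof -
  have "finite (onb::'e set) \<and> (\<forall>v::'e. v = (\<Sum>b\<in>onb. (v \<bullet> b) *\<^sub>R b))"
    unfolding onb_def
    by (rule someI_ex) (use assms orthonormal_basis_exists in \<open>auto simp: fin_dim_def\<close>)
  then show "finite (onb :: 'e set)" "v = (\<Sum>b\<in>onb. (v \<bullet> b) *\<^sub>R b)" by blast+
qed

lemma fin_dim_euclidean: "fin_dim TYPE('e::euclidean_space)"
  unfolding fin_dim_def using finite_Basis span_Basis by blast

lemma fin_dim_prod: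
  assumes "fin_dim TYPE('e::real_inner)" "fin_dim TYPE('f::real_inner)"
  shows "fin_dim TYPE('e \<times> 'f)"
proof -
  obtain B :: "'e set" and C :: "'f set" where BC: "finite B" "span B = UNIV" "finite C" "span C = UNIV"
    using assms by (auto simp: fin_dim_def)
  let ?D = "(\<lambda>x. (x, 0)) ` B \<union> (\<lambda>x. (0, x)) ` C"
  have l: "linear (\<lambda>x::'e. (x, 0::'f))" "linear (\<lambda>x::'f. (0::'e, x))"
    by (auto intro!: linearI)
  have "(x, y) \<in> span ?D" for x :: 'e and y :: 'f
  proof -
    have "(x, 0) \<in> span ?D"
      by (rule subsetD[OF span_mono[OF Un_upper1]]) (simp add: linear_span_image[OF l(1)] BC)
    moreover have "(0, y) \<in> span ?D"
      by (rule subsetD[OF span_mono[OF Un_upper2]]) (simp add: linear_span_image[OF l(2)] BC)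
    ultimately have "(x, 0) + (0, y) \<in> span ?D" by (rule span_add)
    then show ?thesis by simp
  qed
  then have "span ?D = UNIV" by auto
  then show ?thesis unfolding fin_dim_def using BC by (intro exI[of _ ?D]) auto
qed

lemma linear_onb:
  assumes "fin_dim TYPE('e::real_inner)" "linear L"
  shows "L (v::'e) = (\<Sum>b\<in>onb. (v \<bullet> b) *\<^sub>R L b)"
proof -
  have "L v = L (\<Sum>b\<in>onb. (v \<bullet> b) *\<^sub>R b)" using onb(2)[OF assms(1), of v] by simp
  also have "\<dots> = (\<Sum>b\<in>onb. (v \<bullet> b) *\<^sub>R L b)"
    by (simp add: linear_sum[OF assms(2)] linear_scale[OF assms(2)])
  finally show ?thesis .
qed

text \<open>In the chain rule the direction \<open>frechet_derivative f (at x) v\<close> in which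
  \<open>g\<close> is differentiated moves with \<open>x\<close>, whereas the induction hypothesis
  concerns fixed directions. Expanding the moving direction in the finite basis \<open>onb\<close>
  reduces to fixed ones; this is where finite dimension enters.\<close>

lemma Ck_on_compose:
  fixes f :: "'d::real_normed_vector \<Rightarrow> 'e::real_inner"
  assumes fd: "fin_dim TYPE('e)" and S: "open S" and T: "open T"
    and sub: "\<And>x. x \<in> S \<Longrightarrow> f x \<in> T"
    and "Ck_on k S f" "Ck_on k T g"
  shows "Ck_on k S (\<lambda>x. g (f x))"
  using assms(5,6)
proof (induction k arbitrary: g)
  case 0
  have "continuous_on S f" "continuous_on T g" "f ` S \<subseteq> T"
    using 0 sub by (simp_all add: image_subset_iff)
  then show ?case by (simp add: continuous_on_compose2)
next
  case (Suc k)
  let ?D = "\<lambda>x v. \<Sum>b\<in>onb. (frechet_derivative f (at x) v \<bullet> b) *\<^sub>R frechet_derivative g (at (f x)) b"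
  show ?case
  proof (rule Ck_on_SucI[OF S])
    fix x assume x: "x \<in> S"
    have "((\<lambda>x. g (f x)) has_derivative
        (\<lambda>v. frechet_derivative g (at (f x)) (frechet_derivative f (at x) v))) (at x)"
      using Ck_on_Suc_has_derivative[OF Suc.prems(1) x]
        Ck_on_Suc_has_derivative[OF Suc.prems(2) sub[OF x]]
      by (rule has_derivative_compose)
    moreover have "linear (frechet_derivative g (at (f x)))"
      using Ck_on_Suc_has_derivative[OF Suc.prems(2) sub[OF x]] has_derivative_linear by blast
    then have "(\<lambda>v. frechet_derivative g (at (f x)) (frechet_derivative f (at x) v)) = ?D x"
      by (intro ext linear_onb[OF fd])
    ultimately show "((\<lambda>x. g (f x)) has_derivative ?D x) (at x)"
      by simp
  next
    fix v
    have "Ck_on k S (\<lambda>x. frechet_derivative f (at x) v \<bullet> b)" for b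
      using Suc.prems by (intro Ck_on_bilinear[OF bounded_bilinear_inner] S Ck_on_const) auto
    moreover have "Ck_on k S (\<lambda>x. frechet_derivative g (at (f x)) b)" for b
      using Suc.prems Ck_on_SucD[OF Suc.prems(1)] by (intro Suc.IH) auto
    ultimately show "Ck_on k S (\<lambda>x. ?D x v)"
      by (intro Ck_on_sum S Ck_on_bilinear[OF bounded_bilinear_scaleR])
  qed
qed

lemma Ck_on_inverse:
  fixes f :: "'d::real_normed_vector \<Rightarrow> real"
  assumes S: "open S" and "\<And>x. x \<in> S \<Longrightarrow> f x \<noteq> 0" and "Ck_on k S f"
  shows "Ck_on k S (\<lambda>x. inverse (f x))"
  using assms(3)
proof (induction k)
  case 0
  then show ?case using assms(2) by (auto intro: Limits.continuous_on_inverse)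
next
  case (Suc k)
  let ?D = "\<lambda>x v. - 1 * (inverse (f x) * frechet_derivative f (at x) v * inverse (f x))"
  show ?case
  proof (rule Ck_on_SucI[OF S])
    show "((\<lambda>x. inverse (f x)) has_derivative ?D x) (at x)" if "x \<in> S" for x
      using Deriv.has_derivative_inverse[OF assms(2)[OF that] Ck_on_Suc_has_derivative[OF Suc.prems that]]
      by simp
    have "Ck_on k S (\<lambda>x. inverse (f x))"
      by (rule Suc.IH[OF Ck_on_SucD[OF Suc.prems]])
    then show "Ck_on k S (\<lambda>x. ?D x v)" for v
      using Suc.prems by (intro Ck_on_bilinear[OF bounded_bilinear_mult] S Ck_on_const) auto
  qed
qed

lemma smooth_on_subset: "smooth_on S f \<Longrightarrow> T \<subseteq> S \<Longrightarrow> smooth_on T f"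
  using Ck_on_subset unfolding smooth_on_def by blast

lemma smooth_on_cong: "open S \<Longrightarrow> (\<And>x. x \<in> S \<Longrightarrow> f x = g x) \<Longrightarrow> smooth_on S f \<Longrightarrow> smooth_on S g"
  using Ck_on_cong unfolding smooth_on_def by blast

lemma smooth_on_const: "smooth_on S (\<lambda>_. c)"
  by (simp add: smooth_on_def Ck_on_const)

lemma smooth_on_id: "smooth_on S (\<lambda>x. x)"
  by (simp add: smooth_on_def Ck_on_id)

lemma smooth_on_linear:
  "bounded_linear L \<Longrightarrow> open S \<Longrightarrow> smooth_on S f \<Longrightarrow> smooth_on S (\<lambda>x. L (f x))"
  using Ck_on_linear unfolding smooth_on_def by blast

lemma smooth_on_add:
  "open S \<Longrightarrow> smooth_on S f \<Longrightarrow> smooth_on S g \<Longrightarrow> smooth_on S (\<lambda>x. f x + g x)"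
  using Ck_on_add unfolding smooth_on_def by blast

lemma smooth_on_sum:
  "open S \<Longrightarrow> (\<And>i. i \<in> I \<Longrightarrow> smooth_on S (f i)) \<Longrightarrow> smooth_on S (\<lambda>x. \<Sum>i\<in>I. f i x)"
  unfolding smooth_on_def by (intro allI Ck_on_sum) auto

lemma smooth_on_bilinear:
  "bounded_bilinear B \<Longrightarrow> open S \<Longrightarrow> smooth_on S f \<Longrightarrow> smooth_on S g \<Longrightarrow>
    smooth_on S (\<lambda>x. B (f x) (g x))"
  using Ck_on_bilinear unfolding smooth_on_def by blast

lemma smooth_on_Pair:
  "open S \<Longrightarrow> smooth_on S f \<Longrightarrow> smooth_on S g \<Longrightarrow> smooth_on S (\<lambda>x. (f x, g x))"
  using Ck_on_Pair unfolding smooth_on_def by blast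

lemma smooth_on_local:
  assumes "\<And>x. x \<in> S \<Longrightarrow> \<exists>T. open T \<and> x \<in> T \<and> smooth_on T f"
  shows "smooth_on S f"
  unfolding smooth_on_def
proof (intro allI Ck_on_local)
  fix k x assume "x \<in> S"
  from assms[OF this] show "\<exists>T. open T \<and> x \<in> T \<and> Ck_on k T f"
    by (auto simp: smooth_on_def)
qed

lemma smooth_on_compose:
  fixes f :: "'d::real_normed_vector \<Rightarrow> 'e::real_inner"
  assumes "fin_dim TYPE('e)" "open S" "open T" "\<And>x. x \<in> S \<Longrightarrow> f x \<in> T"
    and "smooth_on S f" "smooth_on T g"
  shows "smooth_on S (\<lambda>x. g (f x))"
  using assms(5,6) Ck_on_compose[of S T f, OF assms(1-4)] unfolding smooth_on_def by blast

lemma smooth_on_inverse: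
  fixes f :: "'d::real_normed_vector \<Rightarrow> real"
  assumes "open S" "\<And>x. x \<in> S \<Longrightarrow> f x \<noteq> 0" "smooth_on S f"
  shows "smooth_on S (\<lambda>x. inverse (f x))"
  using assms(3) Ck_on_inverse[of S f, OF assms(1,2)] unfolding smooth_on_def by blast

lemma smooth_on_has_derivative:
  "smooth_on S f \<Longrightarrow> x \<in> S \<Longrightarrow> (f has_derivative frechet_derivative f (at x)) (at x)"
  using Ck_on_Suc_has_derivative unfolding smooth_on_def by blast

lemma smooth_on_frechet_derivative:
  "smooth_on S f \<Longrightarrow> smooth_on S (\<lambda>x. frechet_derivative f (at x) v)"
  using Ck_on.simps(2)[THEN fun_cong, THEN fun_cong] unfolding smooth_on_def by blast

lemma smooth_on_continuous: "smooth_on S f \<Longrightarrow> continuous_on S f"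
  using Ck_on.simps(1)[THEN fun_cong, THEN fun_cong] unfolding smooth_on_def by blast

section \<open>Symmetry of second derivatives\<close>

lemma smooth_on_line:
  fixes f :: "'e::real_normed_vector \<Rightarrow> real"
  assumes "smooth_on S f" "y + s *\<^sub>R u \<in> S"
  shows "((\<lambda>s. f (y + s *\<^sub>R u)) has_real_derivative frechet_derivative f (at (y + s *\<^sub>R u)) u) (at s)"
proof -
  have d: "(f has_derivative frechet_derivative f (at (y + s *\<^sub>R u))) (at (y + s *\<^sub>R u))"
    by (rule smooth_on_has_derivative[OF assms])
  have "((\<lambda>s. y + s *\<^sub>R u) has_derivative (\<lambda>s. s *\<^sub>R u)) (at s)"
    by (auto intro!: derivative_eq_intros)
  from has_derivative_compose[OF this d]
  have "((\<lambda>s. f (y + s *\<^sub>R u)) has_derivative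
         (\<lambda>h. frechet_derivative f (at (y + s *\<^sub>R u)) (h *\<^sub>R u))) (at s)" .
  moreover have "frechet_derivative f (at (y + s *\<^sub>R u)) (h *\<^sub>R u)
      = frechet_derivative f (at (y + s *\<^sub>R u)) u * h" for h
    using linear_scale[OF has_derivative_linear[OF d]] by simp
  ultimately show ?thesis by (simp add: has_field_derivative_def)
qed

text \<open>The mean value theorem is used twice: in direction \<open>u\<close> for the increment of
  \<open>f\<close> by \<open>h *\<^sub>R v\<close>, then in direction \<open>v\<close> for the
  derivative along \<open>u\<close> obtained in this way.\<close>

lemma second_difference:
  fixes f :: "'e::real_normed_vector \<Rightarrow> real"
  assumes f: "smooth_on S f" and h: "h > 0"
    and S: "\<And>s t. 0 \<le> s \<Longrightarrow> s \<le> h \<Longrightarrow> 0 \<le> t \<Longrightarrow> t \<le> h \<Longrightarrow> x + s *\<^sub>R u + t *\<^sub>R v \<in> S"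
  shows "\<exists>s t. 0 \<le> s \<and> s \<le> h \<and> 0 \<le> t \<and> t \<le> h \<and>
    f (x + h *\<^sub>R u + h *\<^sub>R v) - f (x + h *\<^sub>R u) - f (x + h *\<^sub>R v) + f x
      = h * h * frechet_derivative (\<lambda>y. frechet_derivative f (at y) u) (at (x + s *\<^sub>R u + t *\<^sub>R v)) v"
proof -
  let ?f1 = "\<lambda>y. frechet_derivative f (at y) u"
  have "((\<lambda>s. f (x + h *\<^sub>R v + s *\<^sub>R u) - f (x + s *\<^sub>R u)) has_real_derivative
      ?f1 (x + h *\<^sub>R v + s *\<^sub>R u) - ?f1 (x + s *\<^sub>R u)) (at s)" if "0 \<le> s" "s \<le> h" for s
    using S[of s h] S[of s 0] that h
    by (intro DERIV_diff smooth_on_line[OF f]) (simp_all add: algebra_simps)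
  then obtain s where s: "0 < s" "s < h"
    "(f (x + h *\<^sub>R v + h *\<^sub>R u) - f (x + h *\<^sub>R u)) - (f (x + h *\<^sub>R v + 0 *\<^sub>R u) - f (x + 0 *\<^sub>R u))
      = (h - 0) * (?f1 (x + h *\<^sub>R v + s *\<^sub>R u) - ?f1 (x + s *\<^sub>R u))"
    using MVT2[OF h, of "\<lambda>s. f (x + h *\<^sub>R v + s *\<^sub>R u) - f (x + s *\<^sub>R u)"
        "\<lambda>s. ?f1 (x + h *\<^sub>R v + s *\<^sub>R u) - ?f1 (x + s *\<^sub>R u)"] by blast
  have "((\<lambda>t. ?f1 (x + s *\<^sub>R u + t *\<^sub>R v)) has_real_derivative
      frechet_derivative ?f1 (at (x + s *\<^sub>R u + t *\<^sub>R v)) v) (at t)" if "0 \<le> t" "t \<le> h" for t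
    using S[of s t] that s by (intro smooth_on_line[OF smooth_on_frechet_derivative[OF f]]) simp
  then obtain t where t: "0 < t" "t < h"
    "?f1 (x + s *\<^sub>R u + h *\<^sub>R v) - ?f1 (x + s *\<^sub>R u + 0 *\<^sub>R v)
      = (h - 0) * frechet_derivative ?f1 (at (x + s *\<^sub>R u + t *\<^sub>R v)) v"
    using MVT2[OF h, of "\<lambda>t. ?f1 (x + s *\<^sub>R u + t *\<^sub>R v)"
        "\<lambda>t. frechet_derivative ?f1 (at (x + s *\<^sub>R u + t *\<^sub>R v)) v"] by blast
  have "f (x + h *\<^sub>R u + h *\<^sub>R v) - f (x + h *\<^sub>R u) - f (x + h *\<^sub>R v) + f x
      = h * h * frechet_derivative ?f1 (at (x + s *\<^sub>R u + t *\<^sub>R v)) v"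
    using s(3) t(3) by (simp add: add.commute add.left_commute)
  then show ?thesis using s t by (intro exI[of _ s] exI[of _ t]) simp
qed

text \<open>The second difference over a small parallelogram is symmetric in \<open>u\<close> and
  \<open>v\<close>, and up to the factor \<open>h * h\<close> it is a value of either mixed
  derivative near \<open>x\<close>. Continuity puts these values within half the supposed gap of the
  two sides, which is impossible.\<close>

lemma symmetric_second_derivative_real:
  fixes f :: "'e::real_normed_vector \<Rightarrow> real"
  assumes f: "smooth_on S f" and "open S" "x \<in> S"
  shows "frechet_derivative (\<lambda>y. frechet_derivative f (at y) u) (at x) v
       = frechet_derivative (\<lambda>y. frechet_derivative f (at y) v) (at x) u" (is "?a x = ?b x")
proof (rule ccontr)
  assume ne: "?a x \<noteq> ?b x"
  define e where "e = \<bar>?a x - ?b x\<bar> / 2"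
  have e: "e > 0" using ne by (simp add: e_def)
  have "continuous_on S ?a" "continuous_on S ?b"
    by (intro smooth_on_continuous smooth_on_frechet_derivative f)+
  then have "isCont ?a x" "isCont ?b x"
    using \<open>open S\<close> \<open>x \<in> S\<close> by (simp_all add: continuous_on_eq_continuous_at)
  then obtain d1 d2 where d: "d1 > 0" "\<And>y. dist y x < d1 \<Longrightarrow> dist (?a y) (?a x) < e"
      "d2 > 0" "\<And>y. dist y x < d2 \<Longrightarrow> dist (?b y) (?b x) < e"
    using e unfolding continuous_at_eps_delta by metis
  obtain d3 where d3: "d3 > 0" "ball x d3 \<subseteq> S"
    using \<open>open S\<close> \<open>x \<in> S\<close> open_contains_ball by blast
  define \<delta> where "\<delta> = min d1 (min d2 d3)"
  \<comment> \<open>With \<open>h = \<delta> / (2 * N)\<close> the whole parallelogram stays within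
    \<open>\<delta> / 2\<close> of \<open>x\<close>. The summand 1 keeps \<open>N\<close> positive
    when \<open>u\<close> and \<open>v\<close> both vanish.\<close>
  define N where "N = norm u + norm v + 1"
  define h where "h = \<delta> / (2 * N)"
  have \<delta>: "\<delta> > 0" using d d3 by (simp add: \<delta>_def)
  have pos: "N > 0" unfolding N_def by (smt (verit) norm_ge_zero)
  have h: "h > 0" using \<delta> pos by (simp add: h_def)
  have close: "dist (x + s *\<^sub>R u + t *\<^sub>R v) x < \<delta>" if "0 \<le> s" "s \<le> h" "0 \<le> t" "t \<le> h" for s t
  proof -
    have "dist (x + s *\<^sub>R u + t *\<^sub>R v) x = norm (s *\<^sub>R u + t *\<^sub>R v)" by (simp add: dist_norm)
    also have "\<dots> \<le> s * norm u + t * norm v" using that norm_triangle_ineq[of "s *\<^sub>R u" "t *\<^sub>R v"] by simp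
    also have "\<dots> \<le> h * norm u + h * norm v" using that by (intro add_mono mult_right_mono) auto
    also have "\<dots> \<le> h * N" using h by (simp add: N_def algebra_simps)
    also have "\<dots> = \<delta> / 2" using pos by (simp add: h_def)
    also have "\<dots> < \<delta>" using \<delta> by simp
    finally show ?thesis .
  qed
  have inS: "y \<in> S" if "dist y x < \<delta>" for y
    using that d3 by (auto simp: \<delta>_def dist_commute)
  obtain s t where st: "0 \<le> s" "s \<le> h" "0 \<le> t" "t \<le> h"
    "f (x + h *\<^sub>R u + h *\<^sub>R v) - f (x + h *\<^sub>R u) - f (x + h *\<^sub>R v) + f x
      = h * h * ?a (x + s *\<^sub>R u + t *\<^sub>R v)"
    using second_difference[OF f h, of x u v] inS close by blast
  have "x + s *\<^sub>R v + t *\<^sub>R u \<in> S" if "0 \<le> s" "s \<le> h" "0 \<le> t" "t \<le> h" for s t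
    using inS[OF close[of t s]] that by (simp add: algebra_simps)
  then obtain s' t' where st': "0 \<le> s'" "s' \<le> h" "0 \<le> t'" "t' \<le> h"
    "f (x + h *\<^sub>R v + h *\<^sub>R u) - f (x + h *\<^sub>R v) - f (x + h *\<^sub>R u) + f x
      = h * h * ?b (x + s' *\<^sub>R v + t' *\<^sub>R u)"
    using second_difference[OF f h, of x v u] by blast
  have sw: "x + h *\<^sub>R v + h *\<^sub>R u = x + h *\<^sub>R u + h *\<^sub>R v"
    "x + s' *\<^sub>R v + t' *\<^sub>R u = x + t' *\<^sub>R u + s' *\<^sub>R v" by (simp_all add: algebra_simps)
  have "h * h * ?a (x + s *\<^sub>R u + t *\<^sub>R v) = h * h * ?b (x + t' *\<^sub>R u + s' *\<^sub>R v)"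
    using st(5) st'(5) unfolding sw by linarith
  then have eq: "?a (x + s *\<^sub>R u + t *\<^sub>R v) = ?b (x + t' *\<^sub>R u + s' *\<^sub>R v)"
    using h by simp
  have "dist (?a (x + s *\<^sub>R u + t *\<^sub>R v)) (?a x) < e"
    using close[OF st(1-4)] by (intro d(2)) (simp add: \<delta>_def)
  moreover have "dist (?b (x + t' *\<^sub>R u + s' *\<^sub>R v)) (?b x) < e"
    using close[OF st'(3,4,1,2)] by (intro d(4)) (simp add: \<delta>_def)
  ultimately have "\<bar>?a x - ?b x\<bar> < 2 * e" using eq by (simp add: dist_real_def)
  then show False by (simp add: e_def)
qed

lemma frechet_derivative_inner:
  assumes "f differentiable at x"
  shows "frechet_derivative (\<lambda>x. f x \<bullet> w) (at x) v = frechet_derivative f (at x) v \<bullet> w"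
proof -
  have "((\<lambda>x. f x \<bullet> w) has_derivative (\<lambda>v. frechet_derivative f (at x) v \<bullet> w)) (at x)"
    using assms by (intro has_derivative_inner_left) (simp add: frechet_derivative_works)
  from frechet_derivative_at[OF this] show ?thesis by metis
qed

lemma symmetric_second_derivative:
  fixes f :: "'e::real_normed_vector \<Rightarrow> 'f::real_inner"
  assumes f: "smooth_on S f" and S: "open S" "x \<in> S"
  shows "frechet_derivative (\<lambda>y. frechet_derivative f (at y) u) (at x) v
       = frechet_derivative (\<lambda>y. frechet_derivative f (at y) v) (at x) u" (is "?a = ?b")
proof -
  have "?a \<bullet> w = ?b \<bullet> w" for w
  proof -
    let ?g = "\<lambda>x. f x \<bullet> w"
    have g: "smooth_on S ?g"
      by (intro smooth_on_linear[OF bounded_linear_inner_left] S f)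
    have d: "frechet_derivative ?g (at y) v = frechet_derivative f (at y) v \<bullet> w" if "y \<in> S" for y v
      using smooth_on_has_derivative[OF f that] by (intro frechet_derivative_inner differentiableI)
    have "frechet_derivative (\<lambda>y. frechet_derivative ?g (at y) u) (at x) v
        = frechet_derivative (\<lambda>y. frechet_derivative f (at y) u) (at x) v \<bullet> w" for u v
    proof -
      have "((\<lambda>y. frechet_derivative f (at y) u \<bullet> w) has_derivative
          (\<lambda>v. frechet_derivative (\<lambda>y. frechet_derivative f (at y) u) (at x) v \<bullet> w)) (at x)"
        by (intro has_derivative_inner_left smooth_on_has_derivative[OF _ S(2)]
            smooth_on_frechet_derivative f)
      then have "((\<lambda>y. frechet_derivative ?g (at y) u) has_derivative
          (\<lambda>v. frechet_derivative (\<lambda>y. frechet_derivative f (at y) u) (at x) v \<bullet> w)) (at x)"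
        by (rule has_derivative_transform_within_open[OF _ S]) (simp add: d)
      from frechet_derivative_at[OF this] show ?thesis by metis
    qed
    then show ?thesis using symmetric_second_derivative_real[OF g S, of u v] by simp
  qed
  then have "(?a - ?b) \<bullet> (?a - ?b) = 0" by (simp only: inner_diff_left)
  then show ?thesis by simp
qed

lemma smooth_on_diff:
  assumes "open S" "smooth_on S f" "smooth_on S g"
  shows "smooth_on S (\<lambda>x. f x - g x)"
proof -
  have "smooth_on S (\<lambda>x. f x + - g x)"
    by (intro smooth_on_add assms smooth_on_linear[OF bounded_linear_minus[OF bounded_linear_ident]])
  then show ?thesis by simp
qed

text \<open>Gram-Schmidt style elimination replaces Cramer's rule, as the number of vectors is not a type.\<close>

lemma smooth_on_solve:
  fixes m :: "nat \<Rightarrow> 'd::real_normed_vector \<Rightarrow> 'f::real_inner"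
  assumes S: "open S"
    and "\<And>i. i < r \<Longrightarrow> smooth_on S (m i)" "smooth_on S u"
    and "\<And>x c. x \<in> S \<Longrightarrow> (\<Sum>i<r. c i *\<^sub>R m i x) = 0 \<Longrightarrow> \<forall>i<r. c i = 0"
    and "\<And>x. x \<in> S \<Longrightarrow> u x = (\<Sum>i<r. a i x *\<^sub>R m i x)"
    and "i < r"
  shows "smooth_on S (a i)"
  using assms(2-)
proof (induction r arbitrary: m u i)
  case 0
  then show ?case by simp
next
  case (Suc r)
  define e where "e = m r"
  \<comment> \<open>Projection onto the orthogonal complement of the last vector.\<close>
  define P where "P x w = w - ((w \<bullet> e x) * inverse (e x \<bullet> e x)) *\<^sub>R e x" for x w
  have e: "smooth_on S e" using Suc.prems(1) by (simp add: e_def)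
  have ne: "e x \<bullet> e x \<noteq> 0" if "x \<in> S" for x
  proof
    assume "e x \<bullet> e x = 0"
    then have "m r x = 0" by (simp add: e_def)
    then have "(\<Sum>i<Suc r. (if i = r then 1 else 0) *\<^sub>R m i x) = 0"
      by (intro sum.neutral) auto
    then have "\<forall>i<Suc r. (if i = r then 1 else 0) = (0::real)" by (rule Suc.prems(3)[OF that])
    then show False by auto
  qed
  have P: "smooth_on S (\<lambda>x. P x (w x))" if "smooth_on S w" for w
    unfolding P_def
    by (intro smooth_on_diff smooth_on_bilinear[OF bounded_bilinear_scaleR]
        smooth_on_bilinear[OF bounded_bilinear_mult] smooth_on_bilinear[OF bounded_bilinear_inner]
        smooth_on_inverse that e S ne)
  have Plin: "linear (P x)" for x
    by (rule linearI) (simp_all add: P_def inner_add_left algebra_simps)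
  have Pe: "P x (e x) = 0" if "x \<in> S" for x using ne[OF that] by (simp add: P_def)
  \<comment> \<open>\<open>P\<close> kills the last vector, so the projected system has one unknown
    less and the same remaining coefficients.\<close>
  have a: "smooth_on S (a i)" if "i < r" for i
  proof (rule Suc.IH[OF _ _ _ _ that, where m = "\<lambda>i x. P x (m i x)" and u = "\<lambda>x. P x (u x)"])
    show "smooth_on S (\<lambda>x. P x (m i x))" if "i < r" for i
      using that Suc.prems(1) by (intro P) auto
    show "smooth_on S (\<lambda>x. P x (u x))" by (intro P Suc.prems)
    show "\<forall>i<r. c i = 0" if x: "x \<in> S" and 0: "(\<Sum>i<r. c i *\<^sub>R P x (m i x)) = 0" for x c
    proof -
      \<comment> \<open>A relation among the projected vectors says that \<open>w\<close> is a
        multiple of \<open>e x\<close>; adding that multiple as coefficient of the last vector gives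
        a relation among the original ones.\<close>
      define w where "w = (\<Sum>i<r. c i *\<^sub>R m i x)"
      have "P x w = 0"
        using 0 by (simp add: w_def linear_sum[OF Plin] linear_scale[OF Plin])
      then have w: "w = ((w \<bullet> e x) * inverse (e x \<bullet> e x)) *\<^sub>R e x" by (simp add: P_def)
      define c' where "c' i = (if i = r then - ((w \<bullet> e x) * inverse (e x \<bullet> e x)) else c i)" for i
      have "(\<Sum>i<Suc r. c' i *\<^sub>R m i x) = w + c' r *\<^sub>R e x"
        by (simp add: w_def c'_def e_def)
      also have "\<dots> = 0" using w by (simp add: c'_def)
      finally have "\<forall>i<Suc r. c' i = 0" by (rule Suc.prems(3)[OF x])
      then show ?thesis by (metis c'_def less_Suc_eq less_irrefl)
    qed
    show "P x (u x) = (\<Sum>i<r. a i x *\<^sub>R P x (m i x))" if "x \<in> S" for x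
      using Pe[OF that] by (simp add: Suc.prems(4)[OF that] linear_add[OF Plin] linear_sum[OF Plin]
          linear_scale[OF Plin] e_def)
  qed
  \<comment> \<open>The last coefficient is found by removing the part that is now known and pairing
    the rest with \<open>e x\<close>.\<close>
  have "smooth_on S (\<lambda>x. ((u x - (\<Sum>i<r. a i x *\<^sub>R m i x)) \<bullet> e x) * inverse (e x \<bullet> e x))"
    using Suc.prems(1,2)
    by (intro smooth_on_diff smooth_on_sum smooth_on_bilinear[OF bounded_bilinear_scaleR]
        smooth_on_bilinear[OF bounded_bilinear_mult] smooth_on_bilinear[OF bounded_bilinear_inner]
        smooth_on_inverse e S ne a) auto
  moreover have "((u x - (\<Sum>i<r. a i x *\<^sub>R m i x)) \<bullet> e x) * inverse (e x \<bullet> e x) = a r x" if "x \<in> S" for x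
    using ne[OF that] by (simp add: Suc.prems(4)[OF that] e_def)
  ultimately have "smooth_on S (a r)" by (rule smooth_on_cong[OF S, rotated])
  then show ?case using a Suc.prems(5) by (cases "i = r") auto
qed

section \<open>A smooth bump function on an inner product space\<close>

definition flat :: "nat \<Rightarrow> real \<Rightarrow> real" where
  "flat n t = (if t \<le> 0 then 0 else exp (- inverse t) * inverse t ^ n)"

lemma flat_tendsto: "((\<lambda>t. exp (- inverse t) * inverse t ^ n) \<longlongrightarrow> 0) (at_right (0::real))"
proof -
  have "((\<lambda>s::real. s ^ n / exp s) \<longlongrightarrow> 0) at_top" by (rule tendsto_power_div_exp_0)
  from filterlim_compose[OF this filterlim_inverse_at_top_right]
  show ?thesis by (simp add: exp_minus field_simps)
qed

text \<open>The family is closed under differentiation up to linear combinations, which is why all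
  exponents \<open>n\<close> are treated together although only \<open>flat 0\<close> is wanted. At
  \<open>0\<close> the difference quotient of \<open>flat n\<close> is \<open>flat (n + 1)\<close>
  from the right and \<open>0\<close> from the left.\<close>

lemma flat_has_derivative:
  "(flat n has_real_derivative (flat (n + 2) t - of_nat n * flat (n + 1) t)) (at t)"
proof -
  consider "t < 0" | "t = 0" | "t > 0" by linarith
  then show ?thesis
  proof cases
    case 1
    have "((\<lambda>_. 0) has_real_derivative 0) (at t)" by simp
    then have "(flat n has_real_derivative 0) (at t)"
      by (rule has_field_derivative_transform_within_open[of _ _ _ "{..<0}"]) (use 1 in \<open>auto simp: flat_def\<close>)
    then show ?thesis using 1 by (simp add: flat_def)
  next
    case 2
    have "((\<lambda>h. (flat n (0 + h) - flat n 0) / h) \<longlongrightarrow> 0) (at 0)"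
    proof (subst filterlim_at_split, intro conjI)
      show "((\<lambda>h. (flat n (0 + h) - flat n 0) / h) \<longlongrightarrow> 0) (at_left 0)"
        by (rule tendsto_eventually)
          (auto simp: flat_def eventually_at_left[of "-1"] intro!: exI[of _ "-1"])
      show "((\<lambda>h. (flat n (0 + h) - flat n 0) / h) \<longlongrightarrow> 0) (at_right 0)"
        by (rule Lim_transform_eventually[OF flat_tendsto[of "Suc n"]])
          (auto simp: flat_def eventually_at_right[of _ 1] field_simps intro!: exI[of _ 1])
    qed
    then show ?thesis using 2 by (simp add: DERIV_def flat_def)
  next
    case 3
    have pw: "m = 0 \<or> inverse t ^ m = inverse t * inverse t ^ (m - Suc 0)" for m
      by (cases m) auto
    have "((\<lambda>t. exp (- inverse t) * inverse t ^ n) has_real_derivative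
        exp (- inverse t) * inverse t ^ (n + 2) - n * (exp (- inverse t) * inverse t ^ (n + 1))) (at t)"
      using 3 pw[of "n - Suc 0"] by (cases n) (auto intro!: derivative_eq_intros simp: power2_eq_square algebra_simps)
    then have "(flat n has_real_derivative
        exp (- inverse t) * inverse t ^ (n + 2) - n * (exp (- inverse t) * inverse t ^ (n + 1))) (at t)"
      by (rule has_field_derivative_transform_within_open[of _ _ _ "{0<..}"]) (use 3 in \<open>auto simp: flat_def\<close>)
    then show ?thesis using 3 by (simp add: flat_def)
  qed
qed

lemma Ck_on_flat: "Ck_on k UNIV (flat n)"
proof (induction k arbitrary: n)
  case 0
  have "isCont (flat n) t" for t using DERIV_isCont[OF flat_has_derivative] .
  then show ?case by (simp add: continuous_at_imp_continuous_on)
next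
  case (Suc k)
  show ?case
  proof (rule Ck_on_SucI[OF open_UNIV])
    show "(flat n has_derivative (\<lambda>v. (flat (n + 2) t + - real n * flat (n + 1) t) * v)) (at t)" for t
      using flat_has_derivative[of n t] by (simp add: has_field_derivative_def)
    show "Ck_on k UNIV (\<lambda>t. (flat (n + 2) t + - real n * flat (n + 1) t) * v)" for v
      by (intro Ck_on_bilinear[OF bounded_bilinear_mult] Ck_on_add Ck_on_const Suc.IH open_UNIV)
  qed
qed

lemma smooth_bump:
  fixes x0 :: "'e::real_inner"
  assumes "e > 0"
  obtains \<beta> :: "'e \<Rightarrow> real" where "smooth_on UNIV \<beta>" "\<beta> x0 = 1" "\<And>x. x \<notin> cball x0 e \<Longrightarrow> \<beta> x = 0"
proof -
  \<comment> \<open>The squared distance is bilinear in \<open>x - x0\<close> and hence smooth,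
    unlike the norm; the constant factor normalises the value at \<open>x0\<close> to 1.\<close>
  define \<beta> where "\<beta> x = flat 0 (e\<^sup>2 - (x - x0) \<bullet> (x - x0)) * inverse (flat 0 (e\<^sup>2))" for x
  have pos: "flat 0 (e\<^sup>2) \<noteq> 0" using assms by (simp add: flat_def)
  have fl: "smooth_on UNIV (flat 0)" by (simp add: smooth_on_def Ck_on_flat)
  have "smooth_on UNIV (\<lambda>x. e\<^sup>2 - (x - x0) \<bullet> (x - x0))"
    by (intro smooth_on_diff smooth_on_const smooth_on_id open_UNIV
        smooth_on_bilinear[OF bounded_bilinear_inner])
  then have "smooth_on UNIV \<beta>" unfolding \<beta>_def
    by (intro smooth_on_bilinear[OF bounded_bilinear_mult] open_UNIV smooth_on_const
        smooth_on_compose[OF fin_dim_euclidean _ open_UNIV _ _ fl]) auto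
  moreover have "\<beta> x0 = 1" using pos by (simp add: \<beta>_def)
  moreover have "\<beta> x = 0" if "x \<notin> cball x0 e" for x
  proof -
    have "norm (x - x0) > e" using that by (simp add: dist_norm norm_minus_commute)
    then have "(norm (x - x0))\<^sup>2 > e\<^sup>2" using assms by (intro power_strict_mono) auto
    then show ?thesis by (simp add: \<beta>_def flat_def power2_norm_eq_inner)
  qed
  ultimately show ?thesis using that by blast
qed

text \<open>Serves to make closed balls of the model space compact. Adding one basis vector to
  \<open>B\<close> is a Minkowski sum with a segment, and sums of compact sets are compact.\<close>

lemma compact_combinations:
  fixes M :: "'e::real_normed_vector \<Rightarrow> real"
  assumes "finite B"
  shows "compact {\<Sum>b\<in>B. f b *\<^sub>R b | f. \<forall>b\<in>B. f b \<in> {- M b..M b}}"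
  using assms
proof (induction B)
  case empty
  then show ?case by simp
next
  case (insert b B)
  let ?K = "\<lambda>B. {\<Sum>b\<in>B. f b *\<^sub>R b | f. \<forall>b\<in>B. f b \<in> {- M b..M b}}"
  have "?K (insert b B) = {x + y | x y. x \<in> (\<lambda>a. a *\<^sub>R b) ` {- M b..M b} \<and> y \<in> ?K B}" (is "?L = ?R")
  proof (intro equalityI subsetI)
    fix z assume "z \<in> ?L"
    then obtain f where "z = (\<Sum>b\<in>insert b B. f b *\<^sub>R b)" "\<forall>b\<in>insert b B. f b \<in> {- M b..M b}" by blast
    then have "z = f b *\<^sub>R b + (\<Sum>b\<in>B. f b *\<^sub>R b)" "f b \<in> {- M b..M b}" "\<forall>b\<in>B. f b \<in> {- M b..M b}"
      using insert.hyps by auto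
    then show "z \<in> ?R" by blast
  next
    fix z assume "z \<in> ?R"
    then obtain a f where z: "z = a *\<^sub>R b + (\<Sum>b\<in>B. f b *\<^sub>R b)" "a \<in> {- M b..M b}" "\<forall>b\<in>B. f b \<in> {- M b..M b}"
      by blast
    have "(\<Sum>c\<in>B. (f(b := a)) c *\<^sub>R c) = (\<Sum>c\<in>B. f c *\<^sub>R c)"
      using insert.hyps by (intro sum.cong) auto
    then have "z = (\<Sum>c\<in>insert b B. (f(b := a)) c *\<^sub>R c)" "\<forall>c\<in>insert b B. (f(b := a)) c \<in> {- M c..M c}"
      using z insert.hyps by auto
    then show "z \<in> ?L" by blast
  qed
  moreover have "compact ((\<lambda>a. a *\<^sub>R b) ` {- M b..M b})"
    by (intro compact_continuous_image continuous_intros compact_Icc)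
  ultimately show ?case using compact_sums[OF _ insert.IH] by simp
qed

lemma compact_cball_fin_dim:
  assumes "fin_dim TYPE('e::real_inner)"
  shows "compact (cball (x::'e) e)"
proof -
  \<comment> \<open>By Cauchy-Schwarz this bounds the coefficient at \<open>b\<close> of any vector
    of the ball, since its norm is at most \<open>norm x + e\<close>.\<close>
  define M where "M b = (norm x + e) * norm b" for b :: 'e
  let ?K = "{\<Sum>b\<in>onb. f b *\<^sub>R b | f. \<forall>b\<in>onb. f b \<in> {- M b..M b}}"
  have "compact ?K" using onb(1)[OF assms] by (rule compact_combinations)
  moreover have "cball x e \<subseteq> ?K"
  proof
    fix v assume "v \<in> cball x e"
    then have "norm v \<le> norm x + e"
      using norm_triangle_ineq2[of v x] by (simp add: dist_norm norm_minus_commute)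
    then have "\<bar>v \<bullet> b\<bar> \<le> M b" for b
      unfolding M_def using Cauchy_Schwarz_ineq2[of v b] mult_right_mono[of "norm v" _ "norm b"]
      by (metis norm_ge_zero order_trans)
    then have "\<forall>b\<in>onb. v \<bullet> b \<in> {- M b..M b}" by (simp add: abs_le_iff minus_le_iff)
    then show "v \<in> ?K" using onb(2)[OF assms, of v] by blast
  qed
  ultimately show ?thesis
    using compact_Int_closed[of ?K "cball x e"] by (simp add: Int_absorb1)
qed

section \<open>Functions and vector fields on a manifold\<close>

text \<open>Vector values and the restriction to \<open>W\<close> make this apply to the components
  \<open>mderiv A (snd c) q (X q)\<close> of a field, which only make sense in the domain of
  \<open>c\<close>.\<close>

definition smooth_fn :: "('a, 'e::real_normed_vector) chart set \<Rightarrow> 'a set \<Rightarrow>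
    ('a \<Rightarrow> 'f::real_normed_vector) \<Rightarrow> bool" where
  "smooth_fn A W F \<longleftrightarrow> (\<forall>c\<in>A. smooth_on (snd c ` (W \<inter> fst c)) (\<lambda>x. F (chart_inv c x)))"

lemma smooth_fun_iff: "smooth_fun A f \<longleftrightarrow> smooth_fn A UNIV f"
  by (simp add: smooth_fun_def smooth_fn_def o_def)

lemma smooth_fn_subset: "smooth_fn A W F \<Longrightarrow> W' \<subseteq> W \<Longrightarrow> smooth_fn A W' F"
  unfolding smooth_fn_def by (metis (no_types, lifting) Int_mono image_mono order_refl smooth_on_subset)

locale manifold =
  fixes A :: "('a::{t2_space,second_countable_topology}, 'e::real_inner) chart set"
  assumes mfd: "smooth_manifold A"
begin

lemma fin_dim: "fin_dim TYPE('e)"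
  using mfd unfolding smooth_manifold_def fin_dim_def by blast

lemma chart_at: "chart_at A p \<in> A" "p \<in> fst (chart_at A p)"
proof -
  have "\<exists>c. c \<in> A \<and> p \<in> fst c" using mfd unfolding smooth_manifold_def by blast
  then have "chart_at A p \<in> A \<and> p \<in> fst (chart_at A p)"
    unfolding chart_at_def by (rule someI_ex)
  then show "chart_at A p \<in> A" "p \<in> fst (chart_at A p)" by blast+
qed

context
  fixes c assumes c: "c \<in> A"
begin

lemma open_chart: "open (fst c)"
  using mfd c unfolding smooth_manifold_def by blast

lemma chart_homeomorphism: "homeomorphism (fst c) (snd c ` fst c) (snd c) (chart_inv c)"
  using mfd c unfolding smooth_manifold_def by blast

lemma chart_inv_chart: "q \<in> fst c \<Longrightarrow> chart_inv c (snd c q) = q"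
  using homeomorphism_apply1[OF chart_homeomorphism] .

lemma chart_continuous: "continuous_on (fst c) (snd c)"
  using chart_homeomorphism by (simp add: homeomorphism_def)

lemma open_chart_image: "open W \<Longrightarrow> open (snd c ` (W \<inter> fst c))"
proof -
  assume "open W"
  then have "openin (top_of_set (fst c)) (W \<inter> fst c)"
    by (metis inf_commute openin_open_Int)
  then have "openin (top_of_set (snd c ` fst c)) (snd c ` (W \<inter> fst c))"
    by (rule homeomorphism_imp_open_map[OF chart_homeomorphism])
  moreover have "open (snd c ` fst c)"
    using mfd c unfolding smooth_manifold_def by blast
  ultimately show ?thesis by (rule openin_open_trans)
qed

end

lemma transition:
  assumes "c \<in> A" "c' \<in> A"
  shows "smooth_on (snd c ` (fst c \<inter> fst c')) (\<lambda>x. snd c' (chart_inv c x))"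
  using mfd assms unfolding smooth_manifold_def o_def by blast

text \<open>The expressions in all other charts arise from the one in \<open>c\<close> by
  composition with the smooth transition maps, so a single chart decides.\<close>

lemma smooth_fn_chartI:
  assumes c: "c \<in> A" and W: "open W" "W \<subseteq> fst c"
    and F: "smooth_on (snd c ` W) (\<lambda>x. F (chart_inv c x))"
  shows "smooth_fn A W F"
  unfolding smooth_fn_def
proof
  fix c' assume c': "c' \<in> A"
  have Wc: "W \<inter> fst c = W" using W by blast
  have o: "open (snd c' ` (W \<inter> fst c'))" "open (snd c ` W)"
    using open_chart_image[OF c' W(1)] open_chart_image[OF c W(1)] Wc by simp_all
  have i: "chart_inv c' x \<in> W \<inter> fst c'" if "x \<in> snd c' ` (W \<inter> fst c')" for x
    using that chart_inv_chart[OF c'] by auto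
  have "smooth_on (snd c' ` (W \<inter> fst c')) (\<lambda>x. snd c (chart_inv c' x))"
    by (rule smooth_on_subset[OF transition[OF c' c]]) (use W in auto)
  from smooth_on_compose[OF fin_dim o _ this F]
  have "smooth_on (snd c' ` (W \<inter> fst c')) (\<lambda>x. F (chart_inv c (snd c (chart_inv c' x))))"
    using i by blast
  then show "smooth_on (snd c' ` (W \<inter> fst c')) (\<lambda>x. F (chart_inv c' x))"
    by (rule smooth_on_cong[OF o(1), rotated]) (use i W chart_inv_chart[OF c] in \<open>simp add: subset_eq\<close>)
qed

lemma smooth_fn_chartD:
  assumes "smooth_fn A W F" "c \<in> A" "W \<subseteq> fst c"
  shows "smooth_on (snd c ` W) (\<lambda>x. F (chart_inv c x))"
  using assms unfolding smooth_fn_def by (metis inf.absorb1)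

lemma smooth_fn_local:
  assumes "\<And>p. p \<in> W \<Longrightarrow> \<exists>W'. open W' \<and> p \<in> W' \<and> smooth_fn A W' F"
  shows "smooth_fn A W F"
  unfolding smooth_fn_def
proof (intro ballI smooth_on_local)
  fix c x assume c: "c \<in> A" and "x \<in> snd c ` (W \<inter> fst c)"
  then obtain p where p: "p \<in> W" "p \<in> fst c" "x = snd c p" by blast
  obtain W' where W': "open W'" "p \<in> W'" "smooth_fn A W' F" using assms[OF p(1)] by blast
  show "\<exists>T. open T \<and> x \<in> T \<and> smooth_on T (\<lambda>x. F (chart_inv c x))"
    using W' p c open_chart_image[OF c W'(1)] unfolding smooth_fn_def
    by (intro exI[of _ "snd c ` (W' \<inter> fst c)"]) blast
qed

lemma smooth_fn_cong:
  assumes "open W" "\<And>q. q \<in> W \<Longrightarrow> F q = G q" "smooth_fn A W F"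
  shows "smooth_fn A W G"
  unfolding smooth_fn_def
proof
  fix c assume c: "c \<in> A"
  show "smooth_on (snd c ` (W \<inter> fst c)) (\<lambda>x. G (chart_inv c x))"
    by (rule smooth_on_cong[OF open_chart_image[OF c assms(1)], of "\<lambda>x. F (chart_inv c x)"])
      (use assms(2,3) chart_inv_chart[OF c] c in \<open>auto simp: smooth_fn_def\<close>)
qed

lemma smooth_fn_const: "smooth_fn A W (\<lambda>_. k)"
  by (simp add: smooth_fn_def smooth_on_const)

lemma smooth_fn_add:
  assumes "open W" "smooth_fn A W F" "smooth_fn A W G"
  shows "smooth_fn A W (\<lambda>q. F q + G q)"
  using assms unfolding smooth_fn_def by (simp add: smooth_on_add open_chart_image)

lemma smooth_fn_sum:
  assumes "open W" "\<And>i. i \<in> I \<Longrightarrow> smooth_fn A W (F i)"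
  shows "smooth_fn A W (\<lambda>q. \<Sum>i\<in>I. F i q)"
  using assms unfolding smooth_fn_def by (simp add: smooth_on_sum open_chart_image)

lemma smooth_fn_linear:
  assumes "bounded_linear L" "open W" "smooth_fn A W F"
  shows "smooth_fn A W (\<lambda>q. L (F q))"
  using assms(3) smooth_on_linear[OF assms(1) open_chart_image[OF _ assms(2)]]
  unfolding smooth_fn_def by blast

lemma smooth_fn_bilinear:
  assumes "bounded_bilinear B" "open W" "smooth_fn A W F" "smooth_fn A W G"
  shows "smooth_fn A W (\<lambda>q. B (F q) (G q))"
  using assms(3,4) smooth_on_bilinear[OF assms(1) open_chart_image[OF _ assms(2)]]
  unfolding smooth_fn_def by blast

lemmas smooth_fn_scaleR = smooth_fn_bilinear[OF bounded_bilinear_scaleR]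
lemmas smooth_fn_inner = smooth_fn_bilinear[OF bounded_bilinear_inner]
lemmas smooth_fn_mult = smooth_fn_bilinear[OF bounded_bilinear_mult]

lemma smooth_fn_inverse:
  fixes F :: "'a \<Rightarrow> real"
  assumes W: "open W" "\<And>q. q \<in> W \<Longrightarrow> F q \<noteq> 0" and F: "smooth_fn A W F"
  shows "smooth_fn A W (\<lambda>q. inverse (F q))"
  unfolding smooth_fn_def
proof
  fix c assume c: "c \<in> A"
  show "smooth_on (snd c ` (W \<inter> fst c)) (\<lambda>x. inverse (F (chart_inv c x)))"
    by (rule smooth_on_inverse[OF open_chart_image[OF c W(1)]])
      (use F W(2) chart_inv_chart[OF c] c in \<open>auto simp: smooth_fn_def\<close>)
qed

lemma smooth_fn_compose:
  fixes F :: "'a \<Rightarrow> 'g::real_inner"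
  assumes g: "fin_dim TYPE('g)" and W: "open W" and T: "open T" "\<And>q. q \<in> W \<Longrightarrow> F q \<in> T"
    and F: "smooth_fn A W F" and G: "smooth_on T G"
  shows "smooth_fn A W (\<lambda>q. G (F q))"
  unfolding smooth_fn_def
proof
  fix c assume c: "c \<in> A"
  show "smooth_on (snd c ` (W \<inter> fst c)) (\<lambda>x. G (F (chart_inv c x)))"
    by (rule smooth_on_compose[OF g open_chart_image[OF c W] T(1) _ _ G])
      (use F T(2) chart_inv_chart[OF c] c in \<open>auto simp: smooth_fn_def\<close>)
qed

lemma smooth_fn_chart: "c \<in> A \<Longrightarrow> smooth_fn A (fst c) (snd c)"
proof -
  assume c: "c \<in> A"
  have "smooth_on (snd c ` fst c) (\<lambda>x. snd c (chart_inv c x))"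
    by (rule smooth_on_cong[OF _ _ smooth_on_id])
      (use open_chart_image[OF c open_UNIV] in \<open>auto simp: f_inv_into_f\<close>)
  then show ?thesis by (rule smooth_fn_chartI[OF c open_chart[OF c] order_refl])
qed

lemma smooth_fn_continuous:
  assumes F: "smooth_fn A W F" and W: "open W"
  shows "continuous_on W F"
proof -
  have "isCont F p" if p: "p \<in> W" for p
  proof -
    let ?c = "chart_at A p"
    let ?U = "W \<inter> fst ?c"
    have U: "open ?U" using W open_chart[OF chart_at(1)] by blast
    have "continuous_on (snd ?c ` ?U) (\<lambda>x. F (chart_inv ?c x))"
      using F chart_at(1) unfolding smooth_fn_def by (blast intro: smooth_on_continuous)
    then have "continuous_on ?U (\<lambda>q. F (chart_inv ?c (snd ?c q)))"
      by (rule continuous_on_compose2)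
        (auto intro: continuous_on_subset[OF chart_continuous[OF chart_at(1)]])
    then have "continuous_on ?U F"
      by (rule continuous_on_cong[THEN iffD1, rotated -1])
        (auto simp: chart_inv_chart[OF chart_at(1)])
    then show ?thesis using U p chart_at(2) by (simp add: continuous_on_eq_continuous_at)
  qed
  then show ?thesis by (simp add: continuous_at_imp_continuous_on)
qed

section \<open>Derivatives of functions along tangent vectors\<close>

lemma smooth_fn_has_derivative:
  assumes F: "smooth_fn A W F" and W: "open W" "p \<in> W" and c: "c \<in> A" "p \<in> fst c"
  shows "((\<lambda>x. F (chart_inv c x)) has_derivative
    frechet_derivative (\<lambda>x. F (chart_inv c x)) (at (snd c p))) (at (snd c p))"
proof -
  have "smooth_on (snd c ` (W \<inter> fst c)) (\<lambda>x. F (chart_inv c x))"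
    using F c unfolding smooth_fn_def by blast
  then show ?thesis by (rule smooth_on_has_derivative) (use W c in blast)
qed

lemma mderivI:
  assumes "((\<lambda>x. F (chart_inv (chart_at A p) x)) has_derivative D) (at (snd (chart_at A p) p))"
  shows "mderiv A F p = D"
  using frechet_derivative_at[OF assms] by (simp add: mderiv_def o_def fun_eq_iff)

lemma mderiv_has_derivative:
  assumes F: "smooth_fn A W F" and W: "open W" "p \<in> W"
  shows "((\<lambda>x. F (chart_inv (chart_at A p) x)) has_derivative mderiv A F p)
    (at (snd (chart_at A p) p))"
  using smooth_fn_has_derivative[OF assms chart_at] mderivI by metis

text \<open>The change-of-chart rule, by the chain rule through the transition map. It links the
  derivative taken in the preferred chart at \<open>p\<close>, which varies with \<open>p\<close>,
  to one fixed chart.\<close>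

lemma mderiv_chart:
  assumes F: "((\<lambda>x. F (chart_inv c x)) has_derivative D) (at (snd c p))" and c: "c \<in> A" "p \<in> fst c"
  shows "mderiv A F p v = D (mderiv A (snd c) p v)"
proof -
  let ?d = "chart_at A p"
  have "((\<lambda>x. snd c (chart_inv ?d x)) has_derivative mderiv A (snd c) p) (at (snd ?d p))"
    by (rule mderiv_has_derivative[OF smooth_fn_chart[OF c(1)] open_chart[OF c(1)] c(2)])
  moreover have "((\<lambda>x. F (chart_inv c x)) has_derivative D) (at (snd c (chart_inv ?d (snd ?d p))))"
    using F by (simp add: chart_inv_chart chart_at)
  ultimately have "((\<lambda>x. F (chart_inv c (snd c (chart_inv ?d x)))) has_derivative
      (\<lambda>v. D (mderiv A (snd c) p v))) (at (snd ?d p))"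
    by (rule has_derivative_compose)
  then have "((\<lambda>x. F (chart_inv ?d x)) has_derivative
      (\<lambda>v. D (mderiv A (snd c) p v))) (at (snd ?d p))"
  proof (rule has_derivative_transform_within_open)
    show "open (snd ?d ` (fst c \<inter> fst ?d))"
      by (rule open_chart_image[OF chart_at(1) open_chart[OF c(1)]])
    show "snd ?d p \<in> snd ?d ` (fst c \<inter> fst ?d)" using c chart_at(2) by blast
    show "F (chart_inv c (snd c (chart_inv ?d x))) = F (chart_inv ?d x)"
      if "x \<in> snd ?d ` (fst c \<inter> fst ?d)" for x
      using that by (auto simp: chart_inv_chart chart_at(1) c(1))
  qed
  then show ?thesis by (simp add: mderivI)
qed

lemma mderiv_smooth_fn:
  assumes "smooth_fn A W F" "open W" "p \<in> W" "c \<in> A" "p \<in> fst c"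
  shows "mderiv A F p v =
    frechet_derivative (\<lambda>x. F (chart_inv c x)) (at (snd c p)) (mderiv A (snd c) p v)"
  by (rule mderiv_chart[OF smooth_fn_has_derivative[OF assms] assms(4,5)])

lemma mderiv_cong:
  assumes "open W" "p \<in> W" "\<And>q. q \<in> W \<Longrightarrow> F q = G q" "smooth_fn A W F"
  shows "mderiv A G p = mderiv A F p"
proof (rule mderivI)
  let ?d = "chart_at A p"
  show "((\<lambda>x. G (chart_inv ?d x)) has_derivative mderiv A F p) (at (snd ?d p))"
  proof (rule has_derivative_transform_within_open[OF mderiv_has_derivative[OF assms(4,1,2)]])
    show "open (snd ?d ` (W \<inter> fst ?d))" by (rule open_chart_image[OF chart_at(1) assms(1)])
    show "snd ?d p \<in> snd ?d ` (W \<inter> fst ?d)" using assms(2) chart_at(2) by blast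
    show "F (chart_inv ?d x) = G (chart_inv ?d x)" if "x \<in> snd ?d ` (W \<inter> fst ?d)" for x
      using that assms(3) by (auto simp: chart_inv_chart chart_at(1))
  qed
qed

lemma linear_mderiv: "smooth_fn A W F \<Longrightarrow> open W \<Longrightarrow> p \<in> W \<Longrightarrow> linear (mderiv A F p)"
  using mderiv_has_derivative has_derivative_linear by blast

lemma mderiv_const: "mderiv A (\<lambda>_. k) p v = 0"
  using mderivI[of "\<lambda>_. k" p "\<lambda>_. 0"] by simp

context
  fixes W and p :: 'a
  assumes W: "open W" "p \<in> W"
begin

lemma mderiv_add:
  assumes "smooth_fn A W F" "smooth_fn A W G"
  shows "mderiv A (\<lambda>q. F q + G q) p v = mderiv A F p v + mderiv A G p v"
  using mderivI[OF has_derivative_add[OF mderiv_has_derivative[OF assms(1) W]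
        mderiv_has_derivative[OF assms(2) W]]] by simp

lemma mderiv_bilinear:
  assumes "bounded_bilinear B" "smooth_fn A W F" "smooth_fn A W G"
  shows "mderiv A (\<lambda>q. B (F q) (G q)) p v = B (F p) (mderiv A G p v) + B (mderiv A F p v) (G p)"
  using mderivI[OF bounded_bilinear.FDERIV[OF assms(1) mderiv_has_derivative[OF assms(2) W]
        mderiv_has_derivative[OF assms(3) W]]]
  by (simp add: chart_inv_chart chart_at)

lemma mderiv_linear:
  assumes "bounded_linear L" "smooth_fn A W F"
  shows "mderiv A (\<lambda>q. L (F q)) p v = L (mderiv A F p v)"
  using mderivI[OF bounded_linear.has_derivative[OF assms(1) mderiv_has_derivative[OF assms(2) W]]]
  by simp

lemma mderiv_sum:
  assumes "\<And>i. i \<in> I \<Longrightarrow> smooth_fn A W (F i)"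
  shows "mderiv A (\<lambda>q. \<Sum>i\<in>I. F i q) p v = (\<Sum>i\<in>I. mderiv A (F i) p v)"
  using mderivI[OF has_derivative_sum[of I, OF mderiv_has_derivative[OF assms W]]] by simp

end

lemmas mderiv_mult = mderiv_bilinear[OF _ _ bounded_bilinear_mult]
lemmas mderiv_scaleR = mderiv_bilinear[OF _ _ bounded_bilinear_scaleR]

lemma mderiv_chart_at: "mderiv A (snd (chart_at A p)) p v = v"
proof -
  let ?d = "chart_at A p"
  have "((\<lambda>x. snd ?d (chart_inv ?d x)) has_derivative (\<lambda>v. v)) (at (snd ?d p))"
  proof (rule has_derivative_transform_within_open[OF has_derivative_ident])
    show "open (snd ?d ` (UNIV \<inter> fst ?d))" by (rule open_chart_image[OF chart_at(1) open_UNIV])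
    show "snd ?d p \<in> snd ?d ` (UNIV \<inter> fst ?d)" using chart_at(2) by blast
  qed (auto simp: chart_inv_chart chart_at(1))
  then show ?thesis by (simp add: mderivI)
qed

context
  fixes c p assumes c: "c \<in> A" "p \<in> fst c"
begin

lemma linear_dchart: "linear (mderiv A (snd c) p)"
  by (rule linear_mderiv[OF smooth_fn_chart[OF c(1)] open_chart[OF c(1)] c(2)])

text \<open>The inverse is the derivative of the transition map from \<open>c\<close> back to the
  preferred chart at \<open>p\<close>; differentiating the two composites, which are identities near
  the point, gives both inverse laws.\<close>

lemma bij_dchart: "bij (mderiv A (snd c) p)"
proof -
  let ?d = "chart_at A p"
  let ?E = "frechet_derivative (\<lambda>x. snd ?d (chart_inv c x)) (at (snd c p))"
  have E: "((\<lambda>x. snd ?d (chart_inv c x)) has_derivative ?E) (at (snd c p))"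
    by (rule smooth_fn_has_derivative[OF smooth_fn_chart[OF chart_at(1)] open_chart[OF chart_at(1)]
          chart_at(2) c])
  have 1: "?E (mderiv A (snd c) p v) = v" for v
    using mderiv_chart[OF E c] mderiv_chart_at by metis
  have "((\<lambda>x. snd c (chart_inv ?d x)) has_derivative mderiv A (snd c) p)
      (at (snd ?d (chart_inv c (snd c p))))"
    using mderiv_has_derivative[OF smooth_fn_chart[OF c(1)] open_chart[OF c(1)] c(2)]
    by (simp add: chart_inv_chart c)
  from has_derivative_compose[OF E this]
  have 2: "((\<lambda>x. snd c (chart_inv ?d (snd ?d (chart_inv c x)))) has_derivative
      (\<lambda>v. mderiv A (snd c) p (?E v))) (at (snd c p))" .
  have "((\<lambda>x. x) has_derivative (\<lambda>v. mderiv A (snd c) p (?E v))) (at (snd c p))"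
  proof (rule has_derivative_transform_within_open[OF 2])
    show "open (snd c ` (fst ?d \<inter> fst c))" by (rule open_chart_image[OF c(1) open_chart[OF chart_at(1)]])
    show "snd c p \<in> snd c ` (fst ?d \<inter> fst c)" using c chart_at(2) by blast
  qed (auto simp: chart_inv_chart chart_at(1) c(1))
  from has_derivative_unique[OF this has_derivative_ident]
  have "mderiv A (snd c) p (?E v) = v" for v by metis
  with 1 show ?thesis by (intro o_bij[of ?E]) (auto simp: fun_eq_iff)
qed

lemma dchart_coord_field: "mderiv A (snd c) p (coord_field A c w p) = w"
  using bij_dchart unfolding coord_field_def by (simp add: bij_is_surj surj_f_inv_f)

lemma coord_field_expand: "v = (\<Sum>b\<in>onb. (mderiv A (snd c) p v \<bullet> b) *\<^sub>R coord_field A c b p)"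
proof -
  have "mderiv A (snd c) p (\<Sum>b\<in>onb. (mderiv A (snd c) p v \<bullet> b) *\<^sub>R coord_field A c b p)
      = (\<Sum>b\<in>onb. (mderiv A (snd c) p v \<bullet> b) *\<^sub>R b)"
    by (simp add: linear_sum[OF linear_dchart] linear_scale[OF linear_dchart] dchart_coord_field)
  also have "\<dots> = mderiv A (snd c) p v" by (rule onb(2)[OF fin_dim, symmetric])
  finally show ?thesis by (rule injD[OF bij_is_inj[OF bij_dchart] sym])
qed

end

lemma smooth_fn_chart_derivative:
  assumes F: "smooth_fn A W F" and c: "c \<in> A" and W: "open W"
  shows "smooth_fn A (W \<inter> fst c) (\<lambda>q. frechet_derivative (\<lambda>x. F (chart_inv c x)) (at (snd c q)) b)"
proof (rule smooth_fn_chartI[OF c])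
  show "open (W \<inter> fst c)" using W open_chart[OF c] by blast
  have "smooth_on (snd c ` (W \<inter> fst c)) (\<lambda>x. frechet_derivative (\<lambda>x. F (chart_inv c x)) (at x) b)"
    using F c by (auto intro: smooth_on_frechet_derivative simp: smooth_fn_def)
  then show "smooth_on (snd c ` (W \<inter> fst c))
      (\<lambda>x. frechet_derivative (\<lambda>x. F (chart_inv c x)) (at (snd c (chart_inv c x))) b)"
    by (rule smooth_on_cong[OF open_chart_image[OF c W], rotated]) (auto simp: chart_inv_chart c)
qed auto

text \<open>In the chart \<open>c\<close> the derivative along \<open>X\<close> is the sum of the
  components of \<open>X\<close> times the partial derivatives of \<open>F\<close>, and each factor
  is smooth.\<close>

lemma smooth_fn_mderiv:
  assumes F: "smooth_fn A W F" and c: "c \<in> A" and W: "open W"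
    and X: "smooth_fn A (W \<inter> fst c) (\<lambda>q. mderiv A (snd c) q (X q))"
  shows "smooth_fn A (W \<inter> fst c) (\<lambda>q. mderiv A F q (X q))"
proof (rule smooth_fn_cong)
  show o: "open (W \<inter> fst c)" using W open_chart[OF c] by blast
  let ?D = "\<lambda>q. frechet_derivative (\<lambda>x. F (chart_inv c x)) (at (snd c q))"
  show "smooth_fn A (W \<inter> fst c) (\<lambda>q. \<Sum>b\<in>onb. (mderiv A (snd c) q (X q) \<bullet> b) *\<^sub>R ?D q b)"
    by (intro smooth_fn_sum o smooth_fn_scaleR smooth_fn_inner X smooth_fn_const
        smooth_fn_chart_derivative F c W)
  fix q assume q: "q \<in> W \<inter> fst c"
  then have "linear (?D q)"
    using has_derivative_linear[OF smooth_fn_has_derivative[OF F W _ c]] by blast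
  then have "?D q (mderiv A (snd c) q (X q)) = (\<Sum>b\<in>onb. (mderiv A (snd c) q (X q) \<bullet> b) *\<^sub>R ?D q b)"
    by (rule linear_onb[OF fin_dim])
  moreover have "mderiv A F q (X q) = ?D q (mderiv A (snd c) q (X q))"
    by (rule mderiv_smooth_fn[OF F W _ c]) (use q in auto)
  ultimately show "(\<Sum>b\<in>onb. (mderiv A (snd c) q (X q) \<bullet> b) *\<^sub>R ?D q b) = mderiv A F q (X q)"
    by (simp only:)
qed

section \<open>Smooth vector fields\<close>

lemma smooth_vfI:
  assumes "\<And>c. c \<in> A \<Longrightarrow> smooth_fn A (W \<inter> fst c) (\<lambda>q. mderiv A (snd c) q (X q))"
  shows "smooth_vf_on A W X"
  unfolding smooth_vf_on_def
proof
  fix c assume c: "c \<in> A"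
  show "smooth_on (snd c ` (W \<inter> fst c)) (\<lambda>x. mderiv A (snd c) (chart_inv c x) (X (chart_inv c x)))"
    by (rule smooth_fn_chartD[OF assms[OF c] c]) simp
qed

lemma smooth_vf_onD:
  assumes "smooth_vf_on A W X" "c \<in> A" "open W"
  shows "smooth_fn A (W \<inter> fst c) (\<lambda>q. mderiv A (snd c) q (X q))"
proof (rule smooth_fn_chartI[OF assms(2)])
  show "open (W \<inter> fst c)" using assms(3) open_chart[OF assms(2)] by blast
  show "smooth_on (snd c ` (W \<inter> fst c)) (\<lambda>x. mderiv A (snd c) (chart_inv c x) (X (chart_inv c x)))"
    using assms(1,2) unfolding smooth_vf_on_def by blast
qed simp

text \<open>One chart around each point is enough: the components of \<open>X\<close> in another
  chart \<open>c'\<close> are the derivative of the map \<open>snd c'\<close> along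
  \<open>X\<close>, so \<open>smooth_fn_mderiv\<close> transfers smoothness to them.\<close>

lemma smooth_vf_onI:
  assumes "\<And>p. p \<in> W \<Longrightarrow> \<exists>c W'. c \<in> A \<and> open W' \<and> p \<in> W' \<and> W' \<subseteq> fst c \<and>
      smooth_fn A W' (\<lambda>q. mderiv A (snd c) q (X q))"
  shows "smooth_vf_on A W X"
proof -
  have "smooth_fn A (W \<inter> fst c') (\<lambda>q. mderiv A (snd c') q (X q))" if c': "c' \<in> A" for c'
  proof (rule smooth_fn_local)
    fix p assume p: "p \<in> W \<inter> fst c'"
    then obtain c W' where c: "c \<in> A" "open W'" "p \<in> W'" "W' \<subseteq> fst c"
      "smooth_fn A W' (\<lambda>q. mderiv A (snd c) q (X q))" using assms by blast
    have "smooth_fn A ((W' \<inter> fst c') \<inter> fst c) (\<lambda>q. mderiv A (snd c') q (X q))"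
      by (rule smooth_fn_mderiv[OF smooth_fn_subset[OF smooth_fn_chart[OF c']] c(1) _
            smooth_fn_subset[OF c(5)]]) (use c open_chart[OF c'] in auto)
    then show "\<exists>W'. open W' \<and> p \<in> W' \<and> smooth_fn A W' (\<lambda>q. mderiv A (snd c') q (X q))"
      using c p open_chart[OF c'] open_chart[OF c(1)]
      by (intro exI[of _ "(W' \<inter> fst c') \<inter> fst c"]) auto
  qed
  then show ?thesis by (rule smooth_vfI)
qed

lemma smooth_fn_mderiv_vf:
  assumes F: "smooth_fn A W F" and W: "open W" and X: "smooth_vf_on A W X"
  shows "smooth_fn A W (\<lambda>q. mderiv A F q (X q))"
proof (rule smooth_fn_local)
  fix p assume "p \<in> W"
  then show "\<exists>W'. open W' \<and> p \<in> W' \<and> smooth_fn A W' (\<lambda>q. mderiv A F q (X q))"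
    using smooth_fn_mderiv[OF F chart_at(1) W smooth_vf_onD[OF X chart_at(1) W]] W
      chart_at[of p] open_chart[OF chart_at(1)]
    by (intro exI[of _ "W \<inter> fst (chart_at A p)"]) auto
qed

lemma smooth_vf_on_subset: "smooth_vf_on A W X \<Longrightarrow> W' \<subseteq> W \<Longrightarrow> smooth_vf_on A W' X"
  unfolding smooth_vf_on_def by (metis (no_types, lifting) Int_mono image_mono order_refl smooth_on_subset)

lemma smooth_vf_on_add:
  assumes W: "open W" and X: "smooth_vf_on A W X" and Y: "smooth_vf_on A W Y"
  shows "smooth_vf_on A W (\<lambda>q. X q + Y q)"
proof (rule smooth_vfI)
  fix c assume c: "c \<in> A"
  show "smooth_fn A (W \<inter> fst c) (\<lambda>q. mderiv A (snd c) q (X q + Y q))"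
    by (rule smooth_fn_cong[OF _ _ smooth_fn_add[OF _ smooth_vf_onD[OF X c W] smooth_vf_onD[OF Y c W]]])
      (use W open_chart[OF c] linear_add[OF linear_dchart[OF c]] in auto)
qed

lemma smooth_vf_on_scaleR:
  assumes W: "open W" and f: "smooth_fn A W f" and Y: "smooth_vf_on A W Y"
  shows "smooth_vf_on A W (\<lambda>q. f q *\<^sub>R Y q)"
proof (rule smooth_vfI)
  fix c assume c: "c \<in> A"
  show "smooth_fn A (W \<inter> fst c) (\<lambda>q. mderiv A (snd c) q (f q *\<^sub>R Y q))"
    by (rule smooth_fn_cong[OF _ _ smooth_fn_scaleR[OF _ smooth_fn_subset[OF f]
              smooth_vf_onD[OF Y c W]]])
      (use W open_chart[OF c] linear_scale[OF linear_dchart[OF c]] in auto)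
qed

lemma smooth_vf_on_zero: "smooth_vf_on A W (\<lambda>_. 0)"
proof (rule smooth_vfI)
  fix c assume c: "c \<in> A"
  have o: "open (fst c)" by (rule open_chart[OF c])
  have "smooth_fn A (fst c) (\<lambda>q. mderiv A (snd c) q 0)"
    by (rule smooth_fn_cong[OF o _ smooth_fn_const[of _ 0]]) (simp add: linear_0[OF linear_dchart[OF c]])
  then show "smooth_fn A (W \<inter> fst c) (\<lambda>q. mderiv A (snd c) q 0)"
    by (rule smooth_fn_subset) auto
qed

lemma smooth_vf_on_diff:
  assumes W: "open W" and X: "smooth_vf_on A W X" and Y: "smooth_vf_on A W Y"
  shows "smooth_vf_on A W (\<lambda>q. X q - Y q)"
  using smooth_vf_on_add[OF W X smooth_vf_on_scaleR[OF W smooth_fn_const[of _ "- 1"] Y]] by simp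

lemma smooth_vf_on_sum:
  assumes W: "open W" and X: "\<And>i. i \<in> I \<Longrightarrow> smooth_vf_on A W (X i)"
  shows "smooth_vf_on A W (\<lambda>q. \<Sum>i\<in>I. X i q)"
  using X by (induction I rule: infinite_finite_induct)
    (simp_all add: smooth_vf_on_zero smooth_vf_on_add[OF W])

lemma smooth_vf_coord_field: "c \<in> A \<Longrightarrow> smooth_vf_on A (fst c) (coord_field A c w)"
proof (rule smooth_vf_onI)
  fix p assume c: "c \<in> A" and p: "p \<in> fst c"
  have "smooth_fn A (fst c) (\<lambda>q. mderiv A (snd c) q (coord_field A c w q))"
    by (rule smooth_fn_cong[OF open_chart[OF c] _ smooth_fn_const[of _ w]])
      (simp add: dchart_coord_field[OF c])
  then show "\<exists>c' W'. c' \<in> A \<and> open W' \<and> p \<in> W' \<and> W' \<subseteq> fst c' \<and>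
      smooth_fn A W' (\<lambda>q. mderiv A (snd c') q (coord_field A c w q))"
    using c p open_chart[OF c] by blast
qed

lemma smooth_vf_local:
  assumes "\<And>p. p \<in> W \<Longrightarrow> \<exists>W'. open W' \<and> p \<in> W' \<and> smooth_vf_on A W' X"
  shows "smooth_vf_on A W X"
proof (rule smooth_vf_onI)
  fix p assume "p \<in> W"
  then obtain W' where W': "open W'" "p \<in> W'" "smooth_vf_on A W' X" using assms by blast
  show "\<exists>c W'. c \<in> A \<and> open W' \<and> p \<in> W' \<and> W' \<subseteq> fst c \<and> smooth_fn A W' (\<lambda>q. mderiv A (snd c) q (X q))"
    using smooth_vf_onD[OF W'(3) chart_at(1)[of p] W'(1)] W' chart_at[of p] open_chart[OF chart_at(1)]
    by (intro exI[of _ "chart_at A p"] exI[of _ "W' \<inter> fst (chart_at A p)"]) auto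
qed

lemma smooth_vf_on_cong:
  assumes "open W" "\<And>q. q \<in> W \<Longrightarrow> X q = Y q" "smooth_vf_on A W X"
  shows "smooth_vf_on A W Y"
proof (rule smooth_vfI)
  fix c assume c: "c \<in> A"
  show "smooth_fn A (W \<inter> fst c) (\<lambda>q. mderiv A (snd c) q (Y q))"
    by (rule smooth_fn_cong[OF _ _ smooth_vf_onD[OF assms(3) c assms(1)]])
      (use assms open_chart[OF c] in auto)
qed

section \<open>Bump functions on a manifold, extension of fields, tensoriality\<close>

lemma bump:
  assumes W: "open W" "p \<in> W"
  obtains \<rho> K where "smooth_fn A UNIV \<rho>" "\<rho> p = (1::real)" "closed K" "K \<subseteq> W" "\<And>q. q \<notin> K \<Longrightarrow> \<rho> q = 0"
proof -
  let ?c = "chart_at A p"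
  note c = chart_at[of p]
  have "open (snd ?c ` (W \<inter> fst ?c))" "snd ?c p \<in> snd ?c ` (W \<inter> fst ?c)"
    using open_chart_image[OF c(1) W(1)] W c by auto
  then obtain e where e: "e > 0" "cball (snd ?c p) e \<subseteq> snd ?c ` (W \<inter> fst ?c)"
    using open_contains_cball by metis
  obtain \<beta> :: "'e \<Rightarrow> real" where \<beta>: "smooth_on UNIV \<beta>" "\<beta> (snd ?c p) = 1"
      "\<And>x. x \<notin> cball (snd ?c p) e \<Longrightarrow> \<beta> x = 0"
    using smooth_bump[OF e(1), of "snd ?c p"] by blast
  define K where "K = chart_inv ?c ` cball (snd ?c p) e"
  define \<rho> where "\<rho> q = (if q \<in> fst ?c then \<beta> (snd ?c q) else 0)" for q
  have "continuous_on (snd ?c ` fst ?c) (chart_inv ?c)"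
    using chart_homeomorphism[OF c(1)] by (simp add: homeomorphism_def)
  then have "continuous_on (cball (snd ?c p) e) (chart_inv ?c)"
    by (rule continuous_on_subset) (use e in auto)
  then have "compact K"
    unfolding K_def using compact_cball_fin_dim[OF fin_dim] by (rule compact_continuous_image)
  \<comment> \<open>The Hausdorff property enters here: the compact image of the ball is closed in
    the whole manifold and not merely in the chart, so extension by \<open>0\<close> is
    smooth.\<close>
  then have K: "closed K" by (rule compact_imp_closed)
  have KW: "K \<subseteq> W"
  proof
    fix q assume "q \<in> K"
    then obtain r where "r \<in> W \<inter> fst ?c" "q = chart_inv ?c (snd ?c r)" using e unfolding K_def by blast
    then show "q \<in> W" using chart_inv_chart[OF c(1)] by auto
  qed
  have 0: "\<rho> q = 0" if "q \<notin> K" for q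
  proof (cases "q \<in> fst ?c")
    case True
    then have "snd ?c q \<notin> cball (snd ?c p) e"
      using that chart_inv_chart[OF c(1) True] unfolding K_def by (metis image_eqI)
    then show ?thesis using \<beta>(3) by (simp add: \<rho>_def)
  qed (simp add: \<rho>_def)
  have "smooth_fn A UNIV \<rho>"
  proof (rule smooth_fn_local)
    fix q
    have o: "open (fst ?c)" by (rule open_chart[OF c(1)])
    have "smooth_fn A (fst ?c) \<rho>"
      by (rule smooth_fn_cong[OF o _ smooth_fn_compose[OF fin_dim o open_UNIV _
              smooth_fn_chart[OF c(1)] \<beta>(1)]]) (auto simp: \<rho>_def)
    moreover have "smooth_fn A (- K) \<rho>"
      by (rule smooth_fn_cong[OF _ _ smooth_fn_const[of _ 0]]) (use K 0 in \<open>auto simp: open_Compl\<close>)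
    moreover have "q \<in> fst ?c \<or> q \<in> - K"
    proof -
      have "K \<subseteq> fst ?c"
      proof
        fix q assume "q \<in> K"
        then obtain r where "r \<in> W \<inter> fst ?c" "q = chart_inv ?c (snd ?c r)" using e unfolding K_def by blast
        then show "q \<in> fst ?c" using chart_inv_chart[OF c(1)] by auto
      qed
      then show ?thesis by blast
    qed
    ultimately show "\<exists>W'. open W' \<and> q \<in> W' \<and> smooth_fn A W' \<rho>"
      using o K open_Compl by blast
  qed
  moreover have "\<rho> p = 1" using c \<beta>(2) by (simp add: \<rho>_def)
  ultimately show ?thesis using that K KW 0 by blast
qed

context
  fixes W K and \<rho> :: "'a \<Rightarrow> real"
  assumes W: "open W" and \<rho>: "smooth_fn A UNIV \<rho>" and K: "closed K" "K \<subseteq> W" "\<And>q. q \<notin> K \<Longrightarrow> \<rho> q = 0"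
begin

text \<open>The open sets \<open>W\<close> and \<open>- K\<close> cover the manifold, and on the
  second one the product is \<open>0\<close>, whatever \<open>F\<close> does outside
  \<open>W\<close>.\<close>

lemma smooth_fn_cutoff:
  assumes "smooth_fn A W F"
  shows "smooth_fn A UNIV (\<lambda>q. \<rho> q *\<^sub>R F q)"
proof (rule smooth_fn_local)
  fix p
  have "smooth_fn A W (\<lambda>q. \<rho> q *\<^sub>R F q)"
    by (intro smooth_fn_scaleR W smooth_fn_subset[OF \<rho>] assms subset_UNIV)
  moreover have "smooth_fn A (- K) (\<lambda>q. \<rho> q *\<^sub>R F q)"
    by (rule smooth_fn_cong[OF _ _ smooth_fn_const[of _ 0]]) (use K in \<open>auto simp: open_Compl\<close>)
  ultimately show "\<exists>W'. open W' \<and> p \<in> W' \<and> smooth_fn A W' (\<lambda>q. \<rho> q *\<^sub>R F q)"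
    using K W open_Compl[OF K(1)] by blast
qed

lemma smooth_vf_cutoff:
  assumes "smooth_vf_on A W X"
  shows "smooth_vf A (\<lambda>q. \<rho> q *\<^sub>R X q)"
proof (rule smooth_vf_local)
  fix p
  have "smooth_vf_on A W (\<lambda>q. \<rho> q *\<^sub>R X q)"
    by (intro smooth_vf_on_scaleR W smooth_fn_subset[OF \<rho>] assms subset_UNIV)
  moreover have "smooth_vf_on A (- K) (\<lambda>q. \<rho> q *\<^sub>R X q)"
    by (rule smooth_vf_on_cong[OF _ _ smooth_vf_on_zero]) (use K in \<open>auto simp: open_Compl\<close>)
  ultimately show "\<exists>W'. open W' \<and> p \<in> W' \<and> smooth_vf_on A W' (\<lambda>q. \<rho> q *\<^sub>R X q)"
    using K W open_Compl[OF K(1)] by blast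
qed

end

text \<open>Connections, brackets and forms are evaluated on global fields, so every pointwise
  argument begins by extending its vectors. A coordinate field times a bump function does
  this.\<close>

lemma vf_through: obtains X where "smooth_vf A X" "X p = v"
proof -
  let ?c = "chart_at A p"
  note c = chart_at[of p]
  obtain \<rho> K where \<rho>: "smooth_fn A UNIV \<rho>" "\<rho> p = (1::real)" "closed K" "K \<subseteq> fst ?c" "\<And>q. q \<notin> K \<Longrightarrow> \<rho> q = 0"
    using bump[OF open_chart[OF c(1)] c(2)] by blast
  let ?X = "\<lambda>q. \<rho> q *\<^sub>R coord_field A ?c v q"
  have "smooth_vf A ?X"
    by (rule smooth_vf_cutoff[OF open_chart[OF c(1)] \<rho>(1,3,4,5) smooth_vf_coord_field[OF c(1)]])
  moreover have "?X p = v"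
    using dchart_coord_field[OF c, of v] by (simp add: \<rho>(2) mderiv_chart_at)
  ultimately show ?thesis by (rule that)
qed

text \<open>\<open>\<rho>\<^sup>2 Y\<close> is a combination of the globally smooth fields \<open>\<rho> E\<^sub>b\<close> with globally smooth
  coefficients, so a function-linear operator only sees the components of \<open>Y\<close> at \<open>p\<close>.\<close>

lemma tensorial:
  fixes \<Phi> :: "('a \<Rightarrow> 'e) \<Rightarrow> 'f::real_vector"
  assumes add: "\<And>X Y. smooth_vf A X \<Longrightarrow> smooth_vf A Y \<Longrightarrow> \<Phi> (\<lambda>q. X q + Y q) = \<Phi> X + \<Phi> Y"
    and scale: "\<And>f X. smooth_fn A UNIV f \<Longrightarrow> smooth_vf A X \<Longrightarrow> \<Phi> (\<lambda>q. f q *\<^sub>R X q) = f p *\<^sub>R \<Phi> X"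
  shows "\<exists>L. linear L \<and> (\<forall>X. smooth_vf A X \<longrightarrow> \<Phi> X = L (X p))"
proof -
  let ?c = "chart_at A p"
  note c = chart_at[of p]
  obtain \<rho> K where \<rho>: "smooth_fn A UNIV \<rho>" "\<rho> p = (1::real)" "closed K" "K \<subseteq> fst ?c" "\<And>q. q \<notin> K \<Longrightarrow> \<rho> q = 0"
    using bump[OF open_chart[OF c(1)] c(2)] by blast
  note cut = \<rho>(1,3,4,5)
  let ?E = "\<lambda>b q. \<rho> q *\<^sub>R coord_field A ?c b q"
  define L where "L v = (\<Sum>b\<in>onb. (v \<bullet> b) *\<^sub>R \<Phi> (?E b))" for v
  have E: "smooth_vf A (?E b)" for b
    by (rule smooth_vf_cutoff[OF open_chart[OF c(1)] cut smooth_vf_coord_field[OF c(1)]])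
  have zero: "\<Phi> (\<lambda>_. 0) = 0"
    using scale[OF smooth_fn_const[of _ 0] smooth_vf_on_zero] by simp
  have sum: "\<Phi> (\<lambda>q. \<Sum>i\<in>I. Y i q) = (\<Sum>i\<in>I. \<Phi> (Y i))" if "\<And>i. i \<in> I \<Longrightarrow> smooth_vf A (Y i)"
    for I :: "'e set" and Y
    using that
  proof (induction I rule: infinite_finite_induct)
    case (insert i I)
    then show ?case
      using add[of "Y i" "\<lambda>q. \<Sum>i\<in>I. Y i q"] smooth_vf_on_sum[OF open_UNIV, of I Y] by simp
  qed (simp_all add: zero)
  have "\<Phi> X = L (X p)" if X: "smooth_vf A X" for X
  proof -
    let ?f = "\<lambda>b q. \<rho> q *\<^sub>R (mderiv A (snd ?c) q (X q) \<bullet> b)"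
    have o: "open (fst ?c)" by (rule open_chart[OF c(1)])
    have f: "smooth_fn A UNIV (?f b)" for b
      by (intro smooth_fn_cutoff[OF o cut] smooth_fn_inner o smooth_fn_const
          smooth_vf_onD[OF X c(1) open_UNIV, unfolded Int_UNIV_left])
    have "\<Phi> X = \<Phi> (\<lambda>q. (\<rho> q * \<rho> q) *\<^sub>R X q)"
      using scale[OF smooth_fn_mult[OF open_UNIV \<rho>(1) \<rho>(1)] X] \<rho>(2) by simp
    also have "(\<lambda>q. (\<rho> q * \<rho> q) *\<^sub>R X q) = (\<lambda>q. \<Sum>b\<in>onb. ?f b q *\<^sub>R ?E b q)"
    proof
      fix q
      show "(\<rho> q * \<rho> q) *\<^sub>R X q = (\<Sum>b\<in>onb. ?f b q *\<^sub>R ?E b q)"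
      proof (cases "q \<in> K")
        case True
        then have q: "q \<in> fst ?c" using \<rho>(4) by blast
        have "(\<rho> q * \<rho> q) *\<^sub>R X q =
            (\<rho> q * \<rho> q) *\<^sub>R (\<Sum>b\<in>onb. (mderiv A (snd ?c) q (X q) \<bullet> b) *\<^sub>R coord_field A ?c b q)"
          using coord_field_expand[OF c(1) q, of "X q"] by simp
        then show ?thesis by (simp add: scaleR_sum_right mult_ac)
      qed (simp add: \<rho>(5))
    qed
    also have "\<Phi> \<dots> = (\<Sum>b\<in>onb. \<Phi> (\<lambda>q. ?f b q *\<^sub>R ?E b q))"
      by (rule sum) (intro smooth_vf_on_scaleR open_UNIV f E)
    also have "\<dots> = (\<Sum>b\<in>onb. ?f b p *\<^sub>R \<Phi> (?E b))"
      using scale[OF f E] by simp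
    also have "\<dots> = L (X p)" by (simp add: L_def \<rho>(2) mderiv_chart_at)
    finally show ?thesis .
  qed
  moreover have "linear L"
    by (rule linearI) (simp_all add: L_def inner_add_left scaleR_add_left sum.distrib scaleR_sum_right)
  ultimately show ?thesis by blast
qed

end

section \<open>The Lie bracket\<close>

context manifold
begin

text \<open>Separates the coordinate Hessian of \<open>F\<close> from the term containing the
  derivative of the components of \<open>Y\<close>. When two fields are exchanged, the Hessian
  cancels by symmetry and the other terms make up the bracket.\<close>

lemma second_mderiv:
  fixes F :: "'a \<Rightarrow> 'f::real_inner"
  assumes F: "smooth_fn A W F" and W: "open W" "p \<in> W" and Y: "smooth_vf A Y"
  defines "c \<equiv> chart_at A p"
  shows "mderiv A (\<lambda>q. mderiv A F q (Y q)) p v =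
      frechet_derivative (\<lambda>x. frechet_derivative (\<lambda>x. F (chart_inv c x)) (at x) v) (at (snd c p)) (Y p)
      + mderiv A F p (mderiv A (\<lambda>q. mderiv A (snd c) q (Y q)) p v)"
proof -
  note c = chart_at[of p, folded c_def]
  let ?F = "\<lambda>x. F (chart_inv c x)"
  let ?D = "\<lambda>b q. frechet_derivative ?F (at (snd c q)) b"
  let ?y = "\<lambda>q. mderiv A (snd c) q (Y q)"
  let ?H = "\<lambda>u v. frechet_derivative (\<lambda>x. frechet_derivative ?F (at x) u) (at (snd c p)) v"
  let ?U = "W \<inter> fst c"
  have U: "open ?U" "p \<in> ?U" using W c open_chart[OF c(1)] by auto
  have S: "open (snd c ` ?U)" "snd c p \<in> snd c ` ?U" using open_chart_image[OF c(1) W(1)] U by auto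
  have Fs: "smooth_on (snd c ` ?U) ?F" using F c(1) unfolding smooth_fn_def by blast
  have D: "smooth_fn A ?U (?D b)" for b by (rule smooth_fn_chart_derivative[OF F c(1) W(1)])
  have y: "smooth_fn A ?U ?y"
    by (rule smooth_fn_subset[OF smooth_vf_onD[OF Y c(1) open_UNIV]]) blast
  have yp: "mderiv A (snd c) p v = v" for v unfolding c_def by (rule mderiv_chart_at)
  have H: "mderiv A (?D b) p v = ?H b v" for b v
  proof -
    have "((\<lambda>x. frechet_derivative ?F (at x) b) has_derivative (\<lambda>v. ?H b v)) (at (snd c p))"
      by (rule smooth_on_has_derivative[OF smooth_on_frechet_derivative[OF Fs] S(2)])
    then have "((\<lambda>x. ?D b (chart_inv c x)) has_derivative (\<lambda>v. ?H b v)) (at (snd c p))"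
      by (rule has_derivative_transform_within_open[OF _ S]) (auto simp: chart_inv_chart c)
    then show ?thesis unfolding c_def by (simp add: mderivI)
  qed
  have expand: "mderiv A F q w = (\<Sum>b\<in>onb. (mderiv A (snd c) q w \<bullet> b) *\<^sub>R ?D b q)" if "q \<in> ?U" for q w
  proof -
    have "linear (\<lambda>b. ?D b q)"
      using has_derivative_linear[OF smooth_fn_has_derivative[OF F W(1) _ c(1)]] that by blast
    then have "?D (mderiv A (snd c) q w) q = (\<Sum>b\<in>onb. (mderiv A (snd c) q w \<bullet> b) *\<^sub>R ?D b q)"
      by (rule linear_onb[OF fin_dim])
    moreover have "mderiv A F q w = ?D (mderiv A (snd c) q w) q"
      by (rule mderiv_smooth_fn[OF F W(1) _ c(1)]) (use that in auto)
    ultimately show ?thesis by (simp only:)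
  qed
  have smG: "smooth_fn A ?U (\<lambda>q. \<Sum>b\<in>onb. (?y q \<bullet> b) *\<^sub>R ?D b q)"
    by (intro smooth_fn_sum smooth_fn_scaleR smooth_fn_inner y D U smooth_fn_const)
  have "mderiv A (\<lambda>q. mderiv A F q (Y q)) p
      = mderiv A (\<lambda>q. \<Sum>b\<in>onb. (?y q \<bullet> b) *\<^sub>R ?D b q) p"
    by (rule mderiv_cong[OF U expand[symmetric] smG])
  then have "mderiv A (\<lambda>q. mderiv A F q (Y q)) p v
      = mderiv A (\<lambda>q. \<Sum>b\<in>onb. (?y q \<bullet> b) *\<^sub>R ?D b q) p v"
    by (rule fun_cong)
  also have "\<dots> = (\<Sum>b\<in>onb. mderiv A (\<lambda>q. (?y q \<bullet> b) *\<^sub>R ?D b q) p v)"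
    by (intro mderiv_sum[OF U] smooth_fn_scaleR smooth_fn_inner y D U smooth_fn_const)
  also have "\<dots> = (\<Sum>b\<in>onb. (?y p \<bullet> b) *\<^sub>R ?H b v + (mderiv A ?y p v \<bullet> b) *\<^sub>R ?D b p)"
  proof (rule sum.cong[OF refl])
    fix b
    have "mderiv A (\<lambda>q. ?y q \<bullet> b) p v = mderiv A ?y p v \<bullet> b"
      by (rule mderiv_linear[OF U bounded_linear_inner_left y])
    then show "mderiv A (\<lambda>q. (?y q \<bullet> b) *\<^sub>R ?D b q) p v
        = (?y p \<bullet> b) *\<^sub>R ?H b v + (mderiv A ?y p v \<bullet> b) *\<^sub>R ?D b p"
      using mderiv_scaleR[OF U smooth_fn_linear[OF bounded_linear_inner_left U(1) y] D, of b b v]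
      by (simp add: H)
  qed
  also have "\<dots> = (\<Sum>b\<in>onb. (Y p \<bullet> b) *\<^sub>R ?H v b) + mderiv A F p (mderiv A ?y p v)"
  proof -
    \<comment> \<open>Symmetry moves the basis vector into the outer derivative, which is linear in
      its direction, so the sum over the basis collapses to the single direction
      \<open>Y p\<close>.\<close>
    have "(\<Sum>b\<in>onb. (?y p \<bullet> b) *\<^sub>R ?H b v) = (\<Sum>b\<in>onb. (Y p \<bullet> b) *\<^sub>R ?H v b)"
      unfolding yp by (intro sum.cong refl arg_cong2[of _ _ _ _ scaleR] symmetric_second_derivative[OF Fs S])
    moreover have "mderiv A F p (mderiv A ?y p v) = (\<Sum>b\<in>onb. (mderiv A ?y p v \<bullet> b) *\<^sub>R ?D b p)"
      using expand[OF U(2), of "mderiv A ?y p v"] unfolding yp .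
    ultimately show ?thesis by (simp only: sum.distrib)
  qed
  also have "(\<Sum>b\<in>onb. (Y p \<bullet> b) *\<^sub>R ?H v b) = ?H v (Y p)"
    by (rule linear_onb[OF fin_dim, symmetric])
      (rule has_derivative_linear[OF smooth_on_has_derivative[OF smooth_on_frechet_derivative[OF Fs] S(2)]])
  finally show ?thesis .
qed

text \<open>The bracket acts on functions as the commutator of the two derivations. This frees it
  from the preferred chart used in its definition, and both naturality under maps and tensoriality
  of the curvature rest on it.\<close>

lemma mderiv_lie_bracket:
  fixes F :: "'a \<Rightarrow> 'f::real_inner"
  assumes F: "smooth_fn A W F" and W: "open W" "p \<in> W" and X: "smooth_vf A X" and Y: "smooth_vf A Y"
  shows "mderiv A F p (lie_bracket A X Y p) =
    mderiv A (\<lambda>q. mderiv A F q (Y q)) p (X p) - mderiv A (\<lambda>q. mderiv A F q (X q)) p (Y p)"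
proof -
  let ?c = "chart_at A p"
  have "smooth_on (snd ?c ` (W \<inter> fst ?c)) (\<lambda>x. F (chart_inv ?c x))"
    using F chart_at(1) unfolding smooth_fn_def by blast
  moreover have "snd ?c p \<in> snd ?c ` (W \<inter> fst ?c)" using W chart_at(2) by blast
  ultimately show ?thesis
    using symmetric_second_derivative[OF _ open_chart_image[OF chart_at(1) W(1)], of p _ _ "X p" "Y p"]
    by (simp add: second_mderiv[OF F W X] second_mderiv[OF F W Y] lie_bracket_def Let_def
        linear_diff[OF linear_mderiv[OF F W]])
qed

lemma lie_bracket_swap: "lie_bracket A X Y p = - lie_bracket A Y X p"
  by (simp add: lie_bracket_def Let_def)

context
  fixes X Y :: "'a \<Rightarrow> 'e" and p :: 'a
  assumes X: "smooth_vf A X" and Y: "smooth_vf A Y"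
begin

lemma smooth_dchart: "smooth_vf A Z \<Longrightarrow> smooth_fn A (fst (chart_at A p)) (\<lambda>q. mderiv A (snd (chart_at A p)) q (Z q))"
  using smooth_vf_onD[OF _ chart_at(1) open_UNIV] by simp

lemma lie_bracket_add_left:
  assumes X': "smooth_vf A X'"
  shows "lie_bracket A (\<lambda>q. X q + X' q) Y p = lie_bracket A X Y p + lie_bracket A X' Y p"
proof -
  let ?c = "chart_at A p"
  note U = open_chart[OF chart_at(1)[of p]] chart_at(2)[of p]
  let ?d = "\<lambda>Z q. mderiv A (snd ?c) q (Z q)"
  have "mderiv A (?d (\<lambda>q. X q + X' q)) p = mderiv A (\<lambda>q. ?d X q + ?d X' q) p"
    by (rule mderiv_cong[OF U _ smooth_fn_add[OF U(1) smooth_dchart[OF X] smooth_dchart[OF X']]])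
      (simp add: linear_add[OF linear_dchart[OF chart_at(1)]])
  then show ?thesis
    by (simp add: lie_bracket_def Let_def mderiv_add[OF U smooth_dchart[OF X] smooth_dchart[OF X']]
        linear_add[OF linear_mderiv[OF smooth_dchart[OF Y] U]])
qed

lemma lie_bracket_scaleR_left:
  assumes f: "smooth_fn A UNIV f"
  shows "lie_bracket A (\<lambda>q. f q *\<^sub>R X q) Y p = f p *\<^sub>R lie_bracket A X Y p - mderiv A f p (Y p) *\<^sub>R X p"
proof -
  let ?c = "chart_at A p"
  note U = open_chart[OF chart_at(1)[of p]] chart_at(2)[of p]
  let ?d = "\<lambda>Z q. mderiv A (snd ?c) q (Z q)"
  have f': "smooth_fn A (fst ?c) f" by (rule smooth_fn_subset[OF f]) simp
  have "mderiv A (?d (\<lambda>q. f q *\<^sub>R X q)) p = mderiv A (\<lambda>q. f q *\<^sub>R ?d X q) p"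
    by (rule mderiv_cong[OF U _ smooth_fn_scaleR[OF U(1) f' smooth_dchart[OF X]]])
      (simp add: linear_scale[OF linear_dchart[OF chart_at(1)]])
  then show ?thesis
    by (simp add: lie_bracket_def Let_def mderiv_scaleR[OF U f' smooth_dchart[OF X]] mderiv_chart_at
        linear_scale[OF linear_mderiv[OF smooth_dchart[OF Y] U]] algebra_simps)
qed

end

end

section \<open>Maps between manifolds\<close>

locale manifold_pair = A: manifold A + B: manifold B
  for A :: "('a::{t2_space,second_countable_topology}, 'e::real_inner) chart set"
  and B :: "('b::{t2_space,second_countable_topology}, 'f::real_inner) chart set"
begin

lemma smooth_map_onI:
  assumes "continuous_on W f"
    and "\<And>d. d \<in> B \<Longrightarrow> smooth_fn A (W \<inter> f -` fst d) (\<lambda>q. snd d (f q))"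
  shows "smooth_map_on A B W f"
  unfolding smooth_map_on_def
proof (intro conjI ballI assms(1))
  fix c d assume "c \<in> A" "d \<in> B"
  moreover have "W \<inter> fst c \<inter> f -` fst d = W \<inter> f -` fst d \<inter> fst c" by blast
  ultimately show "smooth_on (snd c ` (W \<inter> fst c \<inter> f -` fst d)) (snd d \<circ> f \<circ> chart_inv c)"
    using assms(2)[of d] by (simp add: smooth_fn_def o_def)
qed

context
  fixes W :: "'a set" and f :: "'a \<Rightarrow> 'b"
  assumes f: "smooth_map_on A B W f" and W: "open W"
begin

lemma open_vimage_map: "open V \<Longrightarrow> open (W \<inter> f -` V)"
  using f W unfolding smooth_map_on_def by (metis continuous_on_open_vimage inf_commute)

lemma smooth_fn_chart_map:
  assumes d: "d \<in> B"
  shows "smooth_fn A (W \<inter> f -` fst d) (\<lambda>q. snd d (f q))"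
  unfolding smooth_fn_def
proof
  fix c assume c: "c \<in> A"
  have "W \<inter> f -` fst d \<inter> fst c = W \<inter> fst c \<inter> f -` fst d" by blast
  then show "smooth_on (snd c ` (W \<inter> f -` fst d \<inter> fst c)) (\<lambda>x. snd d (f (chart_inv c x)))"
    using f c d unfolding smooth_map_on_def o_def by simp
qed

lemma smooth_fn_pullback:
  assumes V: "open V" "\<And>q. q \<in> W \<Longrightarrow> f q \<in> V" and G: "smooth_fn B V G"
  shows "smooth_fn A W (\<lambda>q. G (f q))"
proof (rule A.smooth_fn_local)
  fix p assume p: "p \<in> W"
  let ?d = "chart_at B (f p)"
  let ?W = "W \<inter> f -` fst ?d"
  have o: "open ?W" by (rule open_vimage_map[OF B.open_chart[OF B.chart_at(1)]])
  have "smooth_on (snd ?d ` (V \<inter> fst ?d)) (\<lambda>x. G (chart_inv ?d x))"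
    using G B.chart_at(1) unfolding smooth_fn_def by blast
  note A.smooth_fn_compose[OF B.fin_dim o B.open_chart_image[OF B.chart_at(1) V(1)] _
          smooth_fn_chart_map[OF B.chart_at(1)] this]
  then have "smooth_fn A ?W (\<lambda>q. G (chart_inv ?d (snd ?d (f q))))"
    using V(2) by blast
  then have "smooth_fn A ?W (\<lambda>q. G (f q))"
    by (rule A.smooth_fn_cong[OF o, rotated]) (simp add: B.chart_inv_chart[OF B.chart_at(1)])
  then show "\<exists>W'. open W' \<and> p \<in> W' \<and> smooth_fn A W' (\<lambda>q. G (f q))"
    using o p B.chart_at(2) by blast
qed

lemma mderiv_pullback:
  assumes p: "p \<in> W" and V: "open V" "f p \<in> V" and G: "smooth_fn B V G"
  shows "mderiv A (\<lambda>q. G (f q)) p v = mderiv B G (f p) (mdiff A B f p v)"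
proof -
  let ?d = "chart_at B (f p)" and ?c = "chart_at A p"
  let ?W = "W \<inter> f -` fst ?d"
  have o: "open ?W" by (rule open_vimage_map[OF B.open_chart[OF B.chart_at(1)]])
  have pW: "p \<in> ?W" using p B.chart_at(2) by blast
  have "((\<lambda>x. snd ?d (f (chart_inv ?c x))) has_derivative mdiff A B f p) (at (snd ?c p))"
    using A.mderiv_has_derivative[OF smooth_fn_chart_map[OF B.chart_at(1)] o pW]
    by (simp add: mdiff_def[abs_def] o_def)
  moreover have "((\<lambda>y. G (chart_inv ?d y)) has_derivative mderiv B G (f p))
      (at (snd ?d (f (chart_inv ?c (snd ?c p)))))"
    using B.mderiv_has_derivative[OF G V] by (simp add: A.chart_inv_chart A.chart_at)
  ultimately have "((\<lambda>x. G (chart_inv ?d (snd ?d (f (chart_inv ?c x))))) has_derivative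
      (\<lambda>v. mderiv B G (f p) (mdiff A B f p v))) (at (snd ?c p))"
    by (rule has_derivative_compose)
  then have "((\<lambda>x. G (f (chart_inv ?c x))) has_derivative
      (\<lambda>v. mderiv B G (f p) (mdiff A B f p v))) (at (snd ?c p))"
  proof (rule has_derivative_transform_within_open)
    show "open (snd ?c ` (?W \<inter> fst ?c))" by (rule A.open_chart_image[OF A.chart_at(1) o])
    show "snd ?c p \<in> snd ?c ` (?W \<inter> fst ?c)" using pW A.chart_at(2) by blast
  qed (auto simp: A.chart_inv_chart A.chart_at(1) B.chart_inv_chart B.chart_at(1))
  then show ?thesis by (simp add: A.mderivI)
qed

lemma linear_mdiff:
  assumes "p \<in> W" shows "linear (mdiff A B f p)"
proof -
  have "linear (mderiv A (\<lambda>q. snd (chart_at B (f p)) (f q)) p)"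
    by (rule A.linear_mderiv[OF smooth_fn_chart_map[OF B.chart_at(1)]
          open_vimage_map[OF B.open_chart[OF B.chart_at(1)]]])
      (use assms B.chart_at(2) in blast)
  then show ?thesis by (simp add: mdiff_def[abs_def] o_def)
qed

lemma dchart_mdiff:
  assumes "p \<in> W" "d \<in> B" "f p \<in> fst d"
  shows "mderiv B (snd d) (f p) (mdiff A B f p v) = mderiv A (\<lambda>q. snd d (f q)) p v"
  using mderiv_pullback[OF assms(1) B.open_chart[OF assms(2)] assms(3) B.smooth_fn_chart[OF assms(2)]]
  by simp

lemma smooth_fn_mdiff:
  assumes X: "smooth_vf_on A W X" and d: "d \<in> B"
  shows "smooth_fn A (W \<inter> f -` fst d) (\<lambda>q. mderiv B (snd d) (f q) (mdiff A B f q (X q)))"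
proof (rule A.smooth_fn_cong)
  show o: "open (W \<inter> f -` fst d)" by (rule open_vimage_map[OF B.open_chart[OF d]])
  show "smooth_fn A (W \<inter> f -` fst d) (\<lambda>q. mderiv A (\<lambda>q. snd d (f q)) q (X q))"
    by (rule A.smooth_fn_mderiv_vf[OF smooth_fn_chart_map[OF d] o A.smooth_vf_on_subset[OF X]]) blast
qed (use dchart_mdiff d in auto)

lemma mdiff_cong:
  assumes p: "p \<in> W" and "\<And>q. q \<in> W \<Longrightarrow> f q = g q"
  shows "mdiff A B g p v = mdiff A B f p v"
proof -
  let ?d = "chart_at B (f p)"
  let ?W = "W \<inter> f -` fst ?d"
  have "mderiv A (\<lambda>q. snd ?d (g q)) p = mderiv A (\<lambda>q. snd ?d (f q)) p"
  proof (rule A.mderiv_cong[of ?W])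
    show "open ?W" by (rule open_vimage_map[OF B.open_chart[OF B.chart_at(1)]])
  qed (use assms B.chart_at in \<open>auto intro: smooth_fn_chart_map\<close>)
  then show ?thesis using assms by (simp add: mdiff_def o_def)
qed

text \<open>Related fields have related brackets: apply the commutator formula to the coordinates of
  the target pulled back by \<open>f\<close>. The projection and the inclusions of the fibres are
  the two maps in question.\<close>

lemma mdiff_lie_bracket:
  assumes p: "p \<in> W"
    and X: "smooth_vf A X" "smooth_vf B X'" "\<And>q. q \<in> W \<Longrightarrow> mdiff A B f q (X q) = X' (f q)"
    and Y: "smooth_vf A Y" "smooth_vf B Y'" "\<And>q. q \<in> W \<Longrightarrow> mdiff A B f q (Y q) = Y' (f q)"
  shows "mdiff A B f p (lie_bracket A X Y p) = lie_bracket B X' Y' (f p)"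
proof -
  let ?d = "chart_at B (f p)"
  let ?W = "W \<inter> f -` fst ?d"
  let ?F = "\<lambda>q. snd ?d (f q)"
  have o: "open ?W" by (rule open_vimage_map[OF B.open_chart[OF B.chart_at(1)]])
  have pW: "p \<in> ?W" using p B.chart_at(2) by blast
  have F: "smooth_fn A ?W ?F" by (rule smooth_fn_chart_map[OF B.chart_at(1)])
  have 1: "mderiv A (\<lambda>q. mderiv A ?F q (Z q)) p v
      = mderiv B (\<lambda>r. mderiv B (snd ?d) r (Z' r)) (f p) (mdiff A B f p v)"
    if Z: "smooth_vf A Z" "smooth_vf B Z'" "\<And>q. q \<in> W \<Longrightarrow> mdiff A B f q (Z q) = Z' (f q)" for Z Z' v
  proof -
    have G: "smooth_fn B (fst ?d) (\<lambda>r. mderiv B (snd ?d) r (Z' r))"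
      using B.smooth_vf_onD[OF Z(2) B.chart_at(1) open_UNIV] by simp
    have FZ: "smooth_fn A ?W (\<lambda>q. mderiv A ?F q (Z q))"
      by (rule A.smooth_fn_mderiv_vf[OF F o A.smooth_vf_on_subset[OF Z(1)]]) blast
    have "mderiv A (\<lambda>q. mderiv B (snd ?d) (f q) (Z' (f q))) p = mderiv A (\<lambda>q. mderiv A ?F q (Z q)) p"
    proof (rule A.mderiv_cong[OF o pW _ FZ])
      fix q assume "q \<in> ?W"
      then show "mderiv A ?F q (Z q) = mderiv B (snd ?d) (f q) (Z' (f q))"
        using dchart_mdiff[OF _ B.chart_at(1), of q "f p" "Z q"] Z(3)[of q] by simp
    qed
    then show ?thesis
      using mderiv_pullback[OF p B.open_chart[OF B.chart_at(1)] B.chart_at(2) G] by simp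
  qed
  have "mdiff A B f p (lie_bracket A X Y p) = mderiv A ?F p (lie_bracket A X Y p)"
    by (simp add: mdiff_def o_def)
  also have "\<dots> = mderiv A (\<lambda>q. mderiv A ?F q (Y q)) p (X p) - mderiv A (\<lambda>q. mderiv A ?F q (X q)) p (Y p)"
    by (rule A.mderiv_lie_bracket[OF F o pW X(1) Y(1)])
  finally show ?thesis
    by (simp add: 1[OF X] 1[OF Y] X(3)[OF p] Y(3)[OF p] lie_bracket_def Let_def)
qed

end

end

lemma (in manifold) mdiff_id: "mdiff A A (\<lambda>q. q) p v = v"
  using mderiv_chart_at by (simp add: mdiff_def o_def)

lemma mdiff_compose:
  assumes "manifold A" "manifold B" "manifold C"
    and f: "smooth_map_on A B W f" "open W" "p \<in> W"
    and g: "smooth_map_on B C V g" "open V" "f p \<in> V"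
  shows "mdiff A C (\<lambda>q. g (f q)) p v = mdiff B C g (f p) (mdiff A B f p v)"
proof -
  interpret AB: manifold_pair A B using assms by (simp add: manifold_pair_def)
  interpret BC: manifold_pair B C using assms by (simp add: manifold_pair_def)
  let ?e = "chart_at C (g (f p))"
  note e = BC.B.chart_at[of "g (f p)"]
  have "mderiv A (\<lambda>q. snd ?e (g (f q))) p v = mderiv B (\<lambda>r. snd ?e (g r)) (f p) (mdiff A B f p v)"
    by (rule AB.mderiv_pullback[OF f BC.open_vimage_map[OF g(1,2) BC.B.open_chart[OF e(1)]] _
          BC.smooth_fn_chart_map[OF g(1,2) e(1)]]) (use g e in auto)
  then show ?thesis by (simp add: mdiff_def o_def)
qed

section \<open>Connections\<close>

lemma matrix_vector_linear:
  fixes L :: "real^'n \<Rightarrow> real^'n"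
  assumes "linear L"
  shows "matrix L *v u = L u"
  using assms by (simp add: matrix_works)

text \<open>The right-hand side of Koszul's formula, for an arbitrary family \<open>b\<close> so
  that the degenerate vertical and horizontal parts of a metric can be inserted as well.\<close>

definition koszul :: "('a, 'e::real_normed_vector) chart set \<Rightarrow> ('a \<Rightarrow> 'e \<Rightarrow> 'e \<Rightarrow> real) \<Rightarrow>
    ('a \<Rightarrow> 'e) \<Rightarrow> ('a \<Rightarrow> 'e) \<Rightarrow> ('a \<Rightarrow> 'e) \<Rightarrow> 'a \<Rightarrow> real" where
  "koszul A b X Y Z p =
     mderiv A (\<lambda>q. b q (Y q) (Z q)) p (X p) + mderiv A (\<lambda>q. b q (X q) (Z q)) p (Y p)
     - mderiv A (\<lambda>q. b q (X q) (Y q)) p (Z p)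
     + b p (lie_bracket A X Y p) (Z p) - b p (lie_bracket A X Z p) (Y p)
     - b p (lie_bracket A Y Z p) (X p)"

text \<open>Vanishing torsion is assumed only after pairing with \<open>b\<close>. For a degenerate
  \<open>b\<close> the torsion may thus take values in the kernel, as happens for the direct sum
  connection.\<close>

lemma koszul_formula:
  assumes sym: "\<And>u w. b p u w = b p w u"
    and tors: "\<And>X Y w. smooth_vf A X \<Longrightarrow> smooth_vf A Y \<Longrightarrow>
      b p (D Y p (X p)) w - b p (D X p (Y p)) w = b p (lie_bracket A X Y p) w"
    and metric: "\<And>X Y Z. smooth_vf A X \<Longrightarrow> smooth_vf A Y \<Longrightarrow> smooth_vf A Z \<Longrightarrow>
      mderiv A (\<lambda>q. b q (Y q) (Z q)) p (X p) = b p (D Y p (X p)) (Z p) + b p (Y p) (D Z p (X p))"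
    and X: "smooth_vf A X" and Y: "smooth_vf A Y" and Z: "smooth_vf A Z"
  shows "2 * b p (D Y p (X p)) (Z p) = koszul A b X Y Z p"
  unfolding koszul_def metric[OF X Y Z] metric[OF Y X Z] metric[OF Z X Y]
    tors[OF X Y, symmetric] tors[OF X Z, symmetric] tors[OF Y Z, symmetric]
  by (simp add: sym[of "X p"] sym[of "Y p"])

lemma levi_civita_koszul:
  assumes g: "inner_product_on UNIV (g p)" and D: "levi_civita A g D"
    and XYZ: "smooth_vf A X" "smooth_vf A Y" "smooth_vf A Z"
  shows "2 * g p (D Y p (X p)) (Z p) = koszul A g X Y Z p"
proof (rule koszul_formula[OF _ _ _ XYZ])
  show "g p u w = g p w u" for u w using g by (simp add: inner_product_on_def)
  have "g p (u - v) w = g p u w - g p v w" for u v w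
  proof -
    have "g p (u - v + v) w = g p (u - v) w + g p v w"
      using g unfolding inner_product_on_def by blast
    then show ?thesis by simp
  qed
  then show "g p (D Y p (X p)) w - g p (D X p (Y p)) w = g p (lie_bracket A X Y p) w"
    if "smooth_vf A X" "smooth_vf A Y" for X Y w
    using D that unfolding levi_civita_def by metis
  show "mderiv A (\<lambda>q. g q (Y q) (Z q)) p (X p) = g p (D Y p (X p)) (Z p) + g p (Y p) (D Z p (X p))"
    if "smooth_vf A X" "smooth_vf A Y" "smooth_vf A Z" for X Y Z
    using D that unfolding levi_civita_def by blast
qed

lemma
  assumes "connection_on A S D" "section_of A S Y"
  shows connection_on_linear: "linear (D Y p)"
    and connection_on_in: "D Y p v \<in> S p"
    and connection_on_smooth: "smooth_vf A X \<Longrightarrow> smooth_vf A (\<lambda>p. D Y p (X p))"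
    and connection_on_add: "section_of A S Z \<Longrightarrow> D (\<lambda>q. Y q + Z q) p v = D Y p v + D Z p v"
    and connection_on_scaleR: "smooth_fn A UNIV f \<Longrightarrow>
      D (\<lambda>q. f q *\<^sub>R Y q) p v = mderiv A f p v *\<^sub>R Y p + f p *\<^sub>R D Y p v"
  using assms unfolding connection_on_def smooth_fun_iff[symmetric] by blast+

lemma section_of_UNIV: "section_of A (\<lambda>_. UNIV) Y \<longleftrightarrow> smooth_vf A Y"
  by (simp add: section_of_def)

lemmas connection_linear = connection_on_linear[where S = "\<lambda>_. UNIV", unfolded section_of_UNIV]
  and connection_smooth = connection_on_smooth[where S = "\<lambda>_. UNIV", unfolded section_of_UNIV]
  and connection_add = connection_on_add[where S = "\<lambda>_. UNIV", unfolded section_of_UNIV]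
  and connection_scaleR = connection_on_scaleR[where S = "\<lambda>_. UNIV", unfolded section_of_UNIV]

lemma connectionI:
  assumes "\<And>Y p. smooth_vf A Y \<Longrightarrow> linear (D Y p)"
    and "\<And>X Y. smooth_vf A X \<Longrightarrow> smooth_vf A Y \<Longrightarrow> smooth_vf A (\<lambda>p. D Y p (X p))"
    and "\<And>Y Z p v. smooth_vf A Y \<Longrightarrow> smooth_vf A Z \<Longrightarrow> D (\<lambda>q. Y q + Z q) p v = D Y p v + D Z p v"
    and "\<And>f Y p v. smooth_fn A UNIV f \<Longrightarrow> smooth_vf A Y \<Longrightarrow>
      D (\<lambda>q. f q *\<^sub>R Y q) p v = mderiv A f p v *\<^sub>R Y p + f p *\<^sub>R D Y p v"
  shows "connection A D"
  unfolding connection_on_def section_of_UNIV smooth_fun_iff using assms by simp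

section \<open>The difference of two connections and the curvature as tensors\<close>

context manifold
begin

lemma connection_diff_tensorial:
  assumes D0: "connection A D0" and D1: "connection A D1"
  shows "\<exists>L. linear L \<and> (\<forall>Y. smooth_vf A Y \<longrightarrow> D1 Y p v - D0 Y p v = L (Y p))"
  by (rule tensorial)
    (simp_all add: connection_add[OF D0] connection_add[OF D1] connection_scaleR[OF D0]
      connection_scaleR[OF D1] scaleR_diff_right)

context
  fixes D assumes D: "connection A D"
begin

text \<open>The curvature as an operator on fields, from which the matrix \<open>curvature\<close>
  is obtained once the dependence on values at \<open>p\<close> is known.\<close>

definition curv :: "('a \<Rightarrow> 'e) \<Rightarrow> ('a \<Rightarrow> 'e) \<Rightarrow> ('a \<Rightarrow> 'e) \<Rightarrow> 'a \<Rightarrow> 'e" where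
  "curv X Y Z p = D (\<lambda>q. D Z q (Y q)) p (X p) - D (\<lambda>q. D Z q (X q)) p (Y p)
     - D Z p (lie_bracket A X Y p)"

lemma curv_swap: "smooth_vf A Z \<Longrightarrow> curv X Y Z p = - curv Y X Z p"
  unfolding curv_def lie_bracket_swap[of X Y]
  by (simp add: linear_neg[OF connection_linear[OF D]])

text \<open>The \<open>THE\<close> in \<open>curvature\<close> ranges over all extensions of two
  tangent vectors, so independence of the extension is part of its existence. The derivative of
  \<open>f\<close> from the Leibniz rule cancels against the one from the bracket
  \<open>[f X, Y]\<close>.\<close>

lemma curv_cong_left:
  assumes "smooth_vf A X" "smooth_vf A X'" "X p = X' p" and Y: "smooth_vf A Y" and Z: "smooth_vf A Z"
  shows "curv X Y Z p = curv X' Y Z p"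
proof -
  note lin = connection_linear[OF D Z] and sm = connection_smooth[OF D Z]
  have "\<exists>L. linear L \<and> (\<forall>X. smooth_vf A X \<longrightarrow> curv X Y Z p = L (X p))"
  proof (rule tensorial)
    fix X X' assume X: "smooth_vf A X" "smooth_vf A X'"
    have "D (\<lambda>q. D Z q (X q + X' q)) p (Y p)
        = D (\<lambda>q. D Z q (X q)) p (Y p) + D (\<lambda>q. D Z q (X' q)) p (Y p)"
      using connection_add[OF D sm sm, OF X] by (simp add: linear_add[OF lin])
    then show "curv (\<lambda>q. X q + X' q) Y Z p = curv X Y Z p + curv X' Y Z p"
      by (simp add: curv_def lie_bracket_add_left X Y linear_add[OF lin]
          linear_add[OF connection_linear[OF D sm[OF Y]]])
  next
    fix f :: "'a \<Rightarrow> real" and X assume f: "smooth_fn A UNIV f" and X: "smooth_vf A X"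
    have "D (\<lambda>q. D Z q (f q *\<^sub>R X q)) p (Y p)
        = mderiv A f p (Y p) *\<^sub>R D Z p (X p) + f p *\<^sub>R D (\<lambda>q. D Z q (X q)) p (Y p)"
      using connection_scaleR[OF D sm f, OF X] by (simp add: linear_scale[OF lin])
    then show "curv (\<lambda>q. f q *\<^sub>R X q) Y Z p = f p *\<^sub>R curv X Y Z p"
      by (simp add: curv_def lie_bracket_scaleR_left X Y f linear_diff[OF lin] linear_scale[OF lin]
          linear_scale[OF connection_linear[OF D sm[OF Y]]] algebra_simps)
  qed
  then show ?thesis using assms by metis
qed

lemma curv_cong:
  assumes X: "smooth_vf A X" "smooth_vf A X'" "X p = X' p"
    and Y: "smooth_vf A Y" "smooth_vf A Y'" "Y p = Y' p" and Z: "smooth_vf A Z"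
  shows "curv X Y Z p = curv X' Y' Z p"
  using curv_cong_left[OF X Y(1) Z] curv_cong_left[OF Y X(2) Z]
    curv_swap[OF Z, of X' Y p] curv_swap[OF Z, of X' Y' p] by simp

text \<open>The first derivatives of \<open>f\<close> cancel in pairs; the second ones combine to
  the commutator of \<open>X\<close> and \<open>Y\<close> on \<open>f\<close> minus the derivative
  along their bracket, which is zero.\<close>

lemma curv_tensorial:
  assumes X: "smooth_vf A X" and Y: "smooth_vf A Y"
  shows "\<exists>L. linear L \<and> (\<forall>Z. smooth_vf A Z \<longrightarrow> curv X Y Z p = L (Z p))"
proof (rule tensorial)
  fix Z Z' assume Z: "smooth_vf A Z" "smooth_vf A Z'"
  have "D (\<lambda>q. D (\<lambda>q. Z q + Z' q) q (X q)) p v = D (\<lambda>q. D Z q (X q)) p v + D (\<lambda>q. D Z' q (X q)) p v"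
    if X: "smooth_vf A X" for X v
    using connection_add[OF D connection_smooth[OF D _ X] connection_smooth[OF D _ X], OF Z]
    by (simp add: connection_add[OF D Z])
  then show "curv X Y (\<lambda>q. Z q + Z' q) p = curv X Y Z p + curv X Y Z' p"
    by (simp add: curv_def connection_add[OF D Z] X Y)
next
  fix f :: "'a \<Rightarrow> real" and Z assume f: "smooth_fn A UNIV f" and Z: "smooth_vf A Z"
  have df: "smooth_fn A UNIV (\<lambda>q. mderiv A f q (X q))" if "smooth_vf A X" for X
    by (rule smooth_fn_mderiv_vf[OF f open_UNIV that])
  have "D (\<lambda>q. D (\<lambda>q. f q *\<^sub>R Z q) q (X q)) p v
      = mderiv A (\<lambda>q. mderiv A f q (X q)) p v *\<^sub>R Z p + mderiv A f p (X p) *\<^sub>R D Z p v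
        + (mderiv A f p v *\<^sub>R D Z p (X p) + f p *\<^sub>R D (\<lambda>q. D Z q (X q)) p v)"
    if X: "smooth_vf A X" for X v
  proof -
    note DZ = connection_smooth[OF D Z X]
    have "D (\<lambda>q. D (\<lambda>q. f q *\<^sub>R Z q) q (X q)) p v
        = D (\<lambda>q. mderiv A f q (X q) *\<^sub>R Z q + f q *\<^sub>R D Z q (X q)) p v"
      by (simp add: connection_scaleR[OF D Z f])
    also have "\<dots> = D (\<lambda>q. mderiv A f q (X q) *\<^sub>R Z q) p v + D (\<lambda>q. f q *\<^sub>R D Z q (X q)) p v"
      by (rule connection_add[OF D]) (intro smooth_vf_on_scaleR open_UNIV df X Z f DZ)+
    finally show ?thesis
      by (simp add: connection_scaleR[OF D Z df[OF X]] connection_scaleR[OF D DZ f])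
  qed
  then show "curv X Y (\<lambda>q. f q *\<^sub>R Z q) p = f p *\<^sub>R curv X Y Z p"
    by (simp add: curv_def connection_scaleR[OF D Z f] X Y mderiv_lie_bracket[OF f open_UNIV UNIV_I X Y]
        scaleR_diff_left algebra_simps)
qed

end

end

context
  fixes A :: "('a::{t2_space,second_countable_topology}, real^'n) chart set"
  assumes A: "manifold A"
begin

interpretation manifold A by (rule A)

text \<open>Supplies the uniqueness half of \<open>THE\<close> in \<open>conn_diff\<close> and
  \<open>curvature\<close>: every vector at \<open>p\<close> is the value of a global field.\<close>

lemma matrix_through:
  assumes "\<And>Y. smooth_vf A Y \<Longrightarrow> S *v Y p = S' *v Y p"
  shows "S = S'"
  unfolding matrix_eq using assms vf_through[of p] by metis

lemma conn_diff_unique: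
  assumes "\<And>Y. smooth_vf A Y \<Longrightarrow> S *v Y p = D1 Y p v - D0 Y p v"
  shows "conn_diff A D0 D1 p v = S"
  unfolding conn_diff_def using assms by (intro the_equality) (auto intro!: matrix_through[of _ p])

lemma conn_diff_mult:
  assumes "connection A D0" "connection A D1" and Y: "smooth_vf A Y"
  shows "conn_diff A D0 D1 p v *v Y p = D1 Y p v - D0 Y p v"
proof -
  obtain L where L: "linear L" "\<And>Y. smooth_vf A Y \<Longrightarrow> D1 Y p v - D0 Y p v = L (Y p)"
    using connection_diff_tensorial[OF assms(1,2)] by blast
  have "conn_diff A D0 D1 p v = matrix L"
    by (rule conn_diff_unique) (simp add: L matrix_vector_linear)
  then show ?thesis by (simp add: L Y matrix_vector_linear)
qed

lemma curvature_mult: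
  assumes D: "connection A D" and XYZ: "smooth_vf A X" "smooth_vf A Y" "smooth_vf A Z"
  shows "curvature A D p (X p) (Y p) *v Z p =
    D (\<lambda>q. D Z q (Y q)) p (X p) - D (\<lambda>q. D Z q (X q)) p (Y p) - D Z p (lie_bracket A X Y p)"
proof -
  obtain L where L: "linear L" "\<And>Z. smooth_vf A Z \<Longrightarrow> curv D X Y Z p = L (Z p)"
    using curv_tensorial[OF D XYZ(1,2)] by blast
  have *: "matrix L *v Z p = curv D X' Y' Z p"
    if "smooth_vf A X'" "smooth_vf A Y'" "smooth_vf A Z" "X' p = X p" "Y' p = Y p" for X' Y' Z
    using curv_cong[OF D XYZ(1) that(1) that(4)[symmetric] XYZ(2) that(2) that(5)[symmetric] that(3)] L that
    by (simp add: matrix_vector_linear)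
  have "curvature A D p (X p) (Y p) = matrix L"
    unfolding curvature_def
  proof (rule the_equality)
    show "\<forall>X' Y' Z. smooth_vf A X' \<and> smooth_vf A Y' \<and> smooth_vf A Z \<and> X' p = X p \<and> Y' p = Y p \<longrightarrow>
      matrix L *v Z p = D (\<lambda>q. D Z q (Y' q)) p (X' p) - D (\<lambda>q. D Z q (X' q)) p (Y' p)
        - D Z p (lie_bracket A X' Y' p)"
      using * unfolding curv_def[OF D] by blast
    fix R assume R: "\<forall>X' Y' Z. smooth_vf A X' \<and> smooth_vf A Y' \<and> smooth_vf A Z \<and> X' p = X p \<and> Y' p = Y p \<longrightarrow>
      R *v Z p = D (\<lambda>q. D Z q (Y' q)) p (X' p) - D (\<lambda>q. D Z q (X' q)) p (Y' p)
        - D Z p (lie_bracket A X' Y' p)"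
    show "R = matrix L"
    proof (rule matrix_through[of _ p])
      fix Z assume Z: "smooth_vf A Z"
      show "R *v Z p = matrix L *v Z p"
        using R[rule_format, of X Y Z] *[OF XYZ(1,2) Z] XYZ(1,2) Z by (simp add: curv_def[OF D])
    qed
  qed
  then show ?thesis using *[OF XYZ] by (simp add: curv_def[OF D])
qed

end

section \<open>Complementary sub-bundles\<close>

lemma complementary_ex1:
  assumes VH: "complementary V H" and V: "subspace (V p)" and H: "subspace (H p)"
  shows "\<exists>!v. v \<in> V p \<and> u - v \<in> H p"
proof -
  have VH': "V p \<inter> H p = {0}" "\<forall>u. \<exists>v\<in>V p. \<exists>h\<in>H p. u = v + h"
    using VH by (simp_all add: complementary_def)
  obtain v h where vh: "v \<in> V p" "h \<in> H p" "u = v + h" using VH'(2)[rule_format, of u] by auto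
  show ?thesis
  proof (rule ex1I[of _ v])
    show "v \<in> V p \<and> u - v \<in> H p" using vh by simp
    fix w assume w: "w \<in> V p \<and> u - w \<in> H p"
    then have "w - v \<in> V p" using vh subspace_diff[OF V] by blast
    moreover have "(u - v) - (u - w) \<in> H p"
      by (rule subspace_diff[OF H]) (use vh w in simp_all)
    then have "w - v \<in> H p" by simp
    ultimately have "w - v = 0" using VH'(1) by blast
    then show "w = v" by simp
  qed
qed

context
  fixes V H :: "'a \<Rightarrow> 'e::real_vector set" and p :: 'a
  assumes VH: "complementary V H" and V: "subspace (V p)" and H: "subspace (H p)"
begin

lemma proj_along: "proj_along V H p u \<in> V p" "u - proj_along V H p u \<in> H p"
  unfolding proj_along_def using theI'[OF complementary_ex1[OF VH V H]] by blast+

lemma proj_along_unique: "v \<in> V p \<Longrightarrow> u - v \<in> H p \<Longrightarrow> proj_along V H p u = v"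
  using complementary_ex1[OF VH V H, of u] proj_along by blast

lemma proj_along_V: "v \<in> V p \<Longrightarrow> proj_along V H p v = v"
  by (rule proj_along_unique) (simp_all add: subspace_0[OF H])

lemma proj_along_H: "h \<in> H p \<Longrightarrow> proj_along V H p h = 0"
  by (rule proj_along_unique) (simp_all add: subspace_0[OF V])

lemma linear_proj_along: "linear (proj_along V H p)"
proof (rule linearI)
  show "proj_along V H p (u + w) = proj_along V H p u + proj_along V H p w" for u w
  proof (rule proj_along_unique)
    show "proj_along V H p u + proj_along V H p w \<in> V p"
      by (intro subspace_add V proj_along)
    have "(u - proj_along V H p u) + (w - proj_along V H p w) \<in> H p"
      by (intro subspace_add H proj_along)
    then show "u + w - (proj_along V H p u + proj_along V H p w) \<in> H p"
      by (simp add: algebra_simps)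
  qed
  show "proj_along V H p (a *\<^sub>R u) = a *\<^sub>R proj_along V H p u" for a u
  proof (rule proj_along_unique)
    show "a *\<^sub>R proj_along V H p u \<in> V p" by (intro subspace_scale V proj_along)
    have "a *\<^sub>R (u - proj_along V H p u) \<in> H p" by (intro subspace_scale H proj_along)
    then show "a *\<^sub>R u - a *\<^sub>R proj_along V H p u \<in> H p" by (simp add: algebra_simps)
  qed
qed

end

section \<open>Invariant polynomials on block triangular matrices\<close>

lemma matrix_inv_eqI:
  fixes G G' :: "real^'n^'n"
  assumes "G ** G' = mat 1" "G' ** G = mat 1"
  shows "invertible G" "matrix_inv G = G'"
proof -
  show inv: "invertible G" using assms by (auto simp: invertible_def)
  have "G ** matrix_inv G = mat 1 \<and> matrix_inv G ** G = mat 1"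
    unfolding matrix_inv_def by (rule someI_ex) (use assms in blast)
  then have left: "matrix_inv G ** G = mat 1" ..
  have "matrix_inv G = matrix_inv G ** (G ** G')" by (simp add: assms)
  also have "\<dots> = G'" by (simp add: matrix_mul_assoc left)
  finally show "matrix_inv G = G'" .
qed

text \<open>Multilinearity is given slot by slot, so the factors are pulled out one at a time;
  \<open>k\<close> counts the slots already treated.\<close>

lemma invariant_polynomial_scaleR:
  assumes P: "invariant_polynomial l P" and "k \<le> l"
  shows "P (\<lambda>i. if i < k then c i *\<^sub>R M i else M i) = (\<Prod>i<k. c i) * P M"
  using assms(2)
proof (induction k)
  case 0
  then show ?case by simp
next
  case (Suc k)
  let ?M = "\<lambda>i. if i < k then c i *\<^sub>R M i else M i"
  have "linear (\<lambda>S. P (?M(k := S)))"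
    using P Suc.prems unfolding invariant_polynomial_def by auto
  from linear_scale[OF this, of "c k" "M k"]
  have "P (?M(k := c k *\<^sub>R M k)) = c k * P (?M(k := M k))" by simp
  moreover have "?M(k := c k *\<^sub>R M k) = (\<lambda>i. if i < Suc k then c i *\<^sub>R M i else M i)" "?M(k := M k) = ?M"
    by (auto simp: fun_eq_iff less_Suc_eq)
  ultimately show ?case using Suc by simp
qed

context
  fixes V H :: "(real^'n) set"
  assumes VH: "complementary (\<lambda>_::unit. V) (\<lambda>_. H)" and V: "subspace V" and H: "subspace H"
begin

text \<open>Only one tangent space matters here, so the family of subspaces expected by
  \<open>proj_along\<close> is indexed by \<open>unit\<close>.\<close>

abbreviation (input) "Q \<equiv> proj_along (\<lambda>_. V) (\<lambda>_. H) ()"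

lemma projector: "Q u \<in> V" "v \<in> V \<Longrightarrow> Q v = v" "linear Q"
  using proj_along[OF VH V H] proj_along_V[OF VH V H] linear_proj_along[OF VH V H] by auto

definition diagonal :: "real^'n^'n \<Rightarrow> bool" where
  "diagonal M \<longleftrightarrow> (\<forall>u. M *v Q u = Q (M *v u))"

text \<open>Relative to \<open>V \<oplus> H\<close> the only block is the one from \<open>H\<close>
  to \<open>V\<close>. The opposite block never occurs, as all matrices considered preserve
  \<open>V\<close>.\<close>

definition off_diagonal :: "real^'n^'n \<Rightarrow> bool" where
  "off_diagonal M \<longleftrightarrow> (\<forall>u. M *v Q u = 0 \<and> Q (M *v u) = M *v u)"

text \<open>Conjugation by \<open>stretch\<close>, which doubles the vectors of \<open>V\<close> and fixes those of \<open>H\<close>, fixes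
  diagonal matrices and doubles off-diagonal ones.\<close>

definition stretch :: "real^'n^'n" where "stretch = matrix (\<lambda>u. u + Q u)"
definition shrink :: "real^'n^'n" where "shrink = matrix (\<lambda>u. u - (1/2) *\<^sub>R Q u)"

lemma stretch_shrink: "stretch *v u = u + Q u" "shrink *v u = u - (1/2) *\<^sub>R Q u"
proof -
  have "linear (\<lambda>u. u + Q u)" "linear (\<lambda>u. u - (1/2) *\<^sub>R Q u)"
    by (intro linear_compose_add linear_compose_sub linear_compose_scale_right linear_ident projector(3))+
  then show "stretch *v u = u + Q u" "shrink *v u = u - (1/2) *\<^sub>R Q u"
    by (simp_all add: stretch_def shrink_def matrix_vector_linear)
qed

lemma inv_stretch: "invertible stretch" "matrix_inv stretch = shrink"
proof -
  have QQ: "Q (Q u) = Q u" for u by (simp add: projector)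
  have h: "(1/2) *\<^sub>R x + (1/2) *\<^sub>R x = x" for x :: "real^'n"
    by (simp flip: scaleR_add_left)
  have "stretch ** shrink = mat 1"
    unfolding matrix_eq matrix_vector_mul_assoc[symmetric] stretch_shrink
    using h by (simp add: linear_diff[OF projector(3)] linear_scale[OF projector(3)] QQ algebra_simps)
  moreover have "shrink ** stretch = mat 1"
    unfolding matrix_eq matrix_vector_mul_assoc[symmetric] stretch_shrink
    using h by (simp add: linear_add[OF projector(3)] linear_scale[OF projector(3)] QQ algebra_simps)
  ultimately show "invertible stretch" "matrix_inv stretch = shrink" by (rule matrix_inv_eqI)+
qed

lemma stretch_diagonal:
  assumes "diagonal M" shows "stretch ** M ** shrink = M"
proof -
  have QQ: "Q (Q u) = Q u" for u by (simp add: projector)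
  have h: "(1/2) *\<^sub>R x + (1/2) *\<^sub>R x = x" for x :: "real^'n"
    by (simp flip: scaleR_add_left)
  show ?thesis
    unfolding matrix_eq matrix_vector_mul_assoc[symmetric] stretch_shrink matrix_vector_mult_diff_distrib
      matrix_vector_mult_scaleR
    using assms h by (simp add: diagonal_def linear_diff[OF projector(3)] linear_scale[OF projector(3)] QQ algebra_simps)
qed

lemma stretch_off_diagonal:
  assumes "off_diagonal M" shows "stretch ** M ** shrink = 2 *\<^sub>R M"
proof -
  have "(2 *\<^sub>R M) *v u = M *v u + M *v u" for u
    by (simp only: scaleR_2 matrix_vector_mult_add_rdistrib)
  then show ?thesis
    unfolding matrix_eq matrix_vector_mul_assoc[symmetric] stretch_shrink matrix_vector_mult_diff_distrib
      matrix_vector_mult_scaleR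
    using assms by (simp add: off_diagonal_def linear_0[OF projector(3)])
qed

text \<open>Conjugation by \<open>stretch\<close> leaves \<open>P M\<close> unchanged by invariance,
  yet it multiplies it by 2 for each off-diagonal slot, and slot 0 is one of these. So
  \<open>P M\<close> equals itself times a factor of at least 2.\<close>

lemma invariant_polynomial_homogeneous:
  assumes P: "invariant_polynomial l P" and l: "l \<ge> 1" and "off_diagonal (M 0)"
    and M: "\<And>i. i < l \<Longrightarrow> diagonal (M i) \<or> off_diagonal (M i)"
  shows "P M = 0"
proof -
  \<comment> \<open>The zero matrix is the only one that is both diagonal and off-diagonal; it
    counts as off-diagonal, which is harmless.\<close>
  define c where "c i = (if off_diagonal (M i) then 2 else 1 :: real)" for i
  have "P M = P (\<lambda>i. stretch ** M i ** matrix_inv stretch)"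
    using P inv_stretch(1) unfolding invariant_polynomial_def by simp
  also have "\<dots> = P (\<lambda>i. if i < l then c i *\<^sub>R M i else M i)"
  proof -
    have "stretch ** M i ** matrix_inv stretch = (if i < l then c i *\<^sub>R M i else M i)" if "i < l" for i
      using that M[OF that] stretch_diagonal stretch_off_diagonal by (auto simp: inv_stretch c_def)
    then show ?thesis
      by (intro P[unfolded invariant_polynomial_def, THEN conjunct1, rule_format])
  qed
  also have "\<dots> = (\<Prod>i<l. c i) * P M" by (rule invariant_polynomial_scaleR[OF P order_refl])
  finally have "((\<Prod>i<l. c i) - 1) * P M = 0" by (simp add: algebra_simps)
  moreover have "(\<Prod>i<l. c i) \<ge> 2"
  proof -
    have "(\<Prod>i<l. c i) = c 0 * (\<Prod>i\<in>{..<l} - {0}. c i)"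
      using l by (intro prod.remove) auto
    moreover have "(\<Prod>i\<in>{..<l} - {0}. c i) \<ge> 1" by (rule prod_ge_1) (simp add: c_def)
    ultimately show ?thesis using assms(3) by (simp add: c_def)
  qed
  ultimately show ?thesis by simp
qed

text \<open>Split the triangular matrices one at a time into their diagonal and off-diagonal parts.\<close>

lemma invariant_polynomial_triangular:
  assumes P: "invariant_polynomial l P" and l: "l \<ge> 1" and M0: "off_diagonal (M 0)"
    and M: "\<And>i v. i < l \<Longrightarrow> v \<in> V \<Longrightarrow> M i *v v \<in> V"
  shows "P M = 0"
proof -
  \<comment> \<open>Generalised for induction: the slots from \<open>k\<close> on are already
    homogeneous, those below \<open>k\<close> are merely triangular, and slot 0 is off-diagonal
    throughout. The claim is the case \<open>k = l\<close>.\<close>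
  have "P M = 0" if "k \<le> l" "off_diagonal (M 0)"
    "\<And>i v. 1 \<le> i \<Longrightarrow> i < k \<Longrightarrow> v \<in> V \<Longrightarrow> M i *v v \<in> V"
    "\<And>i. k \<le> i \<Longrightarrow> i < l \<Longrightarrow> diagonal (M i) \<or> off_diagonal (M i)" for k M
    using that
  proof (induction k arbitrary: M)
    case 0
    then show ?case using invariant_polynomial_homogeneous[OF P l] by simp
  next
    case (Suc k)
    show ?case
    proof (cases "k = 0")
      case True
      then have "diagonal (M i) \<or> off_diagonal (M i)" if "i < l" for i
        using that Suc.prems(2,4) by (cases i) auto
      then show ?thesis by (rule invariant_polynomial_homogeneous[where M = M, OF P l Suc.prems(2)])
    next
      case False
      let ?R = "M k"
      have RV: "Q (?R *v Q u) = ?R *v Q u" for u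
        using Suc.prems(3)[of k] False by (simp add: projector)
      \<comment> \<open>\<open>R0\<close> is \<open>Q R Q + (1 - Q) R (1 - Q)\<close> and
        \<open>R1\<close> is \<open>Q R (1 - Q)\<close>. The missing block
        \<open>(1 - Q) R Q\<close> is zero because \<open>R\<close> preserves \<open>V\<close>,
        which also allows the first \<open>Q\<close> of \<open>R0\<close> to be dropped.\<close>
      define R0 where "R0 = matrix (\<lambda>u. ?R *v Q u + ((?R *v (u - Q u)) - Q (?R *v (u - Q u))))"
      define R1 where "R1 = matrix (\<lambda>u. Q (?R *v (u - Q u)))"
      have lR: "linear (\<lambda>u. ?R *v Q u)" "linear (\<lambda>u. ?R *v (u - Q u))"
        using linear_compose[OF projector(3) matrix_vector_mul_linear[of ?R]]
          linear_compose[OF linear_compose_sub[OF linear_ident projector(3)] matrix_vector_mul_linear[of ?R]]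
        by (simp_all add: o_def)
      have lQ: "linear (\<lambda>u. Q (?R *v (u - Q u)))"
        using linear_compose[OF lR(2) projector(3)] by (simp add: o_def)
      have R0: "R0 *v u = ?R *v Q u + ((?R *v (u - Q u)) - Q (?R *v (u - Q u)))" for u
        unfolding R0_def by (intro matrix_vector_linear linear_compose_add linear_compose_sub lR lQ)
      have R1: "R1 *v u = Q (?R *v (u - Q u))" for u
        unfolding R1_def by (intro matrix_vector_linear lQ)
      have QQ: "Q (Q u) = Q u" for u by (simp add: projector)
      have sum: "?R = R0 + R1"
        unfolding matrix_eq matrix_vector_mult_add_rdistrib R0 R1
        by (simp add: matrix_vector_mult_diff_distrib)
      have "diagonal R0" unfolding diagonal_def R0
        by (simp add: linear_add[OF projector(3)] linear_diff[OF projector(3)] linear_0[OF projector(3)] QQ RV)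
      moreover have "off_diagonal R1" unfolding off_diagonal_def R1
        by (simp add: QQ linear_0[OF projector(3)])
      moreover have "P (M(k := S)) = 0" if S: "diagonal S \<or> off_diagonal S" for S
      proof (rule Suc.IH)
        show "diagonal ((M(k := S)) i) \<or> off_diagonal ((M(k := S)) i)" if "k \<le> i" "i < l" for i
          using Suc.prems(4)[of i] that S by (cases "i = k") auto
      qed (use Suc.prems False in auto)
      ultimately have 0: "P (M(k := R0)) = 0" "P (M(k := R1)) = 0" by blast+
      have "linear (\<lambda>S. P (M(k := S)))"
        using P Suc.prems(1) unfolding invariant_polynomial_def by auto
      from linear_add[OF this, of R0 R1] have "P (M(k := ?R)) = 0" using 0 sum by simp
      then show ?thesis by simp
    qed
  qed
  from this[of l M] show ?thesis using assms by auto
qed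

end

section \<open>A criterion for Chern-Simons equivalence\<close>

lemma smooth_form_zero: "smooth_form A k (\<lambda>_ _. 0)"
  by (simp add: smooth_form_def smooth_fun_def o_def smooth_on_const linear_iff)

context
  fixes A :: "('a::{t2_space,second_countable_topology}, real^'n) chart set" and D0 D1
  assumes A: "manifold A" and D0: "connection A D0" and D1: "connection A D1"
begin

interpretation manifold A by (rule A)

definition segment :: "real \<Rightarrow> ('a, real^'n) cov_deriv" where
  "segment t Y p v = (1 - t) *\<^sub>R D0 Y p v + t *\<^sub>R D1 Y p v"

lemma segment_connection: "connection A (segment t)"
proof (rule connectionI)
  show "linear (segment t Y p)" if Y: "smooth_vf A Y" for Y p
    unfolding segment_def[abs_def]
    by (intro linear_compose_add linear_compose_scale_right connection_linear[OF D0 Y]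
        connection_linear[OF D1 Y])
  show "smooth_vf A (\<lambda>p. segment t Y p (X p))" if "smooth_vf A X" "smooth_vf A Y" for X Y
    unfolding segment_def
    by (intro smooth_vf_on_add smooth_vf_on_scaleR open_UNIV smooth_fn_const
        connection_smooth[OF D0] connection_smooth[OF D1] that)
qed (simp_all add: segment_def connection_add[OF D0] connection_add[OF D1] connection_scaleR[OF D0]
    connection_scaleR[OF D1] algebra_simps)

lemma segment_curve: "connection_curve A segment"
  unfolding connection_curve_def
\<comment> \<open>Any margin would do: an affine combination of two connections is a connection for
  every real \<open>t\<close>, also outside the unit interval.\<close>
proof (intro exI[of _ 1] conjI ballI allI impI)
  fix X Y c assume XY: "smooth_vf A X \<and> smooth_vf A Y" and c: "c \<in> A"
  let ?S = "{- 1<..<1 + 1 :: real} \<times> snd c ` fst c"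
  have o: "open (snd c ` fst c)" using open_chart_image[OF c open_UNIV] by simp
  have So: "open ?S" by (intro open_Times open_greaterThanLessThan o)
  let ?R = "\<lambda>D x. mderiv A (snd c) (chart_inv c x) (D Y (chart_inv c x) (X (chart_inv c x)))"
  have R: "smooth_on ?S (\<lambda>z. ?R D (snd z))" if D: "connection A D" for D
  proof (rule smooth_on_compose[OF fin_dim_euclidean So o, where f = snd and g = "?R D"])
    have "smooth_on (snd c ` (UNIV \<inter> fst c)) (?R D)"
      using connection_smooth[OF D, of Y X] XY c unfolding smooth_vf_on_def by blast
    then show "smooth_on (snd c ` fst c) (?R D)" by simp
    show "smooth_on ?S snd"
      by (rule smooth_on_linear[OF bounded_linear_snd So smooth_on_id])
  qed auto
  have t: "smooth_on ?S (\<lambda>z. fst z)"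
    by (rule smooth_on_linear[OF bounded_linear_fst So smooth_on_id])
  have "smooth_on ?S (\<lambda>z. (1 - fst z) *\<^sub>R ?R D0 (snd z) + fst z *\<^sub>R ?R D1 (snd z))"
    by (intro smooth_on_add smooth_on_bilinear[OF bounded_bilinear_scaleR] smooth_on_diff
        smooth_on_const So t R D0 D1)
  then have "smooth_on ?S (\<lambda>z. case z of (t, x) \<Rightarrow> ?R (segment t) x)"
  proof (rule smooth_on_cong[OF So, rotated])
    fix z assume "z \<in> ?S"
    then obtain t x where z: "z = (t, x)" "chart_inv c x \<in> fst c"
      by (auto simp: chart_inv_chart[OF c])
    note l = linear_dchart[OF c z(2)]
    show "(1 - fst z) *\<^sub>R ?R D0 (snd z) + fst z *\<^sub>R ?R D1 (snd z) = (case z of (t, x) \<Rightarrow> ?R (segment t) x)"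
      by (simp add: z(1) segment_def linear_add[OF l] linear_scale[OF l])
  qed
  then show "smooth_on ?S (\<lambda>(t, x). let q = chart_inv c x in mderiv A (snd c) q (segment t Y q (X q)))"
    by (simp add: Let_def)
qed (use segment_connection in auto)

lemma segment_velocity: "curve_velocity A segment t p v = conn_diff A D0 D1 p v"
proof -
  have "conn_diff A (segment 0) (segment s) p v = s *\<^sub>R conn_diff A D0 D1 p v" for s
  proof (rule conn_diff_unique[OF A])
    fix Y assume Y: "smooth_vf A Y"
    have "(s *\<^sub>R conn_diff A D0 D1 p v) *v Y p = s *\<^sub>R (D1 Y p v - D0 Y p v)"
      by (simp add: scaleR_matrix_vector_assoc[symmetric] conn_diff_mult[OF A D0 D1 Y])
    then show "(s *\<^sub>R conn_diff A D0 D1 p v) *v Y p = segment s Y p v - segment 0 Y p v"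
      by (simp add: segment_def algebra_simps)
  qed
  moreover have "((\<lambda>s. s *\<^sub>R conn_diff A D0 D1 p v) has_vector_derivative conn_diff A D0 D1 p v) (at t)"
    by (auto intro!: derivative_eq_intros)
  ultimately show ?thesis unfolding curve_velocity_def by (simp add: vector_derivative_at)
qed

text \<open>All curvatures are block triangular and the velocity is strictly so; hence the transgression
  form vanishes identically.\<close>

lemma CS_equivalentI:
  assumes VH: "complementary V H" and V: "\<And>p. subspace (V p)" and H: "\<And>p. subspace (H p)"
    and D0V: "\<And>Y p v. section_of A V Y \<Longrightarrow> D0 Y p v \<in> V p"
    and D1V: "\<And>Y p v. section_of A V Y \<Longrightarrow> D1 Y p v \<in> V p"
    and through: "\<And>p w. w \<in> V p \<Longrightarrow> \<exists>Y. section_of A V Y \<and> Y p = w"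
    and B: "\<And>p v w. conn_diff A D0 D1 p v *v w \<in> V p"
      "\<And>p v w. w \<in> V p \<Longrightarrow> conn_diff A D0 D1 p v *v w = 0"
  shows "CS_equivalent A D0 D1"
  unfolding CS_equivalent_def
proof (intro exI[of _ segment] conjI segment_curve allI impI)
  show "segment 0 = D0" "segment 1 = D1" by (simp_all add: segment_def fun_eq_iff)
  fix l and P :: "(nat \<Rightarrow> real^'n^'n) \<Rightarrow> real" assume lP: "1 \<le> l \<and> invariant_polynomial l P"
  have DV: "segment t Y p v \<in> V p" if "section_of A V Y" for t Y p v
    unfolding segment_def by (intro subspace_add subspace_scale V D0V D1V that)
  have RV: "curvature A (segment t) p u v *v w \<in> V p" if w: "w \<in> V p" for t p u v w
  proof -
    obtain X where X: "smooth_vf A X" "X p = u" by (rule vf_through)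
    obtain Y where Y: "smooth_vf A Y" "Y p = v" by (rule vf_through)
    obtain Z where Z: "section_of A V Z" "Z p = w" using through[OF w] by blast
    have Zs: "smooth_vf A Z" using Z by (simp add: section_of_def)
    \<comment> \<open>Derivatives of sections of \<open>V\<close> are again sections of
      \<open>V\<close>, so the iterated derivatives in the curvature do not leave
      \<open>V\<close>.\<close>
    have sec: "section_of A V (\<lambda>q. segment t Z q (X q))" if "smooth_vf A X" for X
      unfolding section_of_def
      using connection_smooth[OF segment_connection Zs that] DV[OF Z(1)] by blast
    have "curvature A (segment t) p (X p) (Y p) *v Z p \<in> V p"
      unfolding curvature_mult[OF A segment_connection X(1) Y(1) Zs]
      by (intro subspace_diff V DV sec Z(1) X Y)
    then show ?thesis by (simp add: X Y Z)
  qed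
  have "wedge_poly l P (curve_velocity A segment t) (curvature A (segment t)) p v = 0" for t p v
  proof -
    have VH': "complementary (\<lambda>_::unit. V p) (\<lambda>_. H p)" using VH by (simp add: complementary_def)
    note tri = invariant_polynomial_triangular[OF VH' V H]
    have M0: "off_diagonal (V p) (H p) (conn_diff A D0 D1 p u)" for u
      unfolding off_diagonal_def[OF VH' V H]
      using B projector[OF VH' V H] by auto
    have "P (\<lambda>i. if i = 0 then curve_velocity A segment t p (v (\<sigma> 0))
        else curvature A (segment t) p (v (\<sigma> (2 * i - 1))) (v (\<sigma> (2 * i)))) = 0" for \<sigma>
    proof (rule tri)
      show "invariant_polynomial l P" "1 \<le> l" using lP by auto
    qed (use M0 RV B subspace_0[OF V] in \<open>auto simp: segment_velocity\<close>)
    then show ?thesis by (simp add: wedge_poly_def)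
  qed
  then have "TP_form A l P segment = (\<lambda>_ _. 0)" by (simp add: TP_form_def fun_eq_iff)
  then show "exact_form A (2 * l - 1) (TP_form A l P segment)"
    unfolding exact_form_def using lP
    by (auto intro!: exI[of _ "\<lambda>_ _. 0"] simp: smooth_form_zero ext_deriv_def mderiv_const)
qed

end

section \<open>Products and slices\<close>

context manifold
begin

lemma smooth_fn_Pair:
  assumes "open W" "smooth_fn A W F" "smooth_fn A W G"
  shows "smooth_fn A W (\<lambda>q. (F q, G q))"
  using assms unfolding smooth_fn_def by (simp add: smooth_on_Pair open_chart_image)

lemma mderiv_Pair:
  assumes "open W" "p \<in> W" "smooth_fn A W F" "smooth_fn A W G"
  shows "mderiv A (\<lambda>q. (F q, G q)) p v = (mderiv A F p v, mderiv A G p v)"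
  using mderivI[OF has_derivative_Pair[OF mderiv_has_derivative[OF assms(3,1,2)]
        mderiv_has_derivative[OF assms(4,1,2)]]] by simp

end

lemma smooth_map_on_subset:
  assumes "smooth_map_on A B W f" "W' \<subseteq> W"
  shows "smooth_map_on A B W' f"
  unfolding smooth_map_on_def
proof (intro conjI ballI)
  show "continuous_on W' f" using assms continuous_on_subset unfolding smooth_map_on_def by blast
  fix c d assume "c \<in> A" "d \<in> B"
  then have "smooth_on (snd c ` (W \<inter> fst c \<inter> f -` fst d)) (snd d \<circ> f \<circ> chart_inv c)"
    using assms unfolding smooth_map_on_def by blast
  then show "smooth_on (snd c ` (W' \<inter> fst c \<inter> f -` fst d)) (snd d \<circ> f \<circ> chart_inv c)"
    by (rule smooth_on_subset) (use assms(2) in blast)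
qed

lemma smooth_map_on_compose:
  assumes mf: "manifold A" "manifold B" "manifold C"
    and f: "smooth_map_on A B W f" "open W" and g: "smooth_map_on B C V g" "open V"
    and sub: "\<And>q. q \<in> W \<Longrightarrow> f q \<in> V"
  shows "smooth_map_on A C W (\<lambda>q. g (f q))"
proof -
  interpret AB: manifold_pair A B using mf by (simp add: manifold_pair_def)
  interpret BC: manifold_pair B C using mf by (simp add: manifold_pair_def)
  interpret AC: manifold_pair A C using mf by (simp add: manifold_pair_def)
  show ?thesis
  proof (rule AC.smooth_map_onI)
    have "continuous_on W f" "continuous_on V g" "f ` W \<subseteq> V"
      using f g sub by (auto simp: smooth_map_on_def)
    then show "continuous_on W (\<lambda>q. g (f q))" by (simp add: continuous_on_compose2)
    fix e assume e: "e \<in> C"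
    have o: "open (V \<inter> g -` fst e)" by (rule BC.open_vimage_map[OF g BC.B.open_chart[OF e]])
    have "smooth_fn A (W \<inter> f -` (V \<inter> g -` fst e)) (\<lambda>q. snd e (g (f q)))"
      by (rule AB.smooth_fn_pullback[OF smooth_map_on_subset[OF f(1)] AB.open_vimage_map[OF f o] o _
            BC.smooth_fn_chart_map[OF g e]]) auto
    moreover have "W \<inter> f -` (V \<inter> g -` fst e) = W \<inter> (\<lambda>q. g (f q)) -` fst e" using sub by blast
    ultimately show "smooth_fn A (W \<inter> (\<lambda>q. g (f q)) -` fst e) (\<lambda>q. snd e (g (f q)))" by simp
  qed
qed

lemma continuous_on_map_prod:
  assumes f: "continuous_on S f" and h: "continuous_on T h"
  shows "continuous_on (S \<times> T) (map_prod f h)"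
proof -
  have "continuous_on (S \<times> T) (\<lambda>z. f (fst z))" "continuous_on (S \<times> T) (\<lambda>z. h (snd z))"
    by (rule continuous_on_compose2[OF f continuous_on_fst[OF continuous_on_id]], force)
      (rule continuous_on_compose2[OF h continuous_on_snd[OF continuous_on_id]], force)
  then show ?thesis unfolding map_prod_def case_prod_beta by (rule continuous_on_Pair)
qed

context manifold_pair
begin

text \<open>An inverse obtained from \<open>inv_into\<close> is a choice; injectivity of both
  factors forces the choice on the product to be componentwise.\<close>

lemma product_chart_inv:
  assumes c: "c \<in> A" and d: "d \<in> B" and "a \<in> snd c ` fst c" "b \<in> snd d ` fst d"
  shows "inv_into (fst c \<times> fst d) (map_prod (snd c) (snd d)) (a, b) = (chart_inv c a, chart_inv d b)"
proof -
  obtain q r where qr: "q \<in> fst c" "a = snd c q" "r \<in> fst d" "b = snd d r" using assms by blast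
  have "inj_on (snd c) (fst c)" "inj_on (snd d) (fst d)"
    by (metis A.chart_inv_chart[OF c] inj_onI) (metis B.chart_inv_chart[OF d] inj_onI)
  then have "inj_on (map_prod (snd c) (snd d)) (fst c \<times> fst d)" by (rule map_prod_inj_on)
  from inv_into_f_f[OF this, of "(q, r)"] qr
  show ?thesis by (simp add: A.chart_inv_chart[OF c] B.chart_inv_chart[OF d])
qed

text \<open>Local trivialisations are maps out of and into the product, and the calculus of smooth
  maps is set up between manifolds.\<close>

lemma product_manifold: "manifold (product_atlas A B)"
  unfolding manifold_def smooth_manifold_def
proof (intro conjI ballI)
  show "\<exists>S::('e \<times> 'f) set. finite S \<and> span S = UNIV"
    using fin_dim_prod[OF A.fin_dim B.fin_dim] by (simp add: fin_dim_def)
  have "(x, y) \<in> (\<Union>c\<in>product_atlas A B. fst c)" for x y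
  proof (rule UN_I)
    show "(fst (chart_at A x) \<times> fst (chart_at B y), map_prod (snd (chart_at A x)) (snd (chart_at B y)))
        \<in> product_atlas A B"
      using A.chart_at(1) B.chart_at(1) unfolding product_atlas_def by blast
  qed (simp add: A.chart_at B.chart_at)
  then show "(\<Union>c\<in>product_atlas A B. fst c) = UNIV" by auto
next
  fix P assume "P \<in> product_atlas A B"
  then obtain c d where P: "P = (fst c \<times> fst d, map_prod (snd c) (snd d))" "c \<in> A" "d \<in> B"
    unfolding product_atlas_def by blast
  show "open (fst P)" using P A.open_chart[OF P(2)] B.open_chart[OF P(3)] by (simp add: open_Times)
  have im: "snd P ` fst P = snd c ` fst c \<times> snd d ` fst d" using P by (simp add: map_prod_surj_on)
  show "open (snd P ` fst P)"
    unfolding im using A.open_chart_image[OF P(2) open_UNIV] B.open_chart_image[OF P(3) open_UNIV]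
    by (simp add: open_Times)
  have inv: "chart_inv P z = map_prod (chart_inv c) (chart_inv d) z" if "z \<in> snd P ` fst P" for z
    using that product_chart_inv[OF P(2,3), of "fst z" "snd z"] unfolding im
    by (cases z) (simp add: P(1))
  have c: "continuous_on (fst c) (snd c)" "continuous_on (snd c ` fst c) (chart_inv c)"
    using A.chart_homeomorphism[OF P(2)] by (simp_all add: homeomorphism_def)
  have d: "continuous_on (fst d) (snd d)" "continuous_on (snd d ` fst d) (chart_inv d)"
    using B.chart_homeomorphism[OF P(3)] by (simp_all add: homeomorphism_def)
  show "homeomorphism (fst P) (snd P ` fst P) (snd P) (chart_inv P)"
  proof (rule homeomorphismI)
    show "continuous_on (fst P) (snd P)"
      unfolding P(1) fst_conv snd_conv by (rule continuous_on_map_prod[OF c(1) d(1)])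
    have "continuous_on (snd P ` fst P) (map_prod (chart_inv c) (chart_inv d))"
      unfolding im by (rule continuous_on_map_prod[OF c(2) d(2)])
    then show "continuous_on (snd P ` fst P) (chart_inv P)"
      using continuous_on_cong[OF refl inv, of "snd P ` fst P"] by simp
    show "chart_inv P ` (snd P ` fst P) \<subseteq> fst P"
      by (rule image_subsetI) (rule inv_into_into)
    show "chart_inv P (snd P z) = z" if "z \<in> fst P" for z
      using inv[of "snd P z"] that P A.chart_inv_chart[OF P(2)] B.chart_inv_chart[OF P(3)]
      by (cases z) auto
  qed (auto simp: f_inv_into_f)
next
  fix P P' assume "P \<in> product_atlas A B" "P' \<in> product_atlas A B"
  then obtain c d c' d' where P: "P = (fst c \<times> fst d, map_prod (snd c) (snd d))" "c \<in> A" "d \<in> B"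
    and P': "P' = (fst c' \<times> fst d', map_prod (snd c') (snd d'))" "c' \<in> A" "d' \<in> B"
    unfolding product_atlas_def by blast
  let ?U = "snd c ` (fst c \<inter> fst c')" and ?W = "snd d ` (fst d \<inter> fst d')"
  have UW: "open ?U" "open ?W"
    using A.open_chart_image[OF P(2) A.open_chart[OF P'(2)]]
      B.open_chart_image[OF P(3) B.open_chart[OF P'(3)]] by (simp_all add: Int_commute)
  then have o: "open (?U \<times> ?W)" by (rule open_Times)
  have set: "snd P ` (fst P \<inter> fst P') = ?U \<times> ?W"
    using P P' by (simp add: Times_Int_Times map_prod_surj_on)
  have "smooth_on (?U \<times> ?W) (\<lambda>z. (snd c' (chart_inv c (fst z)), snd d' (chart_inv d (snd z))))"
  proof (rule smooth_on_Pair[OF o])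
    show "smooth_on (?U \<times> ?W) (\<lambda>z. snd c' (chart_inv c (fst z)))"
      by (rule smooth_on_compose[OF A.fin_dim o UW(1) _ smooth_on_linear[OF bounded_linear_fst o smooth_on_id]
            A.transition[OF P(2) P'(2)]]) auto
    show "smooth_on (?U \<times> ?W) (\<lambda>z. snd d' (chart_inv d (snd z)))"
      by (rule smooth_on_compose[OF B.fin_dim o UW(2) _ smooth_on_linear[OF bounded_linear_snd o smooth_on_id]
            B.transition[OF P(3) P'(3)]]) auto
  qed
  then show "smooth_on (snd P ` (fst P \<inter> fst P')) (snd P' \<circ> chart_inv P)"
    unfolding set
  proof (rule smooth_on_cong[OF o, rotated])
    fix z assume "z \<in> ?U \<times> ?W"
    then have "chart_inv P z = (chart_inv c (fst z), chart_inv d (snd z))"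
      using product_chart_inv[OF P(2,3), of "fst z" "snd z"] by (auto simp: P(1))
    then show "(snd c' (chart_inv c (fst z)), snd d' (chart_inv d (snd z))) = (snd P' \<circ> chart_inv P) z"
      by (simp add: P'(1))
  qed
qed

end

context manifold_pair
begin

interpretation AB: manifold "product_atlas A B" by (rule product_manifold)
interpretation B_AB: manifold_pair B "product_atlas A B" by unfold_locales
interpretation A_AB: manifold_pair A "product_atlas A B" by unfold_locales
interpretation AB_B: manifold_pair "product_atlas A B" B by unfold_locales

lemma smooth_slice_right: "smooth_map_on B (product_atlas A B) UNIV (\<lambda>y. (x, y))"
proof (rule B_AB.smooth_map_onI)
  fix P assume "P \<in> product_atlas A B"
  then obtain c d where P: "P = (fst c \<times> fst d, map_prod (snd c) (snd d))" "c \<in> A" "d \<in> B"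
    unfolding product_atlas_def by blast
  have "smooth_fn B (fst d) (\<lambda>y. (snd c x, snd d y))"
    by (intro B.smooth_fn_Pair B.open_chart B.smooth_fn_const B.smooth_fn_chart P)
  then show "smooth_fn B (UNIV \<inter> (\<lambda>y. (x, y)) -` fst P) (\<lambda>y. snd P (x, y))"
    unfolding P(1) by (auto elim!: smooth_fn_subset)
qed (intro continuous_intros)

lemma smooth_slice_left: "smooth_map_on A (product_atlas A B) UNIV (\<lambda>x. (x, y))"
proof (rule A_AB.smooth_map_onI)
  fix P assume "P \<in> product_atlas A B"
  then obtain c d where P: "P = (fst c \<times> fst d, map_prod (snd c) (snd d))" "c \<in> A" "d \<in> B"
    unfolding product_atlas_def by blast
  have "smooth_fn A (fst c) (\<lambda>x. (snd c x, snd d y))"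
    by (intro A.smooth_fn_Pair A.open_chart A.smooth_fn_const A.smooth_fn_chart P)
  then show "smooth_fn A (UNIV \<inter> (\<lambda>x. (x, y)) -` fst P) (\<lambda>x. snd P (x, y))"
    unfolding P(1) by (auto elim!: smooth_fn_subset)
qed (intro continuous_intros)

lemma smooth_snd: "smooth_map_on (product_atlas A B) B UNIV snd"
proof (rule AB_B.smooth_map_onI)
  fix d assume d: "d \<in> B"
  show "smooth_fn (product_atlas A B) (UNIV \<inter> snd -` fst d) (\<lambda>z. snd d (snd z))"
  proof (rule AB.smooth_fn_local)
    fix z :: "'a \<times> 'b" assume z: "z \<in> UNIV \<inter> snd -` fst d"
    \<comment> \<open>Any chart of the first factor around \<open>fst z\<close> completes
      \<open>d\<close> to a product chart at \<open>z\<close>.\<close>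
    let ?c = "chart_at A (fst z)"
    let ?P = "(fst ?c \<times> fst d, map_prod (snd ?c) (snd d))"
    have P: "?P \<in> product_atlas A B" using A.chart_at(1) d unfolding product_atlas_def by blast
    have "smooth_fn (product_atlas A B) (fst ?P) (\<lambda>z. snd (snd ?P z))"
      by (rule AB.smooth_fn_linear[OF bounded_linear_snd AB.open_chart[OF P] AB.smooth_fn_chart[OF P]])
    moreover have "(\<lambda>z. snd (snd ?P z)) = (\<lambda>z. snd d (snd z))" by (simp add: fun_eq_iff)
    ultimately show "\<exists>W'. open W' \<and> z \<in> W' \<and> smooth_fn (product_atlas A B) W' (\<lambda>z. snd d (snd z))"
      using AB.open_chart[OF P] z A.chart_at(2)[of "fst z"]
      by (intro exI[of _ "fst ?P"]) (auto simp: mem_Times_iff)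
  qed
qed (intro continuous_intros)

end

section \<open>Fibrations\<close>

locale fibration =
  fixes AF :: "('a::{t2_space,second_countable_topology}, 'e::real_inner) chart set"
    and AM :: "('b::{t2_space,second_countable_topology}, 'm::real_inner) chart set"
    and AC :: "('c::{t2_space,second_countable_topology}, 'k::real_inner) chart set"
    and \<pi> :: "'a \<Rightarrow> 'b"
  assumes fib: "smooth_fibration AF AM AC \<pi>"
begin

lemma manifolds: "manifold AF" "manifold AM" "manifold AC"
  using fib by (simp_all add: smooth_fibration_def manifold_def)

end

sublocale fibration \<subseteq> F: manifold AF by (rule manifolds)
sublocale fibration \<subseteq> M: manifold AM by (rule manifolds)
sublocale fibration \<subseteq> C: manifold AC by (rule manifolds)
sublocale fibration \<subseteq> FM: manifold_pair AF AM by unfold_locales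

context fibration
begin

abbreviation "dp \<equiv> mdiff AF AM \<pi>"

lemma smooth_projection: "smooth_map_on AF AM UNIV \<pi>"
  using fib by (simp add: smooth_fibration_def)

lemma linear_dp: "linear (dp p)"
  by (rule FM.linear_mdiff[OF smooth_projection open_UNIV UNIV_I])

lemma open_preimage: "open U \<Longrightarrow> open (\<pi> -` U)"
  using FM.open_vimage_map[OF smooth_projection open_UNIV] by simp

section \<open>Vertical vectors as tangent vectors of the fibres\<close>

context
  fixes U T assumes triv: "local_trivialization AF AM AC \<pi> U T"
begin

interpretation MC: manifold_pair AM AC by unfold_locales
interpretation P: manifold "product_atlas AM AC" by (rule MC.product_manifold)
interpretation CF: manifold_pair AC AF by unfold_locales
interpretation FC: manifold_pair AF AC by unfold_locales
interpretation FP: manifold_pair AF "product_atlas AM AC" by unfold_locales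
interpretation PF: manifold_pair "product_atlas AM AC" AF by unfold_locales
interpretation FF: manifold_pair AF AF by unfold_locales
interpretation MM: manifold_pair AM AM by unfold_locales

definition triv_inv :: "'a \<Rightarrow> 'b \<times> 'c" where "triv_inv = inv_into (U \<times> UNIV) T"

text \<open>A retraction onto the typical fibre: it is left inverse to every inclusion of a fibre
  over \<open>U\<close>, and its differential carries vertical vectors to the typical fibre.\<close>

definition fibre_coord :: "'a \<Rightarrow> 'c" where "fibre_coord q = snd (triv_inv q)"

lemma open_base: "open U" and open_total: "open (\<pi> -` U)" and open_prod: "open (U \<times> (UNIV :: 'c set))"
  using triv open_preimage[of U] by (auto simp: local_trivialization_def open_Times)

lemma projection_triv: "x \<in> U \<Longrightarrow> \<pi> (T (x, y)) = x"
  using triv by (simp add: local_trivialization_def)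

lemma triv_inv: "q \<in> \<pi> -` U \<Longrightarrow> T (triv_inv q) = q" "x \<in> U \<Longrightarrow> triv_inv (T (x, y)) = (x, y)"
  "q \<in> \<pi> -` U \<Longrightarrow> triv_inv q = (\<pi> q, fibre_coord q)"
proof -
  have bij: "bij_betw T (U \<times> UNIV) (\<pi> -` U)" using triv by (simp add: local_trivialization_def)
  have 1: "T (triv_inv q) = q" if "q \<in> \<pi> -` U" for q
    using bij that unfolding triv_inv_def by (simp add: bij_betw_inv_into_right)
  then show "q \<in> \<pi> -` U \<Longrightarrow> T (triv_inv q) = q" .
  show "x \<in> U \<Longrightarrow> triv_inv (T (x, y)) = (x, y)"
    using bij_betw_inv_into_left[OF bij, of "(x, y)"] unfolding triv_inv_def by simp
  assume q: "q \<in> \<pi> -` U"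
  then have "triv_inv q \<in> U \<times> UNIV"
    using bij unfolding triv_inv_def by (metis bij_betw_def inv_into_into)
  then have "\<pi> (T (triv_inv q)) = fst (triv_inv q)"
    using projection_triv[of "fst (triv_inv q)" "snd (triv_inv q)"] by (simp add: mem_Times_iff)
  then show "triv_inv q = (\<pi> q, fibre_coord q)"
    using 1[OF q] by (simp add: fibre_coord_def prod_eq_iff)
qed

lemma smooth_triv: "smooth_map_on (product_atlas AM AC) AF (U \<times> UNIV) T"
  and smooth_triv_inv: "smooth_map_on AF (product_atlas AM AC) (\<pi> -` U) triv_inv"
  using triv by (simp_all add: local_trivialization_def triv_inv_def)

lemma smooth_fibre_coord: "smooth_map_on AF AC (\<pi> -` U) fibre_coord"
  unfolding fibre_coord_def[abs_def]
  by (rule smooth_map_on_compose[OF manifolds(1) MC.product_manifold manifolds(3) smooth_triv_inv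
        open_total MC.smooth_snd open_UNIV]) simp

lemma smooth_section_map: "smooth_map_on AM AF U (\<lambda>x. T (x, y))"
  by (rule smooth_map_on_compose[OF manifolds(2) MC.product_manifold manifolds(1)
        smooth_map_on_subset[OF MC.smooth_slice_left subset_UNIV] open_base smooth_triv open_prod]) simp

text \<open>Differentiating \<open>\<pi> (T (x, y)) = x\<close> in \<open>x\<close> shows that the
  local section with constant fibre coordinate splits \<open>dp\<close>; in particular
  \<open>dp\<close> is surjective.\<close>

lemma dp_section_map:
  assumes x: "x \<in> U"
  shows "dp (T (x, y)) (mdiff AM AF (\<lambda>x. T (x, y)) x v) = v"
proof -
  note s = smooth_section_map[of y] open_base
  have "mdiff AM AM (\<lambda>x. x) x v = mdiff AM AM (\<lambda>x. \<pi> (T (x, y))) x v"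
    by (rule MM.mdiff_cong[OF smooth_map_on_compose[OF manifolds(2,1,2) s smooth_projection open_UNIV]
          open_base x]) (simp_all add: projection_triv)
  then show ?thesis
    using mdiff_compose[OF manifolds(2,1,2) s x smooth_projection open_UNIV UNIV_I]
    by (simp add: M.mdiff_id)
qed

context
  fixes x assumes x: "x \<in> U"
begin

lemma smooth_fibre_map: "smooth_map_on AC AF UNIV (\<lambda>y. T (x, y))"
  by (rule smooth_map_on_compose[OF manifolds(3) MC.product_manifold manifolds(1)
        MC.smooth_slice_right open_UNIV smooth_triv open_prod]) (simp add: x)

abbreviation "d\<iota> \<equiv> mdiff AC AF (\<lambda>y. T (x, y))"

lemma linear_fibre_map: "linear (d\<iota> y)"
  by (rule CF.linear_mdiff[OF smooth_fibre_map open_UNIV UNIV_I])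

lemma dp_fibre_map: "dp (T (x, y)) (d\<iota> y v) = 0"
proof -
  have "mdiff AC AM (\<lambda>y. \<pi> (T (x, y))) y v = 0"
    by (simp add: projection_triv x mdiff_def o_def C.mderiv_const)
  then show ?thesis
    using mdiff_compose[OF manifolds(3,1,2) smooth_fibre_map open_UNIV UNIV_I smooth_projection
        open_UNIV UNIV_I] by simp
qed

lemma fibre_map_total: "T (x, y) \<in> \<pi> -` U"
  by (simp add: projection_triv x)

lemma fibre_coord_fibre_map: "fibre_coord (T (x, y)) = y"
  by (simp add: fibre_coord_def triv_inv x)

lemma d_fibre_coord_fibre_map: "mdiff AF AC fibre_coord (T (x, y)) (d\<iota> y v) = v"
  using mdiff_compose[OF manifolds(3,1,3) smooth_fibre_map open_UNIV UNIV_I smooth_fibre_coord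
      open_total fibre_map_total[of y], of v]
  by (simp add: fibre_coord_fibre_map C.mdiff_id)

text \<open>Every vertical vector is tangent to its fibre. The difference \<open>w\<close> of the
  two sides is killed by \<open>dp\<close> and by the differential of \<open>fibre_coord\<close>,
  hence by that of \<open>triv_inv\<close>, which is injective because \<open>T\<close> inverts
  \<open>triv_inv\<close>.\<close>

lemma d_fibre_map_fibre_coord:
  assumes v: "dp (T (x, y)) v = 0"
  shows "d\<iota> y (mdiff AF AC fibre_coord (T (x, y)) v) = v"
proof -
  let ?p = "T (x, y)"
  note p = fibre_map_total[of y]
  define w where "w = v - d\<iota> y (mdiff AF AC fibre_coord ?p v)"
  note lin = FC.linear_mdiff[OF smooth_fibre_coord open_total p]
  have w: "dp ?p w = 0" "mdiff AF AC fibre_coord ?p w = 0"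
    using v by (simp_all add: w_def linear_diff[OF linear_dp] linear_diff[OF lin]
        dp_fibre_map d_fibre_coord_fibre_map)
  \<comment> \<open>The atlas of the product consists of product charts only, so the preferred one
    splits and the differential of \<open>triv_inv\<close> becomes a pair.\<close>
  let ?P = "chart_at (product_atlas AM AC) (triv_inv ?p)"
  obtain c d where P: "?P = (fst c \<times> fst d, map_prod (snd c) (snd d))" "c \<in> AM" "d \<in> AC"
    using P.chart_at(1)[of "triv_inv ?p"] unfolding product_atlas_def by blast
  let ?W = "(UNIV \<inter> \<pi> -` fst c) \<inter> (\<pi> -` U \<inter> fibre_coord -` fst d)"
  have Wc: "open (UNIV \<inter> \<pi> -` fst c)"
    by (rule FM.open_vimage_map[OF smooth_projection open_UNIV M.open_chart[OF P(2)]])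
  have Wd: "open (\<pi> -` U \<inter> fibre_coord -` fst d)"
    by (rule FC.open_vimage_map[OF smooth_fibre_coord open_total C.open_chart[OF P(3)]])
  have o: "open ?W" using Wc Wd by (rule open_Int)
  have cd: "\<pi> ?p \<in> fst c" "fibre_coord ?p \<in> fst d"
    using P.chart_at(2)[of "triv_inv ?p"] unfolding P(1) by (auto simp: triv_inv(3)[OF p])
  have pW: "?p \<in> ?W" using p cd by blast
  have sm: "smooth_fn AF ?W (\<lambda>q. snd c (\<pi> q))" "smooth_fn AF ?W (\<lambda>q. snd d (fibre_coord q))"
    by (rule smooth_fn_subset[OF FM.smooth_fn_chart_map[OF smooth_projection open_UNIV P(2)]], blast)
      (rule smooth_fn_subset[OF FC.smooth_fn_chart_map[OF smooth_fibre_coord open_total P(3)]], blast)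
  have "mderiv AF (\<lambda>q. snd ?P (triv_inv q)) ?p = mderiv AF (\<lambda>q. (snd c (\<pi> q), snd d (fibre_coord q))) ?p"
    by (rule F.mderiv_cong[OF o pW _ F.smooth_fn_Pair[OF o sm]]) (simp add: triv_inv(3) P(1))
  then have "mdiff AF (product_atlas AM AC) triv_inv ?p w
      = (mderiv AF (\<lambda>q. snd c (\<pi> q)) ?p w, mderiv AF (\<lambda>q. snd d (fibre_coord q)) ?p w)"
    by (simp add: mdiff_def o_def F.mderiv_Pair[OF o pW sm])
  also have "\<dots> = (mderiv AM (snd c) (\<pi> ?p) (dp ?p w), mderiv AC (snd d) (fibre_coord ?p) (mdiff AF AC fibre_coord ?p w))"
    by (simp only: FM.dchart_mdiff[OF smooth_projection open_UNIV UNIV_I P(2) cd(1)]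
        FC.dchart_mdiff[OF smooth_fibre_coord open_total p P(3) cd(2)])
  also have "\<dots> = 0"
    by (simp add: w linear_0[OF M.linear_dchart[OF P(2) cd(1)]] linear_0[OF C.linear_dchart[OF P(3) cd(2)]]
        zero_prod_def)
  finally have 0: "mdiff AF (product_atlas AM AC) triv_inv ?p w = 0" .
  have ip: "triv_inv q \<in> U \<times> UNIV" if "q \<in> \<pi> -` U" for q using triv_inv(3)[OF that] that by simp
  note comp = smooth_map_on_compose[OF manifolds(1) MC.product_manifold manifolds(1) smooth_triv_inv
      open_total smooth_triv open_prod ip]
  have "mdiff AF AF (\<lambda>q. q) ?p w = mdiff AF AF (\<lambda>q. T (triv_inv q)) ?p w"
    by (rule FF.mdiff_cong[OF comp open_total p]) (simp_all add: triv_inv(1))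
  also have "\<dots> = mdiff (product_atlas AM AC) AF T (triv_inv ?p) 0"
    using mdiff_compose[OF manifolds(1) MC.product_manifold manifolds(1) smooth_triv_inv open_total p
        smooth_triv open_prod ip[OF p], of w] by (simp only: 0)
  also have "\<dots> = 0"
    by (rule linear_0[OF PF.linear_mdiff[OF smooth_triv open_prod ip[OF p]]])
  finally have "w = 0" by (simp add: F.mdiff_id)
  then show ?thesis by (simp add: w_def)
qed

text \<open>Using the differential of \<open>fibre_coord\<close> in place of an inverse of
  \<open>d\<iota>\<close> gives a formula whose smoothness is inherited by pullback along the
  inclusion of the fibre.\<close>

definition fibre_field :: "('a \<Rightarrow> 'e) \<Rightarrow> 'c \<Rightarrow> 'k" where
  "fibre_field X y = mdiff AF AC fibre_coord (T (x, y)) (X (T (x, y)))"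

lemma fibre_field_related:
  assumes "\<And>q. dp q (X q) = 0"
  shows "fields_related AC AF (\<lambda>y. T (x, y)) (fibre_field X) X"
  unfolding fields_related_def fibre_field_def using d_fibre_map_fibre_coord assms by blast

lemma smooth_fibre_field:
  assumes X: "smooth_vf AF X"
  shows "smooth_vf AC (fibre_field X)"
proof (rule C.smooth_vfI)
  fix d assume d: "d \<in> AC"
  have "smooth_fn AF (\<pi> -` U \<inter> fibre_coord -` fst d)
      (\<lambda>q. mderiv AC (snd d) (fibre_coord q) (mdiff AF AC fibre_coord q (X q)))"
    by (rule FC.smooth_fn_mdiff[OF smooth_fibre_coord open_total F.smooth_vf_on_subset[OF X subset_UNIV] d])
  then have "smooth_fn AC (fst d) (\<lambda>y. mderiv AC (snd d) (fibre_coord (T (x, y)))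
      (mdiff AF AC fibre_coord (T (x, y)) (X (T (x, y)))))"
    by (rule CF.smooth_fn_pullback[OF smooth_map_on_subset[OF smooth_fibre_map subset_UNIV]
          C.open_chart[OF d] FC.open_vimage_map[OF smooth_fibre_coord open_total C.open_chart[OF d]], rotated])
      (simp add: projection_triv x fibre_coord_fibre_map)
  then show "smooth_fn AC (UNIV \<inter> fst d) (\<lambda>q. mderiv AC (snd d) q (fibre_field X q))"
    by (simp add: fibre_field_def fibre_coord_fibre_map)
qed

end

end

lemma triv_through: obtains U T y where "local_trivialization AF AM AC \<pi> U T" "\<pi> p \<in> U" "p = T (\<pi> p, y)"
proof -
  obtain U T where UT: "\<pi> p \<in> U" "local_trivialization AF AM AC \<pi> U T"
    using fib unfolding smooth_fibration_def by blast
  have "p = T (\<pi> p, fibre_coord U T p)"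
    using triv_inv(1,3)[OF UT(2), of p] UT(1) by simp
  then show ?thesis using that UT by blast
qed

lemma dp_surj: "\<exists>v. dp p v = u"
proof -
  obtain U T y where UT: "local_trivialization AF AM AC \<pi> U T" "\<pi> p \<in> U" "p = T (\<pi> p, y)"
    by (rule triv_through)
  show ?thesis using dp_section_map[OF UT(1,2), of y u] UT(3) by metis
qed

end

section \<open>Horizontal lifts\<close>

locale horizontal_fibration = fibration AF AM AC \<pi>
  for AF :: "('a::{t2_space,second_countable_topology}, 'e::real_inner) chart set"
    and AM :: "('b::{t2_space,second_countable_topology}, 'm::real_inner) chart set"
    and AC :: "('c::{t2_space,second_countable_topology}, 'k::real_inner) chart set"
    and \<pi> +
  fixes H :: "'a \<Rightarrow> 'e set"
  assumes H_subbundle: "smooth_subbundle AF H" and VH: "complementary (vertical AF AM \<pi>) H"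
begin

abbreviation "V \<equiv> vertical AF AM \<pi>"
abbreviation "proj \<equiv> proj_along V H"

lemma V_iff: "v \<in> V p \<longleftrightarrow> dp p v = 0"
  by (simp add: vertical_def)

lemma subspace_V: "subspace (V p)"
  unfolding vertical_def by (rule linear_subspace_kernel[OF linear_dp])

lemma subspace_H: "subspace (H p)"
  using H_subbundle by (simp add: smooth_subbundle_def)

lemmas proj = proj_along[OF VH subspace_V subspace_H]
  and proj_V = proj_along_V[OF VH subspace_V subspace_H]
  and proj_H = proj_along_H[OF VH subspace_V subspace_H]
  and linear_proj = linear_proj_along[OF VH subspace_V subspace_H]

lemma dp_proj: "dp p (proj p u) = 0"
  using proj(1) by (simp add: V_iff)

lemma horizontal_eqI:
  assumes "h \<in> H p" "h' \<in> H p" "dp p h = dp p h'"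
  shows "h = h'"
proof -
  have "h - h' \<in> H p" using assms subspace_diff[OF subspace_H] by blast
  moreover have "h - h' \<in> V p" using assms by (simp add: V_iff linear_diff[OF linear_dp])
  moreover have "V p \<inter> H p = {0}" using VH by (simp add: complementary_def)
  ultimately have "h - h' = 0" by blast
  then show ?thesis by simp
qed

lemma hor_lift: "hor_lift AF AM \<pi> H K p \<in> H p" "dp p (hor_lift AF AM \<pi> H K p) = K (\<pi> p)"
proof -
  obtain v where v: "dp p v = K (\<pi> p)" using dp_surj by blast
  have "\<exists>!h. h \<in> H p \<and> dp p h = K (\<pi> p)"
  proof (rule ex1I)
    show "v - proj p v \<in> H p \<and> dp p (v - proj p v) = K (\<pi> p)"
      using proj(2) v by (simp add: linear_diff[OF linear_dp] dp_proj)
  qed (use horizontal_eqI proj(2) v dp_proj in \<open>auto simp: linear_diff[OF linear_dp]\<close>)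
  from theI'[OF this]
  show "hor_lift AF AM \<pi> H K p \<in> H p" "dp p (hor_lift AF AM \<pi> H K p) = K (\<pi> p)"
    unfolding hor_lift_def by blast+
qed

text \<open>In a local frame of \<open>H\<close> the coefficients of \<open>h\<close> solve a linear system with smooth coefficients.\<close>

lemma smooth_horizontal:
  assumes u: "\<And>d. d \<in> AM \<Longrightarrow> smooth_fn AF (\<pi> -` fst d) (\<lambda>q. mderiv AM (snd d) (\<pi> q) (dp q (h q)))"
    and h: "\<And>q. h q \<in> H q"
  shows "smooth_vf AF h"
proof (rule F.smooth_vf_local)
  fix p
  have "\<exists>W r. \<exists>X :: nat \<Rightarrow> 'a \<Rightarrow> 'e. open W \<and> p \<in> W \<and> (\<forall>i<r. smooth_vf_on AF W (X i)) \<and>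
      (\<forall>q\<in>W. inj_on (\<lambda>i. X i q) {..<r} \<and> independent ((\<lambda>i. X i q) ` {..<r}) \<and>
               span ((\<lambda>i. X i q) ` {..<r}) = H q)"
    using H_subbundle by (simp add: smooth_subbundle_def)
  then obtain W0 r and X :: "nat \<Rightarrow> 'a \<Rightarrow> 'e" where W0: "open W0" "p \<in> W0"
    and X': "\<forall>i<r. smooth_vf_on AF W0 (X i)"
    and frame': "\<forall>q\<in>W0. inj_on (\<lambda>i. X i q) {..<r} \<and> independent ((\<lambda>i. X i q) ` {..<r}) \<and>
               span ((\<lambda>i. X i q) ` {..<r}) = H q"
    by (elim exE conjE) (rule that)
  note X = X'[rule_format] and frame = frame'[rule_format]
  let ?d = "chart_at AM (\<pi> p)" and ?c = "chart_at AF p"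
  note d = M.chart_at[of "\<pi> p"] and c = F.chart_at[of p]
  define W where "W = (W0 \<inter> \<pi> -` fst ?d) \<inter> fst ?c"
  have oW: "open (W0 \<inter> \<pi> -` fst ?d)" using W0 open_preimage[OF M.open_chart[OF d(1)]] by blast
  have W: "open W" "p \<in> W" "W \<subseteq> fst ?c"
    using oW F.open_chart[OF c(1)] W0 d(2) c(2) by (auto simp: W_def)
  define dd where "dd q = mderiv AM (snd ?d) (\<pi> q)" for q
  have dd: "linear (dd q)" "bij (dd q)" if "q \<in> W" for q
    using that M.linear_dchart[OF d(1)] M.bij_dchart[OF d(1)] by (auto simp: W_def dd_def)
  have m: "smooth_fn AF W (\<lambda>q. dd q (dp q (X i q)))" if "i < r" for i
    unfolding dd_def
    by (rule smooth_fn_subset[OF FM.smooth_fn_mdiff[OF smooth_map_on_subset[OF smooth_projection subset_UNIV]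
            W0(1) X[OF that] d(1)]]) (auto simp: W_def)
  have uW: "smooth_fn AF W (\<lambda>q. dd q (dp q (h q)))"
    unfolding dd_def by (rule smooth_fn_subset[OF u[OF d(1)]]) (auto simp: W_def)
  have frameW: "q \<in> W0" if "q \<in> W" for q using that by (simp add: W_def)
  have "\<exists>a. h q = (\<Sum>i<r. a i *\<^sub>R X i q)" if "q \<in> W" for q
  proof -
    note fr = frame[OF frameW[OF that]]
    have "h q \<in> span ((\<lambda>i. X i q) ` {..<r})" using h fr by blast
    then obtain a where "h q = (\<Sum>x\<in>(\<lambda>i. X i q) ` {..<r}. a x *\<^sub>R x)"
      using span_finite[of "(\<lambda>i. X i q) ` {..<r}"] by auto
    then have "h q = (\<Sum>i<r. a (X i q) *\<^sub>R X i q)" using fr by (simp add: sum.reindex)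
    then show ?thesis by (rule exI[of _ "\<lambda>i. a (X i q)"])
  qed
  then obtain a where a: "\<And>q. q \<in> W \<Longrightarrow> h q = (\<Sum>i<r. a q i *\<^sub>R X i q)" by metis
  have sol: "dd q (dp q (h q)) = (\<Sum>i<r. a q i *\<^sub>R dd q (dp q (X i q)))" if "q \<in> W" for q
    by (simp add: a[OF that] linear_sum[OF linear_dp] linear_scale[OF linear_dp]
        linear_sum[OF dd(1)[OF that]] linear_scale[OF dd(1)[OF that]])
  \<comment> \<open>The system is regular because \<open>dp q\<close> is injective on
    \<open>H q\<close> and \<open>dd q\<close> is bijective.\<close>
  have indep: "\<forall>i<r. k i = 0" if q: "q \<in> W" and 0: "(\<Sum>i<r. k i *\<^sub>R dd q (dp q (X i q))) = 0" for q k
  proof -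
    note fr = frame[OF frameW[OF q]]
    let ?s = "\<Sum>i<r. k i *\<^sub>R X i q"
    have "dd q (dp q ?s) = dd q 0"
      using 0 by (simp add: linear_sum[OF linear_dp] linear_scale[OF linear_dp]
        linear_sum[OF dd(1)[OF q]] linear_scale[OF dd(1)[OF q]] linear_0[OF dd(1)[OF q]])
    then have "dp q ?s = dp q 0"
      using bij_is_inj[OF dd(2)[OF q]] by (simp add: inj_eq linear_0[OF linear_dp])
    moreover have "?s \<in> H q"
    proof -
      have "?s \<in> span ((\<lambda>i. X i q) ` {..<r})"
        by (intro span_sum span_scale span_base) blast
      then show ?thesis using fr by simp
    qed
    ultimately have s: "?s = 0" using horizontal_eqI[OF _ subspace_0[OF subspace_H]] by blast
    \<comment> \<open>The coefficients are indexed by numbers, while linear independence is a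
      property of sets of vectors; injectivity of the frame translates one into the other.\<close>
    let ?k = "\<lambda>x. k (the_inv_into {..<r} (\<lambda>i. X i q) x)"
    have kk: "?k (X i q) = k i" if "i < r" for i
      using the_inv_into_f_f[of "\<lambda>i. X i q" "{..<r}" i] fr that by simp
    have "(\<Sum>x\<in>(\<lambda>i. X i q) ` {..<r}. ?k x *\<^sub>R x) = ?s"
      using fr by (simp add: sum.reindex kk)
    then have "?k x = 0" if "x \<in> (\<lambda>i. X i q) ` {..<r}" for x
      using independentD[of "(\<lambda>i. X i q) ` {..<r}" "(\<lambda>i. X i q) ` {..<r}" ?k x] fr that s by simp
    then show ?thesis using kk by force
  qed
  have aW: "smooth_fn AF W (\<lambda>q. a q i)" if i: "i < r" for i
  proof (rule F.smooth_fn_chartI[OF c(1) W(1,3)])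
    let ?inv = "chart_inv ?c"
    have S: "open (snd ?c ` W)" using F.open_chart_image[OF c(1) W(1)] W(3) by (simp add: Int_absorb2)
    have inv: "?inv x \<in> W" if "x \<in> snd ?c ` W" for x
      using that F.chart_inv_chart[OF c(1)] W(3) by auto
    show "smooth_on (snd ?c ` W) (\<lambda>x. a (?inv x) i)"
    proof (rule smooth_on_solve[OF S _ _ _ _ i])
      show "smooth_on (snd ?c ` W) (\<lambda>x. dd (?inv x) (dp (?inv x) (X j (?inv x))))" if "j < r" for j
        by (rule F.smooth_fn_chartD[OF m[OF that] c(1) W(3)])
      show "smooth_on (snd ?c ` W) (\<lambda>x. dd (?inv x) (dp (?inv x) (h (?inv x))))"
        by (rule F.smooth_fn_chartD[OF uW c(1) W(3)])
    qed (use inv sol indep in blast)+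
  qed
  have "smooth_vf_on AF W (\<lambda>q. \<Sum>i<r. a q i *\<^sub>R X i q)"
    by (intro F.smooth_vf_on_sum W F.smooth_vf_on_scaleR aW F.smooth_vf_on_subset[OF X])
      (auto simp: W_def)
  then have "smooth_vf_on AF W h" by (rule F.smooth_vf_on_cong[OF W(1), rotated]) (simp add: a)
  then show "\<exists>W. open W \<and> p \<in> W \<and> smooth_vf_on AF W h" using W by blast
qed

lemma smooth_hor_lift: assumes K: "smooth_vf AM K" shows "smooth_vf AF (hor_lift AF AM \<pi> H K)"
proof (rule smooth_horizontal)
  fix d assume d: "d \<in> AM"
  have "smooth_fn AM (fst d) (\<lambda>x. mderiv AM (snd d) x (K x))"
    using M.smooth_vf_onD[OF K d open_UNIV] by simp
  then show "smooth_fn AF (\<pi> -` fst d) (\<lambda>q. mderiv AM (snd d) (\<pi> q) (dp q (hor_lift AF AM \<pi> H K q)))"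
    unfolding hor_lift(2)
    by (rule FM.smooth_fn_pullback[OF smooth_map_on_subset[OF smooth_projection subset_UNIV]
          open_preimage[OF M.open_chart[OF d]] M.open_chart[OF d], rotated]) simp
qed (rule hor_lift)

text \<open>The horizontal part is smooth by \<open>smooth_horizontal\<close>, as it has the same
  image under \<open>dp\<close> as \<open>Y\<close>; the vertical part is the remainder.\<close>

lemma smooth_proj:
  assumes Y: "smooth_vf AF Y"
  shows "smooth_vf AF (\<lambda>q. proj q (Y q))"
proof -
  have "smooth_vf AF (\<lambda>q. Y q - proj q (Y q))"
  proof (rule smooth_horizontal)
    fix d assume d: "d \<in> AM"
    show "smooth_fn AF (\<pi> -` fst d) (\<lambda>q. mderiv AM (snd d) (\<pi> q) (dp q (Y q - proj q (Y q))))"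
      using FM.smooth_fn_mdiff[OF smooth_projection open_UNIV Y d]
      by (simp add: linear_diff[OF linear_dp] dp_proj)
  qed (rule proj)
  from F.smooth_vf_on_diff[OF open_UNIV Y this] show ?thesis by simp
qed

lemma section_V: "section_of AF V Y \<longleftrightarrow> smooth_vf AF Y \<and> (\<forall>q. dp q (Y q) = 0)"
  by (simp add: section_of_def V_iff)

lemma section_proj: "smooth_vf AF Y \<Longrightarrow> section_of AF V (\<lambda>q. proj q (Y q))"
  by (simp add: section_V smooth_proj dp_proj)

lemma section_hor: "smooth_vf AF Y \<Longrightarrow> section_of AF H (\<lambda>q. Y q - proj q (Y q))"
  by (simp add: section_of_def proj F.smooth_vf_on_diff smooth_proj)

lemma section_hor_lift: "smooth_vf AM K \<Longrightarrow> section_of AF H (hor_lift AF AM \<pi> H K)"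
  by (simp add: section_of_def hor_lift smooth_hor_lift)

lemma section_through: assumes "w \<in> V p" shows "\<exists>Y. section_of AF V Y \<and> Y p = w"
proof -
  obtain Y where "smooth_vf AF Y" "Y p = w" by (rule F.vf_through)
  then show ?thesis using section_proj[of Y] proj_V[OF assms] by fastforce
qed

lemma decompose:
  obtains W K where "section_of AF V W" "smooth_vf AM K" "u = W p + hor_lift AF AM \<pi> H K p"
proof -
  obtain W where W: "section_of AF V W" "W p = proj p u" using section_through proj(1) by blast
  obtain K where K: "smooth_vf AM K" "K (\<pi> p) = dp p u" by (rule M.vf_through)
  have "hor_lift AF AM \<pi> H K p = u - proj p u"
    by (rule horizontal_eqI[of _ p]) (simp_all add: hor_lift proj K linear_diff[OF linear_dp] dp_proj)
  then have "u = W p + hor_lift AF AM \<pi> H K p" using W by simp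
  then show ?thesis using that W K by blast
qed

text \<open>By \<open>tensorial\<close> only the value at \<open>p\<close> counts, and by
  \<open>decompose\<close> vertical sections and lifts account for all values. These are exactly the
  fields on which the conditions for \<open>DV\<close> and \<open>DH\<close> can be
  evaluated.\<close>

lemma tensor_zero:
  fixes \<Phi> :: "('a \<Rightarrow> 'e) \<Rightarrow> 'f::real_vector"
  assumes "\<And>X Y. smooth_vf AF X \<Longrightarrow> smooth_vf AF Y \<Longrightarrow> \<Phi> (\<lambda>q. X q + Y q) = \<Phi> X + \<Phi> Y"
    and "\<And>f X. smooth_fn AF UNIV f \<Longrightarrow> smooth_vf AF X \<Longrightarrow> \<Phi> (\<lambda>q. f q *\<^sub>R X q) = f p *\<^sub>R \<Phi> X"
    and W: "\<And>W. section_of AF V W \<Longrightarrow> \<Phi> W = 0"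
    and K: "\<And>K. smooth_vf AM K \<Longrightarrow> \<Phi> (hor_lift AF AM \<pi> H K) = 0"
    and Y: "smooth_vf AF Y"
  shows "\<Phi> Y = 0"
proof -
  obtain L where L: "linear L" "\<And>X. smooth_vf AF X \<Longrightarrow> \<Phi> X = L (X p)"
    using F.tensorial[of \<Phi> p, OF assms(1,2)] by blast
  obtain W' K' where d: "section_of AF V W'" "smooth_vf AM K'" "Y p = W' p + hor_lift AF AM \<pi> H K' p"
    by (rule decompose)
  have "L (W' p) = 0" using W[OF d(1)] L(2)[of W'] d(1) by (simp add: section_of_def)
  moreover have "L (hor_lift AF AM \<pi> H K' p) = 0"
    using K[OF d(2)] L(2)[OF smooth_hor_lift[OF d(2)]] by simp
  ultimately show ?thesis using L Y d(3) by (simp add: linear_add)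
qed

end

section \<open>The Levi-Civita connections of the scaled metrics\<close>

text \<open>Inner products are constrained only on the subspace \<open>S\<close>. Composing with a
  linear map into \<open>S\<close>, such as the vertical projection or \<open>dp\<close>, gives
  symmetric bilinear functions on the whole tangent space, possibly degenerate.\<close>

lemma
  assumes b: "inner_product_on S b" and S: "subspace S" and f: "linear f" "\<And>u. f u \<in> S"
  shows inner_product_on_sym: "b (f u) (f w) = b (f w) (f u)"
    and inner_product_on_linear: "linear (\<lambda>u. b (f u) (f w))"
    and inner_product_on_nonneg: "b (f u) (f u) \<ge> 0"
    and inner_product_on_eq_0: "b (f u) (f u) = 0 \<Longrightarrow> f u = 0"
proof -
  show "b (f u) (f w) = b (f w) (f u)" using b f(2) by (simp add: inner_product_on_def)
  show lin: "linear (\<lambda>u. b (f u) (f w))" for w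
    by (rule linearI) (use b f in \<open>simp_all add: inner_product_on_def linear_add linear_scale\<close>)
  have 0: "b 0 (f u) = 0" for u
    using linear_0[OF lin[of u]] by (simp add: linear_0[OF f(1)])
  have pos: "f u \<noteq> 0 \<Longrightarrow> b (f u) (f u) > 0" for u using b f(2) by (simp add: inner_product_on_def)
  show "b (f u) (f u) \<ge> 0" using pos[of u] 0[of u] by (cases "f u = 0") auto
  show "b (f u) (f u) = 0 \<Longrightarrow> f u = 0" using pos[of u] by auto
qed

lemma connection_on_zero:
  assumes D: "connection_on A S D" and "section_of A S (\<lambda>_. 0)" and "smooth_fn A UNIV (\<lambda>_. 0::real)"
  shows "D (\<lambda>_. 0) p v = 0"
  using connection_on_scaleR[OF assms, of p v] by (simp add: connection_on_def)

locale scaled_fibration = horizontal_fibration AF AM AC \<pi> H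
  for AF :: "('a::{t2_space,second_countable_topology}, 'e::real_inner) chart set"
    and AM :: "('b::{t2_space,second_countable_topology}, 'm::real_inner) chart set"
    and AC :: "('c::{t2_space,second_countable_topology}, 'k::real_inner) chart set"
    and \<pi> H +
  fixes g :: "'a \<Rightarrow> 'e \<Rightarrow> 'e \<Rightarrow> real" and gM :: "'b \<Rightarrow> 'm \<Rightarrow> 'm \<Rightarrow> real"
    and DM :: "('b, 'm) cov_deriv" and DV DH :: "('a, 'e) cov_deriv"
    and Dr :: "real \<Rightarrow> ('a, 'e) cov_deriv"
  assumes gM: "bundle_metric AM (\<lambda>_. UNIV) gM" and g: "bundle_metric AF (vertical AF AM \<pi>) g"
    and DM: "levi_civita AM gM DM"
    and Dr: "\<And>r. r \<ge> 1 \<Longrightarrow> levi_civita AF (scaled_metric AF AM \<pi> H g gM r) (Dr r)"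
    and DV: "vertical_connection AF AM AC \<pi> H g DV"
    and DH: "horizontal_connection AF AM \<pi> H DM DH"
begin

text \<open>\<open>gV\<close> has kernel \<open>H\<close> and \<open>gH\<close> has kernel
  \<open>V\<close>; in the scaled metric \<open>gV + r * gH\<close> the parameter sits in front of
  the second alone.\<close>

definition "gV p u w = g p (proj p u) (proj p w)"
definition "gH p u w = gM (\<pi> p) (dp p u) (dp p w)"
abbreviation "g_scaled \<equiv> scaled_metric AF AM \<pi> H g gM"
abbreviation "Dsum \<equiv> sum_connection V H DV DH"
abbreviation "lift \<equiv> hor_lift AF AM \<pi> H"

lemma g_scaled: "g_scaled r p u w = gV p u w + r * gH p u w"
  by (simp add: scaled_metric_def gV_def gH_def)

lemma inner_g: "inner_product_on (V p) (g p)" and inner_gM: "inner_product_on UNIV (gM x)"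
  using g gM by (simp_all add: bundle_metric_def)

lemmas gV_sym = inner_product_on_sym[OF inner_g subspace_V linear_proj proj(1), folded gV_def]
  and linear_gV = inner_product_on_linear[OF inner_g subspace_V linear_proj proj(1), folded gV_def]
  and gV_nonneg = inner_product_on_nonneg[OF inner_g subspace_V linear_proj proj(1), folded gV_def]
  and gV_eq_0 = inner_product_on_eq_0[OF inner_g subspace_V linear_proj proj(1), folded gV_def]

lemma gH_sym: "gH p u w = gH p w u"
  and linear_gH: "linear (\<lambda>u. gH p u w)"
  and gH_nonneg: "gH p u u \<ge> 0"
  and gH_eq_0: "gH p u u = 0 \<Longrightarrow> dp p u = 0"
  unfolding gH_def
  by (rule inner_product_on_sym[OF inner_gM subspace_UNIV linear_dp UNIV_I]
      inner_product_on_linear[OF inner_gM subspace_UNIV linear_dp UNIV_I]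
      inner_product_on_nonneg[OF inner_gM subspace_UNIV linear_dp UNIV_I])+
    (rule inner_product_on_eq_0[OF inner_gM subspace_UNIV linear_dp UNIV_I])

lemma gH_vertical: "dp p w = 0 \<Longrightarrow> gH p w z = 0"
  using linear_0[OF linear_gH[of p z]] by (simp add: gH_def linear_0[OF linear_dp])

lemma gV_horizontal: "h \<in> H p \<Longrightarrow> gV p h z = 0"
  using linear_0[OF linear_gV[of p z]] by (simp add: gV_def proj_H linear_0[OF linear_proj])

lemma linear_g_scaled: "linear (\<lambda>u. g_scaled r p u w)"
  unfolding g_scaled
  using linear_compose_add[OF linear_gV linear_compose_scale_right[OF linear_gH], of p w r p w] by simp

lemma g_scaled_eq_0:
  assumes "r \<ge> 1" "g_scaled r p u u = 0" shows "u = 0"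
proof -
  have "gV p u u = 0 \<and> r * gH p u u = 0"
    using assms gV_nonneg[of p u] gH_nonneg[of p u]
    by (simp add: g_scaled add_nonneg_eq_0_iff)
  then have "proj p u = 0" "dp p u = 0" using assms gV_eq_0[of p u] gH_eq_0[of p u] by auto
  then show ?thesis
    using horizontal_eqI[OF _ subspace_0[OF subspace_H], of u p] proj(2)[of u p] linear_0[OF linear_dp] by simp
qed

lemma inner_g_scaled: assumes "r \<ge> 1" shows "inner_product_on UNIV (g_scaled r p)"
  unfolding inner_product_on_def
proof (intro conjI ballI allI impI)
  show "g_scaled r p u w = g_scaled r p w u" for u w by (simp add: g_scaled gV_sym[of p u] gH_sym[of p u])
  show "g_scaled r p u u > 0" if "u \<noteq> 0" for u
  proof -
    have "g_scaled r p u u \<ge> 0" using assms gV_nonneg gH_nonneg by (simp add: g_scaled)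
    then show ?thesis using g_scaled_eq_0[OF assms, of p u] that by force
  qed
qed (use linear_add[OF linear_g_scaled] linear_scale[OF linear_g_scaled] in auto)

lemma smooth_gV:
  assumes "smooth_vf AF Y" "smooth_vf AF Z"
  shows "smooth_fn AF UNIV (\<lambda>q. gV q (Y q) (Z q))"
  using g section_proj[OF assms(1)] section_proj[OF assms(2)]
  unfolding bundle_metric_def smooth_fun_iff gV_def by blast

text \<open>Near \<open>\<pi> p\<close> the metric of the base has smooth components with respect to the fields \<open>E b\<close>;
  these are global multiples, by a bump function, of the coordinate fields.\<close>

lemma smooth_gH:
  assumes Y: "smooth_vf AF Y" and Z: "smooth_vf AF Z"
  shows "smooth_fn AF UNIV (\<lambda>q. gH q (Y q) (Z q))"
proof (rule F.smooth_fn_local)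
  fix p
  let ?d = "chart_at AM (\<pi> p)"
  note d = M.chart_at[of "\<pi> p"]
  obtain \<rho> K where \<rho>: "smooth_fn AM UNIV \<rho>" "\<rho> (\<pi> p) = (1::real)" "closed K" "K \<subseteq> fst ?d"
      "\<And>q. q \<notin> K \<Longrightarrow> \<rho> q = 0"
    using M.bump[OF M.open_chart[OF d(1)] d(2)] by blast
  define E where "E b x = \<rho> x *\<^sub>R coord_field AM ?d b x" for b x
  have E: "smooth_vf AM (E b)" for b
    unfolding E_def
    by (rule M.smooth_vf_cutoff[OF M.open_chart[OF d(1)] \<rho>(1,3,4,5) M.smooth_vf_coord_field[OF d(1)]])
  have G: "smooth_fn AF UNIV (\<lambda>q. gM (\<pi> q) (E b (\<pi> q)) (E c (\<pi> q)))" for b c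
  proof (rule FM.smooth_fn_pullback[OF smooth_projection open_UNIV open_UNIV])
    show "smooth_fn AM UNIV (\<lambda>x. gM x (E b x) (E c x))"
      using gM E unfolding bundle_metric_def smooth_fun_iff section_of_UNIV by blast
  qed simp
  have R: "smooth_fn AF UNIV (\<lambda>q. \<rho> (\<pi> q))"
    by (rule FM.smooth_fn_pullback[OF smooth_projection open_UNIV open_UNIV _ \<rho>(1)]) simp
  \<comment> \<open>Where \<open>\<rho>\<close> is nonzero, dividing by its square recovers the
    pairings of the coordinate fields from those of the global fields \<open>E b\<close>.\<close>
  define W where "W = \<pi> -` fst ?d \<inter> (\<lambda>q. \<rho> (\<pi> q)) -` (- {0})"
  have "open ((\<lambda>q. \<rho> (\<pi> q)) -` (- {0}))"
    by (rule open_vimage[OF _ F.smooth_fn_continuous[OF R open_UNIV]]) auto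
  then have W: "open W" "p \<in> W"
    using open_preimage[OF M.open_chart[OF d(1)]] d(2) \<rho>(2) by (auto simp: W_def)
  define y where "y X q = mderiv AM (snd ?d) (\<pi> q) (dp q (X q))" for X q
  have y: "smooth_fn AF W (y X)" if "smooth_vf AF X" for X
    unfolding y_def
    by (rule smooth_fn_subset[OF FM.smooth_fn_mdiff[OF smooth_projection open_UNIV that d(1)]])
      (auto simp: W_def)
  have "smooth_fn AF W (\<lambda>q. \<Sum>b\<in>onb. \<Sum>c\<in>onb. ((y Y q \<bullet> b) * (y Z q \<bullet> c)) *
      (gM (\<pi> q) (E b (\<pi> q)) (E c (\<pi> q)) * inverse (\<rho> (\<pi> q) * \<rho> (\<pi> q))))"
    by (intro F.smooth_fn_sum F.smooth_fn_mult F.smooth_fn_inner F.smooth_fn_inverse W F.smooth_fn_const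
        y Y Z smooth_fn_subset[OF G subset_UNIV] smooth_fn_subset[OF R subset_UNIV]) (auto simp: W_def)
  then have "smooth_fn AF W (\<lambda>q. gH q (Y q) (Z q))"
  proof (rule F.smooth_fn_cong[OF W(1), rotated])
    fix q assume q: "q \<in> W"
    then have x: "\<pi> q \<in> fst ?d" "\<rho> (\<pi> q) \<noteq> 0" by (auto simp: W_def)
    let ?x = "\<pi> q" and ?C = "\<lambda>b. coord_field AM ?d b (\<pi> q)"
    have lin1: "linear (\<lambda>u. gM ?x u w)" for w
      by (rule inner_product_on_linear[OF inner_gM subspace_UNIV linear_ident UNIV_I])
    have sym: "gM ?x u w = gM ?x w u" for u w
      by (rule inner_product_on_sym[OF inner_gM subspace_UNIV linear_ident UNIV_I])
    have lin2: "linear (\<lambda>u. gM ?x w u)" for w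
      using lin1[of w] by (subst sym)
    have ex: "dp q (X q) = (\<Sum>b\<in>onb. (y X q \<bullet> b) *\<^sub>R ?C b)" for X
      unfolding y_def by (rule M.coord_field_expand[OF d(1) x(1)])
    have Y': "gM ?x (dp q (Y q)) w = (\<Sum>b\<in>onb. (y Y q \<bullet> b) * gM ?x (?C b) w)" for w
      by (subst ex) (simp add: linear_sum[OF lin1] linear_scale[OF lin1])
    have Z': "gM ?x w (dp q (Z q)) = (\<Sum>c\<in>onb. (y Z q \<bullet> c) * gM ?x w (?C c))" for w
      by (subst ex) (simp add: linear_sum[OF lin2] linear_scale[OF lin2])
    have "gH q (Y q) (Z q) = (\<Sum>b\<in>onb. (y Y q \<bullet> b) * gM ?x (?C b) (dp q (Z q)))"
      unfolding gH_def by (rule Y')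
    also have "\<dots> = (\<Sum>b\<in>onb. \<Sum>c\<in>onb. ((y Y q \<bullet> b) * (y Z q \<bullet> c)) * gM ?x (?C b) (?C c))"
      unfolding Z' by (simp add: sum_distrib_left mult.assoc)
    finally have "gH q (Y q) (Z q)
        = (\<Sum>b\<in>onb. \<Sum>c\<in>onb. ((y Y q \<bullet> b) * (y Z q \<bullet> c)) * gM ?x (?C b) (?C c))" .
    moreover have "gM ?x (?C b) (?C c) = gM ?x (E b ?x) (E c ?x) * inverse (\<rho> ?x * \<rho> ?x)" for b c
      using x(2) by (simp add: E_def linear_scale[OF lin1] linear_scale[OF lin2] field_simps)
    ultimately show "(\<Sum>b\<in>onb. \<Sum>c\<in>onb. ((y Y q \<bullet> b) * (y Z q \<bullet> c)) *
        (gM ?x (E b ?x) (E c ?x) * inverse (\<rho> ?x * \<rho> ?x))) = gH q (Y q) (Z q)"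
      by simp
  qed
  then show "\<exists>W. open W \<and> p \<in> W \<and> smooth_fn AF W (\<lambda>q. gH q (Y q) (Z q))" using W by blast
qed

section \<open>The direct sum connection and the horizontal part of the metric\<close>

lemma conn_DV: "connection_on AF V DV" and conn_DH: "connection_on AF H DH"
  using DV DH by (simp_all add: vertical_connection_def horizontal_connection_def)

lemma sections_zero: "section_of AF V (\<lambda>_. 0)" "section_of AF H (\<lambda>_. 0)"
  by (simp_all add: section_of_def F.smooth_vf_on_zero subspace_0 subspace_V subspace_H)

lemma Dsum_vertical: assumes "section_of AF V Y" shows "Dsum Y p v = DV Y p v"
proof -
  have "proj q (Y q) = Y q" for q using assms proj_V by (simp add: section_of_def)
  then show ?thesis
    by (simp add: sum_connection_def connection_on_zero[OF conn_DH sections_zero(2) F.smooth_fn_const])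
qed

lemma Dsum_horizontal: assumes "section_of AF H Y" shows "Dsum Y p v = DH Y p v"
proof -
  have "proj q (Y q) = 0" for q using assms proj_H by (simp add: section_of_def)
  then show ?thesis
    by (simp add: sum_connection_def connection_on_zero[OF conn_DV sections_zero(1) F.smooth_fn_const])
qed

lemma Dsum_in_V: "section_of AF V Y \<Longrightarrow> Dsum Y p v \<in> V p"
  using Dsum_vertical connection_on_in[OF conn_DV] by simp

lemma dp_Dsum_lift: "smooth_vf AM K \<Longrightarrow> dp p (Dsum (lift K) p v) = DM K (\<pi> p) (dp p v)"
  using DH by (simp add: Dsum_horizontal section_hor_lift horizontal_connection_def)

lemma connection_Dsum: "connection AF Dsum"
proof (rule connectionI)
  show "linear (Dsum Y p)" if Y: "smooth_vf AF Y" for Y p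
    unfolding sum_connection_def[abs_def]
    by (intro linear_compose_add connection_on_linear[OF conn_DV section_proj[OF Y]]
        connection_on_linear[OF conn_DH section_hor[OF Y]])
  show "smooth_vf AF (\<lambda>p. Dsum Y p (X p))" if X: "smooth_vf AF X" and Y: "smooth_vf AF Y" for X Y
    unfolding sum_connection_def
    by (intro F.smooth_vf_on_add open_UNIV connection_on_smooth[OF conn_DV section_proj[OF Y] X]
        connection_on_smooth[OF conn_DH section_hor[OF Y] X])
  show "Dsum (\<lambda>q. Y q + Z q) p v = Dsum Y p v + Dsum Z p v" if Y: "smooth_vf AF Y" and Z: "smooth_vf AF Z"
    for Y Z p v
    using connection_on_add[OF conn_DV section_proj[OF Y] section_proj[OF Z], of p v]
      connection_on_add[OF conn_DH section_hor[OF Y] section_hor[OF Z], of p v]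
    by (simp add: sum_connection_def linear_add[OF linear_proj] add_diff_add)
  show "Dsum (\<lambda>q. f q *\<^sub>R Y q) p v = mderiv AF f p v *\<^sub>R Y p + f p *\<^sub>R Dsum Y p v"
    if f: "smooth_fn AF UNIV f" and Y: "smooth_vf AF Y" for f Y p v
    using connection_on_scaleR[OF conn_DV section_proj[OF Y] f, of p v]
      connection_on_scaleR[OF conn_DH section_hor[OF Y] f, of p v]
    by (simp add: sum_connection_def linear_scale[OF linear_proj] scaleR_diff_right[symmetric])
      (simp add: algebra_simps)
qed

lemma bundle_LC: "connection AM DM"
  using DM by (simp add: levi_civita_def)

text \<open>This defect and \<open>torsion_defect\<close> are tensorial, so they need only be evaluated on vertical
  sections and on horizontal lifts, where they vanish.\<close>

definition "metric_defect Y Z p v = mderiv AF (\<lambda>q. gH q (Y q) (Z q)) p v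
    - gH p (Dsum Y p v) (Z p) - gH p (Y p) (Dsum Z p v)"

lemma metric_defect_sym: "metric_defect Y Z p v = metric_defect Z Y p v"
proof -
  have "(\<lambda>q. gH q (Y q) (Z q)) = (\<lambda>q. gH q (Z q) (Y q))" by (rule ext) (rule gH_sym)
  then show ?thesis
    by (simp add: metric_defect_def gH_sym[of p "Dsum Y p v"] gH_sym[of p "Y p"])
qed

lemma metric_defect_tensor:
  assumes Z: "smooth_vf AF Z"
    and W: "\<And>W. section_of AF V W \<Longrightarrow> metric_defect W Z p v = 0"
    and K: "\<And>K. smooth_vf AM K \<Longrightarrow> metric_defect (lift K) Z p v = 0"
    and Y: "smooth_vf AF Y"
  shows "metric_defect Y Z p v = 0"
proof (rule tensor_zero[of "\<lambda>Y. metric_defect Y Z p v" p, OF _ _ W K Y])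
  fix X Y assume X: "smooth_vf AF X" and Y: "smooth_vf AF Y"
  show "metric_defect (\<lambda>q. X q + Y q) Z p v = metric_defect X Z p v + metric_defect Y Z p v"
    by (simp add: metric_defect_def linear_add[OF linear_gH] connection_add[OF connection_Dsum X Y]
        F.mderiv_add[OF open_UNIV UNIV_I smooth_gH[OF X Z] smooth_gH[OF Y Z]])
next
  fix f :: "'a \<Rightarrow> real" and X assume f: "smooth_fn AF UNIV f" and X: "smooth_vf AF X"
  show "metric_defect (\<lambda>q. f q *\<^sub>R X q) Z p v = f p *\<^sub>R metric_defect X Z p v"
    by (simp add: metric_defect_def linear_add[OF linear_gH] linear_scale[OF linear_gH]
        connection_scaleR[OF connection_Dsum X f] F.mderiv_mult[OF open_UNIV UNIV_I f smooth_gH[OF X Z]]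
        algebra_simps)
qed

text \<open>Both \<open>W\<close> and its covariant derivatives lie in \<open>V\<close>, the kernel
  of \<open>gH\<close>, so all three terms vanish whatever \<open>Z\<close> is.\<close>

lemma metric_defect_vertical:
  assumes W: "section_of AF V W"
  shows "metric_defect W Z p v = 0"
proof -
  have "gH q (W q) z = 0" for q z using W by (intro gH_vertical) (simp add: section_V)
  moreover have "gH p (Dsum W p v) z = 0" for z
    using Dsum_in_V[OF W] by (intro gH_vertical) (simp add: V_iff)
  ultimately show ?thesis by (simp add: metric_defect_def F.mderiv_const)
qed

text \<open>On lifts everything is pulled back from the base, where the identity is the
  compatibility of \<open>DM\<close> with \<open>gM\<close>.\<close>

lemma metric_defect_lifts:
  assumes K: "smooth_vf AM K" and K': "smooth_vf AM K'"
  shows "metric_defect (lift K) (lift K') p v = 0"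
proof -
  obtain X where X: "smooth_vf AM X" "X (\<pi> p) = dp p v" by (rule M.vf_through)
  have sm: "smooth_fn AM UNIV (\<lambda>x. gM x (K x) (K' x))"
    using gM K K' unfolding bundle_metric_def smooth_fun_iff section_of_UNIV by blast
  have "mderiv AF (\<lambda>q. gM (\<pi> q) (K (\<pi> q)) (K' (\<pi> q))) p v = mderiv AM (\<lambda>x. gM x (K x) (K' x)) (\<pi> p) (X (\<pi> p))"
    using FM.mderiv_pullback[OF smooth_projection open_UNIV UNIV_I open_UNIV UNIV_I sm, of p v] X by simp
  also have "\<dots> = gM (\<pi> p) (DM K (\<pi> p) (X (\<pi> p))) (K' (\<pi> p)) + gM (\<pi> p) (K (\<pi> p)) (DM K' (\<pi> p) (X (\<pi> p)))"
    using DM X K K' unfolding levi_civita_def by blast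
  finally show ?thesis
    by (simp add: metric_defect_def gH_def hor_lift dp_Dsum_lift K K' X)
qed

text \<open>One argument is freed at a time: first the partner of a fixed lift becomes arbitrary,
  then, after exchanging the arguments by symmetry, the lift does too.\<close>

lemma metric_gH:
  assumes Y: "smooth_vf AF Y" and Z: "smooth_vf AF Z"
  shows "mderiv AF (\<lambda>q. gH q (Y q) (Z q)) p v = gH p (Dsum Y p v) (Z p) + gH p (Y p) (Dsum Z p v)"
proof -
  have "metric_defect (lift K) Z p v = 0" if K: "smooth_vf AM K" for K
  proof -
    have "metric_defect Z (lift K) p v = 0"
      by (rule metric_defect_tensor[OF smooth_hor_lift[OF K] metric_defect_vertical metric_defect_lifts[OF _ K] Z])
    then show ?thesis using metric_defect_sym by metis
  qed
  from metric_defect_tensor[OF Z metric_defect_vertical this Y]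
  show ?thesis by (simp add: metric_defect_def)
qed

definition "torsion_defect X Y p = dp p (Dsum Y p (X p)) - dp p (Dsum X p (Y p)) - dp p (lie_bracket AF X Y p)"

lemma torsion_defect_swap: "torsion_defect X Y p = - torsion_defect Y X p"
  using linear_neg[OF linear_dp] by (simp add: torsion_defect_def F.lie_bracket_swap[of X Y])

lemma torsion_defect_tensor:
  assumes Y: "smooth_vf AF Y"
    and W: "\<And>W. section_of AF V W \<Longrightarrow> torsion_defect W Y p = 0"
    and K: "\<And>K. smooth_vf AM K \<Longrightarrow> torsion_defect (lift K) Y p = 0"
    and X: "smooth_vf AF X"
  shows "torsion_defect X Y p = 0"
proof (rule tensor_zero[of "\<lambda>X. torsion_defect X Y p" p, OF _ _ W K X])
  note lin = connection_linear[OF connection_Dsum Y]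
  fix X X' assume X: "smooth_vf AF X" "smooth_vf AF X'"
  show "torsion_defect (\<lambda>q. X q + X' q) Y p = torsion_defect X Y p + torsion_defect X' Y p"
    by (simp add: torsion_defect_def linear_add[OF lin] linear_add[OF linear_dp]
        connection_add[OF connection_Dsum X] F.lie_bracket_add_left[OF X(1) Y X(2)])
next
  note lin = connection_linear[OF connection_Dsum Y]
  fix f :: "'a \<Rightarrow> real" and X assume f: "smooth_fn AF UNIV f" and X: "smooth_vf AF X"
  show "torsion_defect (\<lambda>q. f q *\<^sub>R X q) Y p = f p *\<^sub>R torsion_defect X Y p"
    by (simp add: torsion_defect_def linear_add[OF linear_dp] linear_diff[OF linear_dp]
        linear_scale[OF lin] linear_scale[OF linear_dp]
        connection_scaleR[OF connection_Dsum X f] F.lie_bracket_scaleR_left[OF X Y f] algebra_simps)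
qed

lemma dp_lie_bracket:
  assumes "smooth_vf AF X" "smooth_vf AM X'" "\<And>q. dp q (X q) = X' (\<pi> q)"
    and "smooth_vf AF Y" "smooth_vf AM Y'" "\<And>q. dp q (Y q) = Y' (\<pi> q)"
  shows "dp p (lie_bracket AF X Y p) = lie_bracket AM X' Y' (\<pi> p)"
  by (rule FM.mdiff_lie_bracket[OF smooth_projection open_UNIV UNIV_I assms])

lemma lie_bracket_zero: "smooth_vf AM K \<Longrightarrow> lie_bracket AM (\<lambda>_. 0) K x = 0"
  using M.lie_bracket_scaleR_left[of K K "\<lambda>_. 0" x] by (simp add: M.smooth_fn_const M.mderiv_const)

text \<open>A vertical field is related by \<open>\<pi>\<close> to the zero field, so its bracket
  with a field that projects to the base is related to a bracket with zero.\<close>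

lemma lie_bracket_vertical:
  assumes W: "section_of AF V W" and Y: "smooth_vf AF Y" "smooth_vf AM Y'" "\<And>q. dp q (Y q) = Y' (\<pi> q)"
  shows "dp p (lie_bracket AF W Y p) = 0" "dp p (lie_bracket AF Y W p) = 0"
proof -
  show 1: "dp p (lie_bracket AF W Y p) = 0"
    using dp_lie_bracket[of W "\<lambda>_. 0" Y Y' p] W Y by (simp add: section_V M.smooth_vf_on_zero lie_bracket_zero)
  then show "dp p (lie_bracket AF Y W p) = 0"
    by (simp add: F.lie_bracket_swap[of Y W] linear_neg[OF linear_dp])
qed

text \<open>Three cases of test fields. For two vertical fields, derivatives and bracket are
  vertical. For a vertical field and a lift, the lift is covariantly constant along the fibres,
  being pulled back, and the bracket is again vertical. For two lifts, the claim is that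
  \<open>DM\<close> has no torsion.\<close>

lemma torsion_gH:
  assumes X: "smooth_vf AF X" and Y: "smooth_vf AF Y"
  shows "dp p (Dsum Y p (X p)) - dp p (Dsum X p (Y p)) = dp p (lie_bracket AF X Y p)"
proof -
  have VV: "torsion_defect W W' p = 0" if W: "section_of AF V W" and W': "section_of AF V W'" for W W'
    using Dsum_in_V[OF W] Dsum_in_V[OF W'] lie_bracket_vertical(1)[OF W, of W' "\<lambda>_. 0"] W'
    by (simp add: torsion_defect_def V_iff section_V M.smooth_vf_on_zero)
  have VL: "torsion_defect W (lift K) p = 0" if W: "section_of AF V W" and K: "smooth_vf AM K" for W K
  proof -
    have "dp p (W p) = 0" using W by (simp add: section_V)
    then have "dp p (Dsum (lift K) p (W p)) = 0"
      by (simp add: dp_Dsum_lift[OF K] linear_0[OF connection_linear[OF bundle_LC K]])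
    then show ?thesis
      using Dsum_in_V[OF W] lie_bracket_vertical(1)[OF W smooth_hor_lift[OF K] K hor_lift(2)]
      by (simp add: torsion_defect_def V_iff)
  qed
  have LL: "torsion_defect (lift K) (lift K') p = 0" if K: "smooth_vf AM K" and K': "smooth_vf AM K'" for K K'
  proof -
    have "DM K' (\<pi> p) (K (\<pi> p)) - DM K (\<pi> p) (K' (\<pi> p)) = lie_bracket AM K K' (\<pi> p)"
      using DM K K' unfolding levi_civita_def by blast
    then show ?thesis
      using dp_lie_bracket[OF smooth_hor_lift[OF K] K hor_lift(2) smooth_hor_lift[OF K'] K' hor_lift(2), of p]
      by (simp add: torsion_defect_def dp_Dsum_lift K K' hor_lift(2))
  qed
  have YV: "torsion_defect W Y p = 0" if W: "section_of AF V W" for W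
  proof -
    have "torsion_defect Y W p = 0"
    proof (rule torsion_defect_tensor[OF _ _ _ Y])
      show "smooth_vf AF W" using W by (simp add: section_of_def)
      show "torsion_defect W' W p = 0" if "section_of AF V W'" for W' by (rule VV[OF that W])
      show "torsion_defect (lift K) W p = 0" if "smooth_vf AM K" for K
        using torsion_defect_swap[of "lift K" W p] VL[OF W that] by simp
    qed
    then show ?thesis using torsion_defect_swap[of W Y p] by simp
  qed
  have YL: "torsion_defect (lift K) Y p = 0" if K: "smooth_vf AM K" for K
  proof -
    have "torsion_defect Y (lift K) p = 0"
      by (rule torsion_defect_tensor[OF smooth_hor_lift[OF K] VL[OF _ K] LL[OF _ K] Y])
    then show ?thesis using torsion_defect_swap[of "lift K" Y p] by simp
  qed
  have "torsion_defect X Y p = 0" by (rule torsion_defect_tensor[OF Y YV YL X])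
  then show ?thesis by (simp add: torsion_defect_def)
qed

lemma koszul_gH:
  assumes "smooth_vf AF X" "smooth_vf AF Y" "smooth_vf AF Z"
  shows "2 * gH p (Dsum Y p (X p)) (Z p) = koszul AF gH X Y Z p"
proof (rule koszul_formula[OF _ _ _ assms])
  show "gH p u w = gH p w u" for u w by (rule gH_sym)
  show "gH p (Dsum Y p (X p)) w - gH p (Dsum X p (Y p)) w = gH p (lie_bracket AF X Y p) w"
    if "smooth_vf AF X" "smooth_vf AF Y" for X Y w
  proof -
    have "linear (\<lambda>u. gM (\<pi> p) u (dp p w))"
      by (rule inner_product_on_linear[OF inner_gM subspace_UNIV linear_ident UNIV_I])
    from linear_diff[OF this] show ?thesis
      unfolding gH_def torsion_gH[OF that, symmetric] by metis
  qed
qed (rule metric_gH)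

section \<open>Dependence of the Levi-Civita connections on the parameter\<close>

lemma koszul_g_scaled:
  assumes X: "smooth_vf AF X" and Y: "smooth_vf AF Y" and Z: "smooth_vf AF Z"
  shows "koszul AF (g_scaled r) X Y Z p = koszul AF gV X Y Z p + r * koszul AF gH X Y Z p"
proof -
  have "mderiv AF (\<lambda>q. g_scaled r q (Y q) (Z q)) p v
      = mderiv AF (\<lambda>q. gV q (Y q) (Z q)) p v + r * mderiv AF (\<lambda>q. gH q (Y q) (Z q)) p v"
    if Y: "smooth_vf AF Y" and Z: "smooth_vf AF Z" for Y Z v
    unfolding g_scaled
    using F.mderiv_add[OF open_UNIV UNIV_I smooth_gV[OF Y Z]
        F.smooth_fn_mult[OF open_UNIV F.smooth_fn_const[of _ r] smooth_gH[OF Y Z]]]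
      F.mderiv_mult[OF open_UNIV UNIV_I F.smooth_fn_const[of _ r] smooth_gH[OF Y Z]]
    by (simp add: F.mderiv_const)
  then show ?thesis using X Y Z by (simp add: koszul_def g_scaled algebra_simps)
qed

text \<open>The right-hand side does not depend on \<open>r\<close>: the contribution of \<open>gH\<close> to Koszul's formula
  is absorbed by the direct sum connection.\<close>

lemma g_scaled_difference:
  assumes r: "r \<ge> 1" and XYZ: "smooth_vf AF X" "smooth_vf AF Y" "smooth_vf AF Z"
  shows "2 * g_scaled r p (Dr r Y p (X p) - Dsum Y p (X p)) (Z p)
    = koszul AF gV X Y Z p - 2 * gV p (Dsum Y p (X p)) (Z p)"
proof -
  have "2 * g_scaled r p (Dr r Y p (X p)) (Z p) = koszul AF gV X Y Z p + r * koszul AF gH X Y Z p"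
    using levi_civita_koszul[OF inner_g_scaled[OF r] Dr[OF r] XYZ] koszul_g_scaled[OF XYZ] by simp
  then show ?thesis
    by (simp add: linear_diff[OF linear_g_scaled] koszul_gH[OF XYZ, symmetric])
      (simp add: g_scaled algebra_simps)
qed

text \<open>Both sides have the same pairing with every \<open>z\<close> under the metric for
  \<open>r\<close>, which is nondegenerate. The left pairing is independent of \<open>r\<close> and
  so may be computed at \<open>r = 1\<close>; on the right, \<open>1 / r\<close> compensates the
  weight of \<open>gH\<close>, and \<open>gV\<close> sees only the vertical part.\<close>

lemma Dr_difference:
  fixes p :: 'a and v :: 'e
  assumes r: "r \<ge> 1" and Y: "smooth_vf AF Y"
  defines "s \<equiv> Dr 1 Y p v - Dsum Y p v"
  shows "Dr r Y p v - Dsum Y p v = proj p s + (1 / r) *\<^sub>R (s - proj p s)" (is "?a = ?b")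
proof -
  obtain X where X: "smooth_vf AF X" "X p = v" by (rule F.vf_through)
  have "g_scaled r p ?a z = g_scaled r p ?b z" for z
  proof -
    obtain Z where Z: "smooth_vf AF Z" "Z p = z" by (rule F.vf_through)
    have "g_scaled r p ?a z = g_scaled 1 p s z"
      using g_scaled_difference[OF r X(1) Y Z(1), of p] g_scaled_difference[OF order_refl X(1) Y Z(1), of p]
      by (simp add: X Z s_def)
    also have "\<dots> = g_scaled r p ?b z"
    proof -
      have "gV p (proj p s) z = gV p s z" "gV p (s - proj p s) z = 0"
        by (simp_all add: gV_def proj_V proj gV_horizontal[OF proj(2), unfolded gV_def])
      moreover have "gH p (proj p s) z = 0" by (rule gH_vertical[OF dp_proj])
      ultimately show ?thesis
        using r by (simp add: g_scaled linear_add[OF linear_gV] linear_add[OF linear_gH]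
            linear_scale[OF linear_gV] linear_scale[OF linear_gH] linear_diff[OF linear_gH])
    qed
    finally show ?thesis .
  qed
  then have "g_scaled r p (?a - ?b) (?a - ?b) = 0" by (simp only: linear_diff[OF linear_g_scaled])
  then show ?thesis using g_scaled_eq_0[OF r, of p "?a - ?b"] by simp
qed

text \<open>The lift is in the kernel of \<open>gV\<close>, so three of the six terms of Koszul's
  expression drop out. The remaining derivative along the lift and the two brackets with it are
  twice the formula prescribed for \<open>DV\<close> in horizontal directions.\<close>

lemma koszul_gV_lift:
  assumes K: "smooth_vf AM K" and Y: "section_of AF V Y" and Z: "section_of AF V Z"
  shows "koszul AF gV (lift K) Y Z p = 2 * gV p (Dsum Y p (lift K p)) (Z p)"
proof -
  have V: "dp q (Y q) = 0" "dp q (Z q) = 0" "proj q (Y q) = Y q" "proj q (Z q) = Z q" for q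
    using Y Z proj_V by (simp_all add: section_of_def V_iff)
  have Ys: "smooth_vf AF Y" and Zs: "smooth_vf AF Z" using Y Z by (simp_all add: section_of_def)
  have br: "dp p (lie_bracket AF (lift K) U p) = 0" if "section_of AF V U" for U
    by (rule lie_bracket_vertical(2)[OF that smooth_hor_lift[OF K] K hor_lift(2)])
  have P: "proj p (lie_bracket AF (lift K) U p) = lie_bracket AF (lift K) U p" if "section_of AF V U" for U
    by (rule proj_V) (simp add: V_iff br that)
  have D: "proj p (Dsum Y p (lift K p)) = DV Y p (lift K p)"
    using proj_V[OF Dsum_in_V[OF Y]] by (simp add: Dsum_vertical[OF Y])
  have 0: "gV q (lift K q) z = 0" "gV q z (lift K q) = 0" for q z
    using gV_horizontal[OF hor_lift(1)] gV_sym by metis+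
  have "g p (DV Y p (lift K p)) (Z p) = 1/2 * (g p (lie_bracket AF (lift K) Y p) (Z p)
      - g p (lie_bracket AF (lift K) Z p) (Y p) + mderiv AF (\<lambda>q. g q (Y q) (Z q)) p (lift K p))"
    by (rule DV[unfolded vertical_connection_def, THEN conjunct2, THEN conjunct2, rule_format,
          OF conjI[OF K conjI[OF Y Z]], unfolded Let_def])
  then show ?thesis
    by (simp add: koszul_def 0 F.mderiv_const) (simp add: gV_def V P[OF Y] P[OF Z] D)
qed

text \<open>Vertical fields restrict to the fibre through \<open>p\<close> and can be moved to the
  typical fibre, where \<open>DV\<close> becomes a Levi-Civita connection and satisfies Koszul's
  formula. Each of the six terms survives the transport: derivatives by the chain rule, brackets
  because the fields are related by the inclusion.\<close>

lemma koszul_gV_vertical: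
  assumes X: "section_of AF V X" and Y: "section_of AF V Y" and Z: "section_of AF V Z"
  shows "koszul AF gV X Y Z p = 2 * gV p (Dsum Y p (X p)) (Z p)"
proof -
  obtain U T y where T: "local_trivialization AF AM AC \<pi> U T" "\<pi> p \<in> U" "p = T (\<pi> p, y)"
    by (rule triv_through)
  define x where "x = \<pi> p"
  define \<iota> where "\<iota> = (\<lambda>y. T (x, y))"
  define g' where "g' = pullback_metric AC AF \<iota> g"
  have x: "x \<in> U" using T by (simp add: x_def)
  have py: "\<iota> y = p" using T(3) by (simp add: \<iota>_def x_def)
  interpret CF: manifold_pair AC AF by unfold_locales
  note sm = smooth_fibre_map[OF T(1) x, folded \<iota>_def]
  note lin = linear_fibre_map[OF T(1) x, folded \<iota>_def]
  have dpi: "dp (\<iota> z) (mdiff AC AF \<iota> z u) = 0" for z u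
    using dp_fibre_map[OF T(1) x, of z u] by (simp add: \<iota>_def)
  \<comment> \<open>The differential of \<open>fibre_coord\<close> is a left inverse. Injectivity
    makes the metric on the typical fibre positive definite.\<close>
  have inj: "mdiff AC AF \<iota> z u = 0 \<Longrightarrow> u = 0" for z u
  proof -
    assume "mdiff AC AF \<iota> z u = 0"
    moreover have "linear (mdiff AF AC (fibre_coord U T) (\<iota> z))"
      by (rule manifold_pair.linear_mdiff[OF _ smooth_fibre_coord[OF T(1)] open_total[OF T(1)]])
        (use fibre_map_total[OF T(1) x, of z] in \<open>unfold_locales, simp_all add: \<iota>_def\<close>)
    ultimately show "u = 0"
      using d_fibre_coord_fibre_map[OF T(1) x, of z u] by (simp add: \<iota>_def linear_0)
  qed
  define F' where "F' X = fibre_field U T x X" for X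
  have F': "smooth_vf AC (F' S)" "mdiff AC AF \<iota> z (F' S z) = S (\<iota> z)" "smooth_vf AF S"
    "proj q (S q) = S q" if "section_of AF V S" for S z q
    using smooth_fibre_field[OF T(1) x, of S] fibre_field_related[OF T(1) x, of S] that proj_V
    by (simp_all add: F'_def section_V fields_related_def \<iota>_def V_iff)
  have gg: "g' z u w = gV (\<iota> z) (mdiff AC AF \<iota> z u) (mdiff AC AF \<iota> z w)" for z u w
    by (simp add: g'_def pullback_metric_def gV_def proj_V V_iff dpi)
  have inner': "inner_product_on UNIV (g' z)" for z
    unfolding inner_product_on_def gg
  proof (intro conjI ballI allI impI)
    fix u :: 'k assume "u \<noteq> 0"
    then have "mdiff AC AF \<iota> z u \<noteq> 0" using inj by blast
    moreover have "proj (\<iota> z) (mdiff AC AF \<iota> z u) = mdiff AC AF \<iota> z u" by (simp add: proj_V V_iff dpi)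
    ultimately show "gV (\<iota> z) (mdiff AC AF \<iota> z u) (mdiff AC AF \<iota> z u) > 0"
      using gV_nonneg gV_eq_0 by (metis less_eq_real_def)
  qed (rule gV_sym, simp_all add: linear_add[OF lin] linear_scale[OF lin]
      linear_add[OF linear_gV] linear_scale[OF linear_gV])
  have "\<exists>DC. levi_civita AC (pullback_metric AC AF \<iota> g) DC \<and>
      (\<forall>X Y Z X' Y'.
         section_of AF V X \<and> section_of AF V Y \<and> section_of AF V Z \<and> smooth_vf AC X' \<and>
         smooth_vf AC Y' \<and> fields_related AC AF \<iota> X' X \<and> fields_related AC AF \<iota> Y' Y \<longrightarrow>
         (\<forall>y. g (\<iota> y) (DV Y (\<iota> y) (X (\<iota> y))) (Z (\<iota> y)) =
              g (\<iota> y) (mdiff AC AF \<iota> y (DC Y' y (X' y))) (Z (\<iota> y))))"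
    unfolding \<iota>_def
    by (rule DV[unfolded vertical_connection_def, THEN conjunct2, THEN conjunct1, rule_format,
        OF conjI[OF T(1) x], unfolded Let_def])
  then obtain DC where "levi_civita AC (pullback_metric AC AF \<iota> g) DC" and
    DCV: "\<And>X Y Z X' Y' y. section_of AF V X \<and> section_of AF V Y \<and> section_of AF V Z \<and>
      smooth_vf AC X' \<and> smooth_vf AC Y' \<and> fields_related AC AF \<iota> X' X \<and> fields_related AC AF \<iota> Y' Y \<Longrightarrow>
      g (\<iota> y) (DV Y (\<iota> y) (X (\<iota> y))) (Z (\<iota> y)) = g (\<iota> y) (mdiff AC AF \<iota> y (DC Y' y (X' y))) (Z (\<iota> y))"
    by blast
  then have DC: "levi_civita AC g' DC" by (simp add: g'_def)
  have rel: "fields_related AC AF \<iota> (F' S) S" if "section_of AF V S" for S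
    using F'(2)[OF that] by (simp add: fields_related_def)
  have "2 * gV p (Dsum Y p (X p)) (Z p) = 2 * g' y (DC (F' Y) y (F' X y)) (F' Z y)"
  proof -
    have "g p (DV Y p (X p)) (Z p) = g p (mdiff AC AF \<iota> y (DC (F' Y) y (F' X y))) (Z p)"
      using DCV[of X Y Z "F' X" "F' Y" y] X Y Z F'(1)[OF X] F'(1)[OF Y] rel[OF X] rel[OF Y]
      by (simp add: py)
    moreover have "proj p (Dsum Y p (X p)) = DV Y p (X p)"
      using proj_V[OF Dsum_in_V[OF Y]] by (simp add: Dsum_vertical[OF Y])
    ultimately show ?thesis
      by (simp add: gV_def F'(4)[OF Z] g'_def pullback_metric_def py F'(2)[OF Z])
  qed
  also have "\<dots> = koszul AC g' (F' X) (F' Y) (F' Z) y"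
    by (rule levi_civita_koszul[OF inner' DC F'(1)[OF X] F'(1)[OF Y] F'(1)[OF Z]])
  also have "\<dots> = koszul AF gV X Y Z p"
  proof -
    have m: "mderiv AC (\<lambda>z. g' z (F' R z) (F' S z)) y (F' Q y) = mderiv AF (\<lambda>q. gV q (R q) (S q)) p (Q p)"
      if R: "section_of AF V R" and S: "section_of AF V S" and Q: "section_of AF V Q" for Q R S
      using CF.mderiv_pullback[OF sm open_UNIV UNIV_I open_UNIV UNIV_I smooth_gV[OF F'(3)[OF R] F'(3)[OF S]], of y "F' Q y"]
      by (simp add: gg F'(2)[OF R] F'(2)[OF S] F'(2)[OF Q] py)
    have l: "g' y (lie_bracket AC (F' Q) (F' R) y) (F' S y) = gV p (lie_bracket AF Q R p) (S p)"
      if Q: "section_of AF V Q" and R: "section_of AF V R" and S: "section_of AF V S" for Q R S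
      using CF.mdiff_lie_bracket[OF sm open_UNIV UNIV_I F'(1)[OF Q] F'(3)[OF Q] F'(2)[OF Q]
          F'(1)[OF R] F'(3)[OF R] F'(2)[OF R], of y]
      by (simp add: gg F'(2)[OF S] py)
    show ?thesis
      unfolding koszul_def m[OF Y Z X] m[OF X Z Y] m[OF X Y Z] l[OF X Y Z] l[OF X Z Y] l[OF Y Z X] ..
  qed
  finally show ?thesis by simp
qed

text \<open>Splitting the direction \<open>v\<close> into a vertical and a lifted part matches the
  two conditions that characterise \<open>DV\<close>; in both cases the right-hand side of
  \<open>g_scaled_difference\<close> vanishes.\<close>

lemma Dr_difference_vertical:
  assumes Y: "section_of AF V Y"
  shows "proj p (Dr 1 Y p v - Dsum Y p v) = 0"
proof -
  let ?s = "\<lambda>v. Dr 1 Y p v - Dsum Y p v"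
  have Ys: "smooth_vf AF Y" using Y by (simp add: section_of_def)
  have Dr1: "connection AF (Dr 1)" using Dr[of 1] by (simp add: levi_civita_def)
  \<comment> \<open>The test field extends the vertical part of the difference itself: being
    vertical it removes the \<open>gH\<close> term, and the remaining pairing is the
    \<open>gV\<close> square of the difference.\<close>
  obtain Z where Z: "section_of AF V Z" "Z p = proj p (?s v)" using section_through proj(1) by blast
  have Zs: "smooth_vf AF Z" using Z by (simp add: section_of_def)
  have lin: "linear ?s"
    by (intro linear_compose_sub connection_linear[OF Dr1 Ys] connection_linear[OF connection_Dsum Ys])
  obtain W K where d: "section_of AF V W" "smooth_vf AM K" "v = W p + lift K p" by (rule decompose)
  have "g_scaled 1 p (?s (W p)) (Z p) = 0"
    using g_scaled_difference[OF order_refl _ Ys Zs, of W p] koszul_gV_vertical[OF d(1) Y Z(1), of p] d(1)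
    by (simp add: section_of_def)
  moreover have "g_scaled 1 p (?s (lift K p)) (Z p) = 0"
    using g_scaled_difference[OF order_refl smooth_hor_lift[OF d(2)] Ys Zs, of p]
      koszul_gV_lift[OF d(2) Y Z(1), of p] by simp
  ultimately have "g_scaled 1 p (?s v) (Z p) = 0"
    unfolding d(3) linear_add[OF lin] linear_add[OF linear_g_scaled] by simp
  moreover have "gH p (?s v) (Z p) = 0"
    using gH_sym[of p "?s v"] gH_vertical[of p "Z p"] Z by (simp add: dp_proj)
  ultimately have "gV p (?s v) (proj p (?s v)) = 0" by (simp add: g_scaled Z)
  then have "gV p (?s v) (?s v) = 0" by (simp add: gV_def proj_V proj)
  then show ?thesis by (rule gV_eq_0)
qed

end

theorem theorem3p2:
  fixes AF :: "('a::{t2_space,second_countable_topology}, real^'n) chart set"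
    and AM :: "('b::{t2_space,second_countable_topology}, 'm::real_inner) chart set"
    and AC :: "('c::{t2_space,second_countable_topology}, 'k::real_inner) chart set"
    and \<pi> :: "'a \<Rightarrow> 'b"
    and H :: "'a \<Rightarrow> (real^'n) set"
    and g :: "'a \<Rightarrow> real^'n \<Rightarrow> real^'n \<Rightarrow> real"
    and gM :: "'b \<Rightarrow> 'm \<Rightarrow> 'm \<Rightarrow> real"
    and DM :: "('b, 'm) cov_deriv"
    and DV DH Dsum Dlim :: "('a, real^'n) cov_deriv"
    and Dr :: "real \<Rightarrow> ('a, real^'n) cov_deriv"
  assumes "smooth_fibration AF AM AC \<pi>"
    and "bundle_metric AM (\<lambda>_. UNIV) gM"
    and "bundle_metric AF (vertical AF AM \<pi>) g"
    and "smooth_subbundle AF H"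
    and "complementary (vertical AF AM \<pi>) H"
    and "levi_civita AM gM DM"
    and "\<And>r. r \<ge> 1 \<Longrightarrow> levi_civita AF (scaled_metric AF AM \<pi> H g gM r) (Dr r)"
    and "vertical_connection AF AM AC \<pi> H g DV"
    and "horizontal_connection AF AM \<pi> H DM DH"
    and "Dsum = sum_connection (vertical AF AM \<pi>) H DV DH"
    and "Dlim = limit_connection AF Dsum Dr"
  shows "(\<forall>p v. \<exists>S. ((\<lambda>r. conn_diff AF Dsum (Dr r) p v) \<longlongrightarrow> S) at_top) \<and>
         connection AF Dlim \<and>
         CS_equivalent AF Dlim Dsum"
proof -
  interpret scaled_fibration AF AM AC \<pi> H g gM DM DV DH Dr
    by unfold_locales (use assms in auto)
  note mf = manifolds(1)
  have Ds: "connection AF Dsum" using connection_Dsum by (simp add: assms(10))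
  have Drc: "connection AF (Dr r)" if "r \<ge> 1" for r using Dr[OF that] by (simp add: levi_civita_def)
  let ?S = "\<lambda>r p v. conn_diff AF Dsum (Dr r) p v"
  note S = conn_diff_mult[OF mf Ds Drc]
  \<comment> \<open>The candidate for the limit, the vertical part of the difference tensor at
    \<open>r = 1\<close>: by \<open>Dr_difference\<close> this part is the same for all
    \<open>r\<close>, and the horizontal part decays.\<close>
  define L where "L p v = matrix (\<lambda>w. proj p (?S 1 p v *v w))" for p v
  have L: "L p v *v w = proj p (?S 1 p v *v w)" for p v w
    unfolding L_def using linear_compose[OF matrix_vector_mul_linear linear_proj]
    by (intro matrix_vector_linear) (simp add: o_def)
  have LY: "L p v *v Y p = proj p (Dr 1 Y p v - Dsum Y p v)" if "smooth_vf AF Y" for p v Y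
    by (simp add: L S[OF _ that])
  have Sr: "?S r p v = L p v + (1 / r) *\<^sub>R (?S 1 p v - L p v)" if r: "r \<ge> 1" for r p v
  proof (rule conn_diff_unique[OF mf])
    fix Y assume Y: "smooth_vf AF Y"
    show "(L p v + (1 / r) *\<^sub>R (?S 1 p v - L p v)) *v Y p = Dr r Y p v - Dsum Y p v"
      using Dr_difference[OF r Y, of p v] S[OF _ Y, of 1 p v] LY[OF Y, of p v]
      by (simp add: assms(10) matrix_vector_mult_add_rdistrib matrix_vector_mult_diff_rdistrib
          scaleR_matrix_vector_assoc[symmetric])
  qed
  have lim: "((\<lambda>r. ?S r p v) \<longlongrightarrow> L p v) at_top" for p v
  proof -
    have "((\<lambda>r::real. 1 / r) \<longlongrightarrow> 0) at_top"
      by (intro tendsto_divide_0[OF tendsto_const] filterlim_at_top_imp_at_infinity filterlim_ident)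
    then have "((\<lambda>r. L p v + (1 / r) *\<^sub>R (?S 1 p v - L p v)) \<longlongrightarrow> L p v + 0 *\<^sub>R (?S 1 p v - L p v)) at_top"
      by (intro tendsto_add tendsto_const tendsto_scaleR)
    then have "((\<lambda>r. L p v + (1 / r) *\<^sub>R (?S 1 p v - L p v)) \<longlongrightarrow> L p v) at_top" by simp
    moreover have "\<forall>\<^sub>F r in at_top. L p v + (1 / r) *\<^sub>R (?S 1 p v - L p v) = ?S r p v"
      using eventually_ge_at_top[of "1::real"] by (rule eventually_mono) (rule Sr[symmetric])
    ultimately show ?thesis by (rule Lim_transform_eventually)
  qed
  have Dlim: "Dlim Y p v = Dsum Y p v + L p v *v Y p" for Y p v
    unfolding assms(11) limit_connection_def using tendsto_Lim[OF _ lim] by simp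
  \<comment> \<open>On smooth fields the matrix can be traded for derivatives by known connections,
    so linearity in \<open>v\<close> and smoothness come from those of \<open>Dsum\<close>,
    \<open>Dr 1\<close> and the projection.\<close>
  have DlimY: "Dlim Y p v = Dsum Y p v + proj p (Dr 1 Y p v - Dsum Y p v)" if "smooth_vf AF Y" for Y p v
    by (simp add: Dlim LY[OF that])
  have Dl: "connection AF Dlim"
  proof (rule connectionI)
    show "linear (Dlim Y p)" if Y: "smooth_vf AF Y" for Y p
    proof -
      have "linear (\<lambda>v. Dsum Y p v + proj p (Dr 1 Y p v - Dsum Y p v))"
        by (intro linear_compose_add linear_compose[OF _ linear_proj, unfolded o_def] linear_compose_sub
            connection_linear[OF Ds Y] connection_linear[OF Drc Y] order_refl)
      moreover have "Dlim Y p = (\<lambda>v. Dsum Y p v + proj p (Dr 1 Y p v - Dsum Y p v))"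
        by (rule ext) (rule DlimY[OF Y])
      ultimately show ?thesis by (simp only:)
    qed
    show "smooth_vf AF (\<lambda>p. Dlim Y p (X p))" if "smooth_vf AF X" "smooth_vf AF Y" for X Y
      unfolding DlimY[OF that(2)]
      by (intro F.smooth_vf_on_add smooth_proj F.smooth_vf_on_diff open_UNIV connection_smooth[OF Ds]
          connection_smooth[OF Drc] that order_refl)
  qed (simp_all add: Dlim connection_add[OF Ds] connection_scaleR[OF Ds] matrix_vector_right_distrib
      matrix_vector_mult_scaleR algebra_simps)
  have minus: "(- M) *v w = - (M *v w)" for M :: "real^'n^'n" and w
    using matrix_vector_mult_diff_rdistrib[of 0 M w] by simp
  \<comment> \<open>The curve runs from \<open>Dlim\<close> to \<open>Dsum\<close>, so its velocity
    is \<open>- L\<close>; the sign does not affect the block shape.\<close>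
  have B: "conn_diff AF Dlim Dsum p v = - L p v" for p v
    by (rule conn_diff_unique[OF mf]) (simp add: Dlim minus)
  have LV: "L p v *v w = 0" if w: "w \<in> V p" for p v w
  proof -
    obtain Y where Y: "section_of AF V Y" "Y p = w" using section_through[OF w] by blast
    then show ?thesis
      using LY[of Y p v] Dr_difference_vertical[OF Y(1), of p v] by (simp add: assms(10) section_of_def)
  qed
  have "CS_equivalent AF Dlim Dsum"
  proof (rule CS_equivalentI[OF mf Dl Ds VH subspace_V subspace_H])
    fix Y p v assume Y: "section_of AF V Y"
    show "Dsum Y p v \<in> V p" using Dsum_in_V[OF Y] by (simp add: assms(10))
    then show "Dlim Y p v \<in> V p"
      unfolding Dlim by (intro subspace_add subspace_V) (simp_all add: L proj)
  next
    fix p v w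
    show "conn_diff AF Dlim Dsum p v *v w \<in> V p"
      using subspace_neg[OF subspace_V proj(1)] by (simp add: B L minus)
    show "conn_diff AF Dlim Dsum p v *v w = 0" if "w \<in> V p"
      using LV[OF that] by (simp add: B minus)
  qed (rule section_through)
  then show ?thesis using lim Dl by blast
qed

end
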